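(* The relation $<$ is a linear ordering on $B_\bullet$ that is compatible with multiplication on the left ($x<x'$ implies $yx<yx'$ for all $y$), and with the shift endomorphism $\partial$ ($x<x'$ implies $\partial x<\partial x'$). This linear ordering extends the orders $<^+$ on $B_\bullet^+$, $<_B$ on $B_\infty$, and $<_F$ on $F$.
   Context: $B_\bullet$ is the group (of parenthesized braids) presented by generators $\sigma_i,a_i$ ($i\ge1$) and the relations, for all $i\ge1$ and $j\ge i+2$: $\sigma_i\sigma_j=\sigma_j\sigma_i$, $\sigma_ia_j=a_j\sigma_i$, $a_ia_{j-1}=a_ja_i$, $a_i\sigma_{j-1}=\sigma_ja_i$, $\sigma_i\sigma_{i+1}\sigma_i=\sigma_{i+1}\sigma_i\sigma_{i+1}$, $\sigma_{i+1}\sigma_ia_{i+1}=a_i\sigma_i$, $\sigma_i\sigma_{i+1}a_i=a_{i+1}\sigma_i$. The shift $\partial$ is the injective endomorphism with $\sigma_i\mapsto\sigma_{i+1}$, $a_i\mapsto a_{i+1}$. $B_\bullet^+$ is the submonoid generated by all $\sigma_i,a_i$. $B_\infty$ and $F$ (copies of Artin's braid group and Thompson's group) are the subgroups generated by the $\sigma_i$'s and by the $a_i$'s; $B_\infty^+$ and $F^+$ are the submonoids generated by the $\sigma_i$'s and by the $a_i$'s. Every element of $B_\bullet^+$ can be written uniquely as $\beta f$ with $\beta\in B_\infty^+$, $f\in F^+$, and every element of $B_\bullet$ can be written as $x^{-1}y$ with $x,y\in B_\bullet^+$. Order $<_B$: for $\beta,\beta'\in B_\infty$, $\beta<_B\beta'$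 iff $\beta^{-1}\beta'$ has an expression as a word in the $\sigma_j^{\pm1}$ in which, $i$ being the minimal index occurring, $\sigma_i$ occurs but $\sigma_i^{-1}$ does not (this is known to be a left-invariant linear order on $B_\infty$). Order $<_F$: finite binary trees (either $\bullet$, or $t_1t_2$) are linearly ordered by: $\bullet\prec t_1t_2$ always, and $t_1t_2\prec t_1't_2'$ iff $t_1\prec t'_1$, or $t_1=t_1'$ and $t_2\prec t_2'$. For a tree $t$, $\mathrm{ev}(t)\in F^+$ is defined by $\mathrm{ev}(\bullet)=1$, $\mathrm{ev}(t_1t_2)=\mathrm{ev}(t_1)\cdot\partial\,\mathrm{ev}(t_2)\cdot a_1$; $\mathrm{ev}$ is injective. Every $f\in F^+$ can be written as $\mathrm{ev}(t_1)\cdot\partial\,\mathrm{ev}(t_2)\cdots\partial^{p-1}\mathrm{ev}(t_p)$, the sequence $(t_1,t_2,\dots)$ being unique up to appending trees $\bullet$ at the end. For $f,f'\in F^+$, $f<_Ff'$ iff the tree sequence of $f$ (continued by $\bullet$'s) is lexicographically $\prec$-smaller than that of $f'$. This is a left-invariant linear order on $F^+$, and it is extended to $F$ by left invariance: $f<_Ff'$ iff $hf<_Fhf'$ for $h\in F^+$ such that $hf,hf'\in F^+$. Order $<^+$: for $x=\beta f$, $x'=\beta'f'$ in $B_\bullet^+$ (with $\beta,\beta'\in B_\infty^+$, $f,f'\in F^+$), $x<^+x'$ iff $\beta<_B\beta'$, or $\beta=\beta'$ and $f<_Ff'$. Relation $<$: let $C$ be the set of all elements of $B_\bullet$ that can be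 written as $x^{-1}x'$ with $x,x'\in B_\bullet^+$ and $x<^+x'$. For $x,x'\in B_\bullet$, $x<x'$ iff $x^{-1}x'\in C$. *)

theory Defs
  imports "HOL-Algebra.Generated_Groups" HOL.Hull
begin

section \<open>Groups given by a presentation\<close>

text \<open>A letter \<open>(g, True)\<close> stands for the generator \<open>g\<close>, and \<open>(g, False)\<close> for its inverse.\<close>

type_synonym 'g word = "('g \<times> bool) list"

definition words :: "'g set \<Rightarrow> 'g word set" where
  "words S = lists (S \<times> UNIV)"

definition pos_word :: "'g list \<Rightarrow> 'g word" where
  "pos_word = map (\<lambda>g. (g, True))"

inductive pres_eq :: "'g set \<Rightarrow> ('g word \<times> 'g word) set \<Rightarrow> 'g word \<Rightarrow> 'g word \<Rightarrow> bool"
  for S R where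
  refl: "w \<in> words S \<Longrightarrow> pres_eq S R w w"
| sym: "pres_eq S R v w \<Longrightarrow> pres_eq S R w v"
| trans: "pres_eq S R u v \<Longrightarrow> pres_eq S R v w \<Longrightarrow> pres_eq S R u w"
| cancel: "u \<in> words S \<Longrightarrow> v \<in> words S \<Longrightarrow> g \<in> S \<Longrightarrow>
    pres_eq S R (u @ [(g, b), (g, \<not> b)] @ v) (u @ v)"
| rel: "u \<in> words S \<Longrightarrow> v \<in> words S \<Longrightarrow> (l, r) \<in> R \<Longrightarrow>
    l \<in> words S \<Longrightarrow> r \<in> words S \<Longrightarrow> pres_eq S R (u @ l @ v) (u @ r @ v)"

definition pres_rel :: "'g set \<Rightarrow> ('g word \<times> 'g word) set \<Rightarrow> ('g word \<times> 'g word) set" where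
  "pres_rel S R = {(v, w). pres_eq S R v w}"

definition pres_class :: "'g set \<Rightarrow> ('g word \<times> 'g word) set \<Rightarrow> 'g word \<Rightarrow> 'g word set" where
  "pres_class S R w = pres_rel S R `` {w}"

definition presented_group :: "'g set \<Rightarrow> ('g word \<times> 'g word) set \<Rightarrow> 'g word set monoid" where
  "presented_group S R =
    \<lparr>carrier = words S // pres_rel S R,
     mult = (\<lambda>X Y. \<Union>v\<in>X. \<Union>w\<in>Y. pres_class S R (v @ w)),
     one = pres_class S R []\<rparr>"

lemma words_append [simp]: "v @ w \<in> words S \<longleftrightarrow> v \<in> words S \<and> w \<in> words S"
  by (auto simp: words_def)

lemma words_Nil [simp]: "[] \<in> words S"
  by (auto simp: words_def)

lemma words_Cons [simp]: "(g, b) # w \<in> words S \<longleftrightarrow> g \<in> S \<and> w \<in> words S"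
  by (auto simp: words_def)

lemma pres_eq_words: "pres_eq S R v w \<Longrightarrow> v \<in> words S \<and> w \<in> words S"
  by (induction rule: pres_eq.induct) auto

lemma equiv_pres_rel: "equiv (words S) (pres_rel S R)"
  by (rule equivI)
     (auto simp: pres_rel_def refl_on_def sym_def trans_def
           intro: pres_eq.intros dest: pres_eq_words)

lemma pres_eq_append_ctxt:
  assumes "pres_eq S R v w" "x \<in> words S" "y \<in> words S"
  shows "pres_eq S R (x @ v @ y) (x @ w @ y)"
  using assms
proof (induction rule: pres_eq.induct)
  case (refl w) then show ?case by (intro pres_eq.refl) auto
next
  case (sym v w) then show ?case by (blast intro: pres_eq.sym)
next
  case (trans u v w) then show ?case by (blast intro: pres_eq.trans)
next
  case (cancel u v g b)
  then show ?case using pres_eq.cancel[of "x @ u" S "v @ y" g R b] by simp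
next
  case (rel u v l r)
  then show ?case using pres_eq.rel[of "x @ u" S "v @ y" l r R] by simp
qed

lemma pres_eq_append:
  assumes "pres_eq S R v v'" "pres_eq S R w w'"
  shows "pres_eq S R (v @ w) (v' @ w')"
  using pres_eq_append_ctxt[OF assms(1), of "[]" w] pres_eq_append_ctxt[OF assms(2), of v' "[]"]
    pres_eq_words[OF assms(1)] pres_eq_words[OF assms(2)]
  by (auto intro: pres_eq.trans)

lemma pres_class_eq_iff:
  assumes "v \<in> words S" "w \<in> words S"
  shows "pres_class S R v = pres_class S R w \<longleftrightarrow> pres_eq S R v w"
  using eq_equiv_class_iff[OF equiv_pres_rel assms] by (auto simp: pres_class_def pres_rel_def)

lemma carrier_presented_group:
  "carrier (presented_group S R) = pres_class S R ` words S"
  by (auto simp: presented_group_def quotient_def pres_class_def)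

lemma mem_pres_class [simp]: "v \<in> pres_class S R w \<longleftrightarrow> pres_eq S R w v"
  by (simp add: pres_class_def pres_rel_def)

lemma mult_pres_class:
  assumes "v \<in> words S" "w \<in> words S"
  shows "pres_class S R v \<otimes>\<^bsub>presented_group S R\<^esub> pres_class S R w = pres_class S R (v @ w)"
proof -
  have *: "pres_class S R (v' @ w') = pres_class S R (v @ w)"
    if "v' \<in> pres_class S R v" "w' \<in> pres_class S R w" for v' w'
  proof -
    from that have "pres_eq S R (v @ w) (v' @ w')"
      by (simp add: pres_eq_append)
    then show ?thesis
      using pres_eq_words by (metis pres_class_eq_iff)
  qed
  have "v \<in> pres_class S R v" "w \<in> pres_class S R w"
    using assms by (simp_all add: pres_eq.refl)
  then have "(\<Union>v'\<in>pres_class S R v. \<Union>w'\<in>pres_class S R w. pres_class S R (v' @ w'))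
      = pres_class S R (v @ w)"
    using * by blast
  then show ?thesis by (simp add: presented_group_def)
qed

definition inv_word :: "'g word \<Rightarrow> 'g word" where
  "inv_word w = rev (map (\<lambda>(g, b). (g, \<not> b)) w)"

lemma pres_eq_inverse:
  "w \<in> words S \<Longrightarrow> pres_eq S R (inv_word w @ w) [] \<and> inv_word w \<in> words S"
proof (induction w)
  case Nil then show ?case by (simp add: inv_word_def pres_eq.refl)
next
  case (Cons p w)
  obtain g b where p: "p = (g, b)" by fastforce
  from Cons p have *: "pres_eq S R (inv_word w @ w) []" "inv_word w \<in> words S" "g \<in> S" "w \<in> words S"
    by simp_all
  then have "pres_eq S R (inv_word w @ [(g, \<not> b), (g, \<not> \<not> b)] @ w) (inv_word w @ w)"
    by (intro pres_eq.cancel)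
  then have "pres_eq S R (inv_word w @ [(g, \<not> b), (g, \<not> \<not> b)] @ w) []"
    using *(1) by (rule pres_eq.trans)
  with * p show ?case by (simp add: inv_word_def)
qed

lemma one_presented_group: "\<one>\<^bsub>presented_group S R\<^esub> = pres_class S R []"
  by (simp add: presented_group_def)

lemma group_presented_group: "group (presented_group S R)"
proof (rule groupI)
  fix x assume "x \<in> carrier (presented_group S R)"
  then obtain w where w: "w \<in> words S" "x = pres_class S R w"
    by (auto simp: carrier_presented_group)
  have *: "pres_eq S R (inv_word w @ w) []" "inv_word w \<in> words S"
    using pres_eq_inverse[OF w(1)] by simp_all
  then have "pres_class S R (inv_word w) \<otimes>\<^bsub>presented_group S R\<^esub> x = \<one>\<^bsub>presented_group S R\<^esub>"
    using w by (simp add: mult_pres_class one_presented_group pres_class_eq_iff)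
  moreover have "pres_class S R (inv_word w) \<in> carrier (presented_group S R)"
    using * by (simp add: carrier_presented_group)
  ultimately show "\<exists>y\<in>carrier (presented_group S R).
      y \<otimes>\<^bsub>presented_group S R\<^esub> x = \<one>\<^bsub>presented_group S R\<^esub>" by blast
qed (auto simp: carrier_presented_group mult_pres_class one_presented_group)


section \<open>The group of parenthesized braids\<close>

text \<open>\<open>Sig i\<close> is the letter \<open>\<sigma>\<^sub>i\<close> and \<open>Thm i\<close> (for Thompson) the letter \<open>a\<^sub>i\<close>; indices start at 1,
  so the index 0 is excluded from \<open>gens\<close>.\<close>

datatype gen = Sig nat | Thm nat

definition gens :: "gen set" where
  "gens = Sig ` {1..} \<union> Thm ` {1..}"

inductive_set rels :: "(gen word \<times> gen word) set" where
  sig_sig: "1 \<le> i \<Longrightarrow> i + 2 \<le> j \<Longrightarrow>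
    (pos_word [Sig i, Sig j], pos_word [Sig j, Sig i]) \<in> rels"
| sig_thm: "1 \<le> i \<Longrightarrow> i + 2 \<le> j \<Longrightarrow>
    (pos_word [Sig i, Thm j], pos_word [Thm j, Sig i]) \<in> rels"
| thm_thm: "1 \<le> i \<Longrightarrow> i + 2 \<le> j \<Longrightarrow>
    (pos_word [Thm i, Thm (j - 1)], pos_word [Thm j, Thm i]) \<in> rels"
| thm_sig: "1 \<le> i \<Longrightarrow> i + 2 \<le> j \<Longrightarrow>
    (pos_word [Thm i, Sig (j - 1)], pos_word [Sig j, Thm i]) \<in> rels"
| braid: "1 \<le> i \<Longrightarrow>
    (pos_word [Sig i, Sig (i + 1), Sig i], pos_word [Sig (i + 1), Sig i, Sig (i + 1)]) \<in> rels"
| sig_sig_thm: "1 \<le> i \<Longrightarrow>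
    (pos_word [Sig (i + 1), Sig i, Thm (i + 1)], pos_word [Thm i, Sig i]) \<in> rels"
| sig_sig_thm': "1 \<le> i \<Longrightarrow>
    (pos_word [Sig i, Sig (i + 1), Thm i], pos_word [Thm (i + 1), Sig i]) \<in> rels"

definition PB :: "gen word set monoid" where
  "PB = presented_group gens rels"

definition PB_class :: "gen word \<Rightarrow> gen word set" where
  "PB_class = pres_class gens rels"

definition sig :: "nat \<Rightarrow> gen word set" where
  "sig i = PB_class [(Sig i, True)]"

definition thm_gen :: "nat \<Rightarrow> gen word set" where
  "thm_gen i = PB_class [(Thm i, True)]"

fun shift_gen :: "gen \<Rightarrow> gen" where
  "shift_gen (Sig i) = Sig (i + 1)"
| "shift_gen (Thm i) = Thm (i + 1)"

definition shift_word :: "gen word \<Rightarrow> gen word" where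
  "shift_word = map (map_prod shift_gen id)"

definition shift :: "gen word set \<Rightarrow> gen word set" where
  "shift X = (\<Union>w\<in>X. PB_class (shift_word w))"

interpretation PB: group PB
  unfolding PB_def by (rule group_presented_group)

lemma carrier_PB: "carrier PB = PB_class ` words gens"
  by (simp add: PB_def PB_class_def carrier_presented_group)

lemma PB_class_mult:
  "v \<in> words gens \<Longrightarrow> w \<in> words gens \<Longrightarrow> PB_class v \<otimes>\<^bsub>PB\<^esub> PB_class w = PB_class (v @ w)"
  unfolding PB_def PB_class_def by (rule mult_pres_class)

lemma shift_word_append [simp]: "shift_word (v @ w) = shift_word v @ shift_word w"
  by (simp add: shift_word_def)

lemma shift_word_Nil [simp]: "shift_word [] = []"
  by (simp add: shift_word_def)

lemma shift_word_Cons [simp]: "shift_word ((g, b) # w) = (shift_gen g, b) # shift_word w"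
  by (simp add: shift_word_def)

lemma shift_gen_gens [simp]: "g \<in> gens \<Longrightarrow> shift_gen g \<in> gens"
  by (auto simp: gens_def)

lemma shift_word_words [simp]: "w \<in> words gens \<Longrightarrow> shift_word w \<in> words gens"
  by (induction w) auto

lemma shift_word_rels: "(l, r) \<in> rels \<Longrightarrow> (shift_word l, shift_word r) \<in> rels"
proof (induction rule: rels.induct)
  case (sig_sig i j)
  then show ?case using rels.sig_sig[of "i + 1" "j + 1"] by (simp add: shift_word_def pos_word_def)
next
  case (sig_thm i j)
  then show ?case using rels.sig_thm[of "i + 1" "j + 1"] by (simp add: shift_word_def pos_word_def)
next
  case (thm_thm i j)
  then show ?case using rels.thm_thm[of "i + 1" "j + 1"] by (simp add: shift_word_def pos_word_def)
next
  case (thm_sig i j)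
  then show ?case using rels.thm_sig[of "i + 1" "j + 1"] by (simp add: shift_word_def pos_word_def)
next
  case (braid i)
  then show ?case using rels.braid[of "i + 1"] by (simp add: shift_word_def pos_word_def)
next
  case (sig_sig_thm i)
  then show ?case using rels.sig_sig_thm[of "i + 1"] by (simp add: shift_word_def pos_word_def)
next
  case (sig_sig_thm' i)
  then show ?case using rels.sig_sig_thm'[of "i + 1"] by (simp add: shift_word_def pos_word_def)
qed

lemma shift_word_pres_eq:
  "pres_eq gens rels v w \<Longrightarrow> pres_eq gens rels (shift_word v) (shift_word w)"
proof (induction rule: pres_eq.induct)
  case (cancel u v g b)
  then show ?case
    using pres_eq.cancel[of "shift_word u" gens "shift_word v" "shift_gen g" rels b]
    by simp
qed (auto intro: pres_eq.intros shift_word_rels)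

lemma shift_PB_class:
  assumes "w \<in> words gens"
  shows "shift (PB_class w) = PB_class (shift_word w)"
proof -
  have *: "PB_class (shift_word v) = PB_class (shift_word w)" if "v \<in> PB_class w" for v
  proof -
    from that have "pres_eq gens rels (shift_word w) (shift_word v)"
      by (simp add: PB_class_def shift_word_pres_eq)
    then show ?thesis
      unfolding PB_class_def using pres_eq_words by (metis pres_class_eq_iff)
  qed
  have "w \<in> PB_class w"
    using assms by (simp add: PB_class_def pres_eq.refl)
  with * show ?thesis unfolding shift_def by blast
qed

lemma shift_hom: "shift \<in> hom PB PB"
  by (auto simp: hom_def carrier_PB PB_class_mult shift_PB_class)

lemma shift_sig: "i \<ge> 1 \<Longrightarrow> shift (sig i) = sig (i + 1)"
  unfolding sig_def by (subst shift_PB_class) (auto simp: gens_def)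

lemma shift_thm_gen: "i \<ge> 1 \<Longrightarrow> shift (thm_gen i) = thm_gen (i + 1)"
  unfolding thm_gen_def by (subst shift_PB_class) (auto simp: gens_def)

definition submonoid_generated :: "('a, 'b) monoid_scheme \<Rightarrow> 'a set \<Rightarrow> 'a set" where
  "submonoid_generated G X = (\<lambda>H. submonoid H G) hull X"

definition PB_pos :: "gen word set set" where
  "PB_pos = submonoid_generated PB (sig ` {1..} \<union> thm_gen ` {1..})"

definition B_inf :: "gen word set set" where
  "B_inf = generate PB (sig ` {1..})"

definition F :: "gen word set set" where
  "F = generate PB (thm_gen ` {1..})"

definition B_inf_pos :: "gen word set set" where
  "B_inf_pos = submonoid_generated PB (sig ` {1..})"

definition F_pos :: "gen word set set" where
  "F_pos = submonoid_generated PB (thm_gen ` {1..})"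


section \<open>The orders\<close>

definition sigma_positive :: "gen word \<Rightarrow> bool" where
  "sigma_positive w \<longleftrightarrow>
    w \<in> words (Sig ` {1..}) \<and>
    (\<exists>i. (\<forall>(g, b)\<in>set w. \<exists>j\<ge>i. g = Sig j) \<and> (Sig i, True) \<in> set w \<and> (Sig i, False) \<notin> set w)"

text \<open>The relations below are strict, and given as sets of pairs of group elements.\<close>

definition less_B :: "(gen word set \<times> gen word set) set" where
  "less_B = {(\<beta>, \<beta>'). \<beta> \<in> B_inf \<and> \<beta>' \<in> B_inf \<and>
    (\<exists>w. sigma_positive w \<and> PB_class w = inv\<^bsub>PB\<^esub> \<beta> \<otimes>\<^bsub>PB\<^esub> \<beta>')}"

datatype tree = Leaf | Node tree tree

fun tree_less :: "tree \<Rightarrow> tree \<Rightarrow> bool" where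
  "tree_less Leaf (Node t1' t2') \<longleftrightarrow> True"
| "tree_less (Node t1 t2) (Node t1' t2') \<longleftrightarrow> tree_less t1 t1' \<or> t1 = t1' \<and> tree_less t2 t2'"
| "tree_less t Leaf \<longleftrightarrow> False"

fun ev :: "tree \<Rightarrow> gen word set" where
  "ev Leaf = \<one>\<^bsub>PB\<^esub>"
| "ev (Node t1 t2) = ev t1 \<otimes>\<^bsub>PB\<^esub> shift (ev t2) \<otimes>\<^bsub>PB\<^esub> thm_gen 1"

text \<open>\<open>ev_seq [t\<^sub>1, \<dots>, t\<^sub>p]\<close> is \<open>ev t\<^sub>1 \<cdot> \<partial> (ev t\<^sub>2) \<cdots> \<partial>\<^sup>p\<^sup>-\<^sup>1 (ev t\<^sub>p)\<close>; list positions start at 0.\<close>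

definition ev_seq :: "tree list \<Rightarrow> gen word set" where
  "ev_seq ts = foldr (\<lambda>i x. (shift ^^ i) (ev (ts ! i)) \<otimes>\<^bsub>PB\<^esub> x) [0..<length ts] \<one>\<^bsub>PB\<^esub>"

text \<open>Tree sequences are continued by \<open>Leaf\<close>, which makes the representing list irrelevant.\<close>

definition tree_at :: "tree list \<Rightarrow> nat \<Rightarrow> tree" where
  "tree_at ts n = (if n < length ts then ts ! n else Leaf)"

definition tree_seq_less :: "tree list \<Rightarrow> tree list \<Rightarrow> bool" where
  "tree_seq_less ts ts' \<longleftrightarrow>
    (\<exists>k. (\<forall>i<k. tree_at ts i = tree_at ts' i) \<and> tree_less (tree_at ts k) (tree_at ts' k))"

definition less_F_pos :: "(gen word set \<times> gen word set) set" where
  "less_F_pos = {(f, f'). f \<in> F_pos \<and> f' \<in> F_pos \<and>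
    (\<exists>ts ts'. f = ev_seq ts \<and> f' = ev_seq ts' \<and> tree_seq_less ts ts')}"

text \<open>By left invariance of \<open>less_F_pos\<close>, the choice of the left multiplier \<open>h\<close> does not matter.\<close>

definition less_F :: "(gen word set \<times> gen word set) set" where
  "less_F = {(f, f'). f \<in> F \<and> f' \<in> F \<and>
    (\<exists>h\<in>F_pos. h \<otimes>\<^bsub>PB\<^esub> f \<in> F_pos \<and> h \<otimes>\<^bsub>PB\<^esub> f' \<in> F_pos \<and>
      (h \<otimes>\<^bsub>PB\<^esub> f, h \<otimes>\<^bsub>PB\<^esub> f') \<in> less_F_pos)}"

definition less_PB_pos :: "(gen word set \<times> gen word set) set" where
  "less_PB_pos = {(x, x'). \<exists>\<beta>\<in>B_inf_pos. \<exists>f\<in>F_pos. \<exists>\<beta>'\<in>B_inf_pos. \<exists>f'\<in>F_pos.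
    x = \<beta> \<otimes>\<^bsub>PB\<^esub> f \<and> x' = \<beta>' \<otimes>\<^bsub>PB\<^esub> f' \<and>
    ((\<beta>, \<beta>') \<in> less_B \<or> \<beta> = \<beta>' \<and> (f, f') \<in> less_F_pos)}"

definition PB_cone :: "gen word set set" where
  "PB_cone = {inv\<^bsub>PB\<^esub> x \<otimes>\<^bsub>PB\<^esub> x' | x x'. x \<in> PB_pos \<and> x' \<in> PB_pos \<and> (x, x') \<in> less_PB_pos}"

definition less_PB :: "(gen word set \<times> gen word set) set" where
  "less_PB = {(x, x'). x \<in> carrier PB \<and> x' \<in> carrier PB \<and> inv\<^bsub>PB\<^esub> x \<otimes>\<^bsub>PB\<^esub> x' \<in> PB_cone}"

end

theory Submission
  imports Defs Complex_Main
begin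

text \<open>
  Everything is reduced to four facts. (1) \<open>PB\<close> acts on the colourings of the half-line by elements
  of a group: the \<open>a\<^sub>i\<close> act by piecewise linear reparametrisation and the \<open>\<sigma>\<^sub>i\<close> by the Hurwitz (Artin)
  action. On \<open>F\<close> this makes the tree order \<open>less_F_pos\<close> the order given by the first difference of
  increasing maps, which is left invariant by construction. (2) With colours in a free group,
  Larue's argument shows that a \<open>\<sigma>\<close>-positive word never represents an element of \<open>F\<close>; this gives at
  once the irreflexivity of \<open>less_B\<close>, the triviality of \<open>B_inf \<inter> F\<close> and the uniqueness of the
  decomposition \<open>\<beta> f\<close>. (3) Comparability of braids follows from self-distributivity: every positive
  braid is a product of shifted special braids, and special braids are compared through the
  confluence of left self-distributive expansion and the absorption property of right powers.
  (4) \<open>F_pos\<close>, \<open>B_inf_pos\<close> (Garside) and hence \<open>PB_pos\<close> have common left multiples, so that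
  the elements of the groups are left fractions. The positive cone is then closed
  under products because \<open>less_PB_pos\<close> is left invariant, for which the point is that pulling \<open>a\<^sub>k\<close>
  through a braid (cabling a strand) preserves \<open>\<sigma>\<close>-positivity.
\<close>

text \<open>The definition of \<open>less_PB_pos\<close> quantifies over decompositions, so nothing
  can be said about it before \<open>\<beta> f\<close> is known to be unique. Uniqueness needs a
  stage on which both kinds of elements are visible: positions are real because \<open>F\<close>
  subdivides cells, and colourings are stored as cumulative products so that \<open>F\<close> acts
  by mere precomposition while a braid exchanges unit cells. An element that is both a braid and in
  \<open>F\<close> is then an increasing map that preserves the integers and is the identity far
  out; it fixes every natural number and leaves the colours of the unit cells alone, whereas a
  \<open>\<sigma>\<close>-positive word changes one of them when the colours are free. The obstacle
  to left invariance is that \<open>a_k \<beta> = c a_m\<close> with \<open>m\<close> depending on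
  \<open>\<beta>\<close>: different braids may release the letter at different positions, after
  which their parts in \<open>F\<close> are unrelated. If the braid parts are equal, the positions
  agree; otherwise the braid parts alone decide, provided that cabling keeps their quotient
  \<open>\<sigma>\<close>-positive.\<close>

abbreviation pb_mult (infixl "\<cdot>" 70) where "x \<cdot> y \<equiv> x \<otimes>\<^bsub>PB\<^esub> y"
abbreviation pb_one ("\<e>") where "\<e> \<equiv> \<one>\<^bsub>PB\<^esub>"
abbreviation pb_inv ("\<i> _" [81] 80) where "\<i> x \<equiv> inv\<^bsub>PB\<^esub> x"

section \<open>Words, submonoids and the defining relations\<close>

lemma gens_simps [simp]: "Sig i \<in> gens \<longleftrightarrow> 1 \<le> i" "Thm i \<in> gens \<longleftrightarrow> 1 \<le> i"
  by (auto simp: gens_def)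

lemma PB_class_eq_iff:
  "v \<in> words gens \<Longrightarrow> w \<in> words gens \<Longrightarrow> PB_class v = PB_class w \<longleftrightarrow> pres_eq gens rels v w"
  unfolding PB_class_def by (rule pres_class_eq_iff)

lemma PB_class_carrier [simp]: "w \<in> words gens \<Longrightarrow> PB_class w \<in> carrier PB"
  by (auto simp: carrier_PB)

lemma PB_class_Nil: "PB_class [] = \<e>"
  by (simp add: PB_def PB_class_def one_presented_group)

lemma sig_carrier [simp]: "1 \<le> i \<Longrightarrow> sig i \<in> carrier PB"
  by (simp add: sig_def)

lemma thm_gen_carrier [simp]: "1 \<le> i \<Longrightarrow> thm_gen i \<in> carrier PB"
  by (simp add: thm_gen_def)

lemma PB_class_neg:
  assumes "g \<in> gens" shows "PB_class [(g, False)] = \<i> PB_class [(g, True)]"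
proof -
  have "PB_class [(g, False)] \<cdot> PB_class [(g, True)] = PB_class [(g, False), (g, True)]"
    using assms by (simp add: PB_class_mult)
  also have "\<dots> = \<e>"
    using assms pres_eq.cancel[of "[]" gens "[]" g rels False]
    by (simp add: PB_class_eq_iff flip: PB_class_Nil)
  finally show ?thesis
    using assms by (metis PB.inv_equality PB_class_carrier words_Cons words_Nil)
qed

lemma PB_class_Cons:
  assumes "g \<in> gens" "w \<in> words gens"
  shows "PB_class ((g, b) # w) = PB_class [(g, b)] \<cdot> PB_class w"
  using assms by (simp add: PB_class_mult)

lemma pos_word_words [simp]: "pos_word l \<in> words S \<longleftrightarrow> set l \<subseteq> S"
  by (induction l) (auto simp: pos_word_def)

lemma PB_class_rel:
  assumes "(pos_word l, pos_word r) \<in> rels" "set l \<subseteq> gens" "set r \<subseteq> gens"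
  shows "PB_class (pos_word l) = PB_class (pos_word r)"
  using assms pres_eq.rel[of "[]" gens "[]" "pos_word l" "pos_word r" rels]
  by (simp add: PB_class_eq_iff)

lemma PB_class_pos2:
  assumes "g \<in> gens" "h \<in> gens"
  shows "PB_class (pos_word [g, h]) = PB_class [(g, True)] \<cdot> PB_class [(h, True)]"
  using assms by (simp add: PB_class_mult pos_word_def)

lemma PB_class_pos3:
  assumes "g \<in> gens" "h \<in> gens" "k \<in> gens"
  shows "PB_class (pos_word [g, h, k])
    = PB_class [(g, True)] \<cdot> PB_class [(h, True)] \<cdot> PB_class [(k, True)]"
  using assms by (simp add: PB_class_mult pos_word_def)

lemma sig_sig: "1 \<le> i \<Longrightarrow> i + 2 \<le> j \<Longrightarrow> sig i \<cdot> sig j = sig j \<cdot> sig i"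
  using PB_class_rel[OF rels.sig_sig[of i j]] by (simp add: PB_class_pos2 sig_def)

lemma sig_thm: "1 \<le> i \<Longrightarrow> i + 2 \<le> j \<Longrightarrow> sig i \<cdot> thm_gen j = thm_gen j \<cdot> sig i"
  using PB_class_rel[OF rels.sig_thm[of i j]] by (simp add: PB_class_pos2 sig_def thm_gen_def)

text \<open>Here and in \<open>thm_sig\<close> the index \<open>j\<close> of the presentation is
  replaced by \<open>Suc j\<close>: the truncated \<open>j - 1\<close> disappears, and later case
  distinctions can split on \<open>i < j\<close>.\<close>

lemma thm_thm: "1 \<le> i \<Longrightarrow> i < j \<Longrightarrow> thm_gen i \<cdot> thm_gen j = thm_gen (Suc j) \<cdot> thm_gen i"
  using PB_class_rel[OF rels.thm_thm[of i "Suc j"]] by (simp add: PB_class_pos2 thm_gen_def)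

lemma thm_sig: "1 \<le> i \<Longrightarrow> i < j \<Longrightarrow> thm_gen i \<cdot> sig j = sig (Suc j) \<cdot> thm_gen i"
  using PB_class_rel[OF rels.thm_sig[of i "Suc j"]]
  by (simp add: PB_class_pos2 thm_gen_def sig_def)

lemma braid: "1 \<le> i \<Longrightarrow> sig i \<cdot> sig (Suc i) \<cdot> sig i = sig (Suc i) \<cdot> sig i \<cdot> sig (Suc i)"
  using PB_class_rel[OF rels.braid[of i]] by (simp add: PB_class_pos3 sig_def)

text \<open>Read from left to right, this relation and the next one pull an \<open>a\<close> through
  a crossing of its own strand: the strand is doubled, and one positive crossing becomes two
  positive ones.\<close>

lemma thm_sig_same: "1 \<le> i \<Longrightarrow> thm_gen i \<cdot> sig i = sig (Suc i) \<cdot> sig i \<cdot> thm_gen (Suc i)"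
  using PB_class_rel[OF rels.sig_sig_thm[of i]]
  by (simp add: PB_class_pos2 PB_class_pos3 thm_gen_def sig_def)

lemma thm_sig_Suc: "1 \<le> i \<Longrightarrow> thm_gen (Suc i) \<cdot> sig i = sig i \<cdot> sig (Suc i) \<cdot> thm_gen i"
  using PB_class_rel[OF rels.sig_sig_thm'[of i]]
  by (simp add: PB_class_pos2 PB_class_pos3 thm_gen_def sig_def)

section \<open>Generated submonoids and induction over generators\<close>

lemma submonoid_generated_submonoid:
  assumes "monoid G" "X \<subseteq> carrier G" shows "submonoid (submonoid_generated G X) G"
proof -
  interpret monoid G by fact
  have "submonoid (carrier G) G" by unfold_locales auto
  then have *: "submonoid_generated G X \<subseteq> carrier G"
    unfolding submonoid_generated_def using assms(2) by (intro hull_minimal)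
  show ?thesis
  proof
    show "submonoid_generated G X \<subseteq> carrier G" by fact
  next
    fix x y assume "x \<in> submonoid_generated G X" "y \<in> submonoid_generated G X"
    then show "x \<otimes>\<^bsub>G\<^esub> y \<in> submonoid_generated G X"
      unfolding submonoid_generated_def hull_def using submonoid.m_closed by fastforce
  next
    show "\<one>\<^bsub>G\<^esub> \<in> submonoid_generated G X"
      unfolding submonoid_generated_def hull_def using submonoid.one_closed by fastforce
  qed
qed

lemma submonoid_generated_minimal:
  "submonoid H G \<Longrightarrow> X \<subseteq> H \<Longrightarrow> submonoid_generated G X \<subseteq> H"
  unfolding submonoid_generated_def by (intro hull_minimal)

lemma submonoid_generated_incl: "x \<in> X \<Longrightarrow> x \<in> submonoid_generated G X"
  unfolding submonoid_generated_def by (rule hull_inc)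

lemma submonoid_generated_induct [consumes 3, case_names one mult]:
  assumes G: "monoid G" and X: "X \<subseteq> carrier G" and x: "x \<in> submonoid_generated G X"
    and one: "P \<one>\<^bsub>G\<^esub>"
    and mult: "\<And>x s. x \<in> submonoid_generated G X \<Longrightarrow> P x \<Longrightarrow> s \<in> X \<Longrightarrow> P (x \<otimes>\<^bsub>G\<^esub> s)"
  shows "P x"
proof -
  interpret monoid G by fact
  let ?M = "submonoid_generated G X"
  interpret M: submonoid ?M G by (rule submonoid_generated_submonoid[OF G X])
  \<comment> \<open>The elements whose right multiplication preserves \<open>P\<close> form a
    submonoid containing the generators, hence all of \<open>?M\<close>; applying this to the unit
    gives \<open>P x\<close>.\<close>
  let ?H = "{y \<in> ?M. \<forall>x\<in>?M. P x \<longrightarrow> P (x \<otimes>\<^bsub>G\<^esub> y)}"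
  have "submonoid ?H G"
  proof
    show "?H \<subseteq> carrier G" using M.subset by auto
    show "\<one>\<^bsub>G\<^esub> \<in> ?H" using M.subset by auto
    fix y z assume yz: "y \<in> ?H" "z \<in> ?H"
    have "P (x \<otimes>\<^bsub>G\<^esub> (y \<otimes>\<^bsub>G\<^esub> z))" if "x \<in> ?M" "P x" for x
    proof -
      have "P ((x \<otimes>\<^bsub>G\<^esub> y) \<otimes>\<^bsub>G\<^esub> z)" using yz that M.m_closed by blast
      moreover have "x \<in> carrier G" "y \<in> carrier G" "z \<in> carrier G"
        using that yz M.subset by auto
      ultimately show ?thesis by (simp add: m_assoc)
    qed
    then show "y \<otimes>\<^bsub>G\<^esub> z \<in> ?H" using yz M.m_closed by auto
  qed
  moreover have "X \<subseteq> ?H" using mult submonoid_generated_incl[of _ X G] by auto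
  ultimately have "?M \<subseteq> ?H" by (rule submonoid_generated_minimal)
  then have "P (\<one>\<^bsub>G\<^esub> \<otimes>\<^bsub>G\<^esub> x)" using x one M.one_closed by blast
  then show ?thesis using x M.subset by auto
qed

lemma generators_carrier:
  "sig ` {1..} \<subseteq> carrier PB" "thm_gen ` {1..} \<subseteq> carrier PB"
  "sig ` {1..} \<union> thm_gen ` {1..} \<subseteq> carrier PB"
  by auto

interpretation PBp: submonoid PB_pos PB
  unfolding PB_pos_def by (rule submonoid_generated_submonoid[OF PB.monoid_axioms generators_carrier(3)])
interpretation Bp: submonoid B_inf_pos PB
  unfolding B_inf_pos_def by (rule submonoid_generated_submonoid[OF PB.monoid_axioms generators_carrier(1)])
interpretation Fp: submonoid F_pos PB
  unfolding F_pos_def by (rule submonoid_generated_submonoid[OF PB.monoid_axioms generators_carrier(2)])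
interpretation B: subgroup B_inf PB
  unfolding B_inf_def by (rule PB.generate_is_subgroup[OF generators_carrier(1)])
interpretation F: subgroup F PB
  unfolding F_def by (rule PB.generate_is_subgroup[OF generators_carrier(2)])

lemma sig_pos [simp]: "1 \<le> i \<Longrightarrow> sig i \<in> B_inf_pos" "1 \<le> i \<Longrightarrow> sig i \<in> PB_pos"
  "1 \<le> i \<Longrightarrow> sig i \<in> B_inf"
  by (auto simp: B_inf_pos_def PB_pos_def B_inf_def
      intro!: submonoid_generated_incl generate.incl)

lemma thm_gen_pos [simp]: "1 \<le> i \<Longrightarrow> thm_gen i \<in> F_pos" "1 \<le> i \<Longrightarrow> thm_gen i \<in> PB_pos"
  "1 \<le> i \<Longrightarrow> thm_gen i \<in> F"
  by (auto simp: F_pos_def PB_pos_def F_def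
      intro!: submonoid_generated_incl generate.incl)

lemma pos_subsets:
  shows B_inf_pos_PB_pos: "B_inf_pos \<subseteq> PB_pos" and F_pos_PB_pos: "F_pos \<subseteq> PB_pos"
    and B_inf_pos_B_inf: "B_inf_pos \<subseteq> B_inf" and F_pos_F: "F_pos \<subseteq> F"
proof -
  show "B_inf_pos \<subseteq> PB_pos"
    unfolding B_inf_pos_def by (rule submonoid_generated_minimal) (use PBp.submonoid_axioms in auto)
  show "F_pos \<subseteq> PB_pos"
    unfolding F_pos_def by (rule submonoid_generated_minimal) (use PBp.submonoid_axioms in auto)
  show "B_inf_pos \<subseteq> B_inf"
    unfolding B_inf_pos_def
    by (rule submonoid_generated_minimal)
      (use B.subgroup_is_submonoid in auto)
  show "F_pos \<subseteq> F"
    unfolding F_pos_def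
    by (rule submonoid_generated_minimal)
      (use F.subgroup_is_submonoid in auto)
qed

lemmas pos_induct = submonoid_generated_induct[OF PB.monoid_axioms]

lemma B_inf_pos_induct [consumes 1, case_names one mult]:
  assumes "x \<in> B_inf_pos" "P \<e>"
    "\<And>x i. x \<in> B_inf_pos \<Longrightarrow> P x \<Longrightarrow> 1 \<le> i \<Longrightarrow> P (x \<cdot> sig i)"
  shows "P x"
  using pos_induct[OF generators_carrier(1), of x P] assms unfolding B_inf_pos_def by auto

lemma F_pos_induct [consumes 1, case_names one mult]:
  assumes "x \<in> F_pos" "P \<e>"
    "\<And>x i. x \<in> F_pos \<Longrightarrow> P x \<Longrightarrow> 1 \<le> i \<Longrightarrow> P (x \<cdot> thm_gen i)"
  shows "P x"
  using pos_induct[OF generators_carrier(2), of x P] assms unfolding F_pos_def by auto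

lemma PB_pos_induct [consumes 1, case_names one sig thm_gen]:
  assumes "x \<in> PB_pos" "P \<e>"
    "\<And>x i. x \<in> PB_pos \<Longrightarrow> P x \<Longrightarrow> 1 \<le> i \<Longrightarrow> P (x \<cdot> sig i)"
    "\<And>x i. x \<in> PB_pos \<Longrightarrow> P x \<Longrightarrow> 1 \<le> i \<Longrightarrow> P (x \<cdot> thm_gen i)"
  shows "P x"
  using pos_induct[OF generators_carrier(3), of x P] assms unfolding PB_pos_def by auto

lemma generate_induct_right [consumes 2, case_names one mult inv]:
  assumes "X \<subseteq> carrier PB" "x \<in> generate PB X" "P \<e>"
    "\<And>x s. x \<in> generate PB X \<Longrightarrow> P x \<Longrightarrow> s \<in> X \<Longrightarrow> P (x \<cdot> s)"
    "\<And>x s. x \<in> generate PB X \<Longrightarrow> P x \<Longrightarrow> s \<in> X \<Longrightarrow> P (x \<cdot> \<i> s)"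
  shows "P x"
proof -
  interpret X: subgroup "generate PB X" PB by (rule PB.generate_is_subgroup[OF assms(1)])
  \<comment> \<open>The rule \<open>eng\<close> multiplies two arbitrary elements, so the claim is
    generalised to an arbitrary left factor \<open>y\<close>; the two factors are then absorbed one
    after the other.\<close>
  have "y \<in> generate PB X \<Longrightarrow> P y \<Longrightarrow> P (y \<cdot> x)" for y
    using assms(2)
  proof (induction arbitrary: y rule: generate.induct)
    case (eng h1 h2)
    then have "P (y \<cdot> h1 \<cdot> h2)" by blast
    then show ?case using eng by (simp add: PB.m_assoc)
  qed (use assms(4,5) in auto)
  from this[of \<e>] show ?thesis using assms(2,3) by simp
qed

lemma PB_cancel [simp]:
  "x \<in> carrier PB \<Longrightarrow> y \<in> carrier PB \<Longrightarrow> x \<cdot> (\<i> x \<cdot> y) = y"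
  "x \<in> carrier PB \<Longrightarrow> y \<in> carrier PB \<Longrightarrow> \<i> x \<cdot> (x \<cdot> y) = y"
  by (simp_all flip: PB.m_assoc)

lemma shift_carrier [simp]: "x \<in> carrier PB \<Longrightarrow> shift x \<in> carrier PB"
  using shift_hom by (auto simp: hom_def)

lemma shift_mult [simp]:
  "x \<in> carrier PB \<Longrightarrow> y \<in> carrier PB \<Longrightarrow> shift (x \<cdot> y) = shift x \<cdot> shift y"
  using shift_hom by (auto simp: hom_def)

lemma shift_one [simp]: "shift \<e> = \<e>"
  using shift_PB_class[of "[]"] by (simp add: PB_class_Nil)

lemma shift_inv [simp]: "x \<in> carrier PB \<Longrightarrow> shift (\<i> x) = \<i> shift x"
  by (metis PB.inv_closed PB.inv_equality PB.l_inv shift_carrier shift_mult shift_one)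

section \<open>The action on colourings of the half-line\<close>

text \<open>The usual piecewise linear generators of Thompson's group. Precomposition squeezes the
  two unit cells between \<open>a\<close> and \<open>a + 2\<close> into the single cell from
  \<open>a\<close> to \<open>a + 1\<close>, each becoming one half of it.\<close>

definition thm_pl :: "real \<Rightarrow> real \<Rightarrow> real" where
  "thm_pl a p = (if p \<le> a then p else if p \<le> a + 1 then 2 * p - a else p + 1)"

definition thm_pl_inv :: "real \<Rightarrow> real \<Rightarrow> real" where
  "thm_pl_inv a p = (if p \<le> a then p else if p \<le> a + 2 then (p + a) / 2 else p - 1)"

text \<open>A colouring \<open>v\<close> stores cumulative products: \<open>- v p + v q\<close> is the colour of the interval
  \<open>[p, q)\<close>. On the colours \<open>x, y\<close> of \<open>[a, a + 1)\<close> and \<open>[a + 1, a + 2)\<close> (or of matching parts of them),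
  \<open>sig_act a\<close> is the map \<open>(x, y) \<mapsto> (x + y - x, x)\<close>.\<close>

definition sig_act :: "real \<Rightarrow> (real \<Rightarrow> 'g::group_add) \<Rightarrow> real \<Rightarrow> 'g" where
  "sig_act a v p =
    (if p \<le> a then v p
     else if p \<le> a + 1 then v (p + 1) + (- v (a + 1) + v a)
     else if p \<le> a + 2 then v (a + 2) + (- v (a + 1) + v (p - 1))
     else v p)"

definition sig_act_inv :: "real \<Rightarrow> (real \<Rightarrow> 'g::group_add) \<Rightarrow> real \<Rightarrow> 'g" where
  "sig_act_inv a v p =
    (if p \<le> a then v p
     else if p \<le> a + 1 then v a + (- v (a + 1) + v (p + 1))
     else if p \<le> a + 2 then v (p - 1) + (- v (a + 1) + v (a + 2))
     else v p)"

text \<open>Normal form for the noncommutative group of colours. It is instantiated at the type of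
  colours only, so that the arithmetic of the real positions stays untouched.\<close>

lemma group_normalize:
  fixes x y z :: "'a::group_add"
  shows "- (x + y) = - y + - x" "x + y + z = x + (y + z)"
  by (simp_all add: minus_add add.assoc del: add_uminus_conv_diff)

lemma thm_pl_inverse: "thm_pl a (thm_pl_inv a p) = p" "thm_pl_inv a (thm_pl a p) = p"
  by (auto simp: thm_pl_def thm_pl_inv_def field_simps)

lemma sig_act_inverse:
  fixes v :: "real \<Rightarrow> 'g::group_add"
  shows "sig_act a (sig_act_inv a v) = v" "sig_act_inv a (sig_act a v) = v"
proof -
  have "sig_act a (sig_act_inv a v) p = v p \<and> sig_act_inv a (sig_act a v) p = v p" for p
  proof -
    consider "p \<le> a" | "a < p" "p \<le> a + 1" | "a + 1 < p" "p \<le> a + 2" | "a + 2 < p" by linarith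
    then show ?thesis
      by cases (auto simp: sig_act_def sig_act_inv_def group_normalize[where 'a='g] add.commute[of _ a] simp del: add_uminus_conv_diff)
  qed
  then show "sig_act a (sig_act_inv a v) = v" "sig_act_inv a (sig_act a v) = v" by auto
qed

lemma sig_act_sig_act:
  fixes v :: "real \<Rightarrow> 'g::group_add"
  assumes "a + 2 \<le> b"
  shows "sig_act a (sig_act b v) = sig_act b (sig_act a v)"
proof
  fix p
  consider "p \<le> a" | "a < p" "p \<le> a + 1" | "a + 1 < p" "p \<le> a + 2" | "a + 2 < p" "p \<le> b"
    | "b < p" "p \<le> b + 1" | "b + 1 < p" "p \<le> b + 2" | "b + 2 < p" by linarith
  then show "sig_act a (sig_act b v) p = sig_act b (sig_act a v) p"
    using assms by cases (auto simp: sig_act_def group_normalize[where 'a='g] add.commute[of _ a] add.commute[of _ b] simp del: add_uminus_conv_diff)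
qed

lemma sig_act_thm_pl:
  fixes v :: "real \<Rightarrow> 'g::group_add"
  assumes "a + 2 \<le> b"
  shows "sig_act a v \<circ> thm_pl b = sig_act a (v \<circ> thm_pl b)"
proof
  fix p
  consider "p \<le> a" | "a < p" "p \<le> a + 1" | "a + 1 < p" "p \<le> a + 2" | "a + 2 < p" "p \<le> b"
    | "b < p" "p \<le> b + 1" | "b + 1 < p" by linarith
  then show "(sig_act a v \<circ> thm_pl b) p = sig_act a (v \<circ> thm_pl b) p"
    using assms by cases (auto simp: sig_act_def thm_pl_def group_normalize[where 'a='g] add.commute[of _ a] simp del: add_uminus_conv_diff)
qed

lemma thm_pl_thm_pl:
  assumes "a + 2 \<le> b"
  shows "thm_pl a \<circ> thm_pl (b - 1) = thm_pl b \<circ> thm_pl a"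
  using assms by (auto simp: thm_pl_def fun_eq_iff)

lemma thm_pl_sig_act:
  fixes v :: "real \<Rightarrow> 'g::group_add"
  assumes "a + 2 \<le> b"
  shows "sig_act (b - 1) (v \<circ> thm_pl a) = sig_act b v \<circ> thm_pl a"
proof
  fix p
  consider "p \<le> a" | "a < p" "p \<le> a + 1" | "a + 1 < p" "p \<le> b - 1" | "b - 1 < p" "p \<le> b"
    | "b < p" "p \<le> b + 1" | "b + 1 < p" by linarith
  then show "sig_act (b - 1) (v \<circ> thm_pl a) p = (sig_act b v \<circ> thm_pl a) p"
    using assms by cases (auto simp: sig_act_def thm_pl_def group_normalize[where 'a='g] add.commute[of _ a] add.commute[of _ b] simp del: add_uminus_conv_diff)
qed

lemma sig_act_braid:
  fixes v :: "real \<Rightarrow> 'g::group_add"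
  shows
  "sig_act a (sig_act (a + 1) (sig_act a v)) = sig_act (a + 1) (sig_act a (sig_act (a + 1) v))"
proof
  fix p
  consider "p \<le> a" | "a < p" "p \<le> a + 1" | "a + 1 < p" "p \<le> a + 2" | "a + 2 < p" "p \<le> a + 3"
    | "a + 3 < p" by linarith
  then show "sig_act a (sig_act (a + 1) (sig_act a v)) p
      = sig_act (a + 1) (sig_act a (sig_act (a + 1) v)) p"
    by cases (auto simp: sig_act_def group_normalize[where 'a='g] add.commute[of _ a] simp del: add_uminus_conv_diff)
qed

lemma sig_act_cable_left:
  fixes v :: "real \<Rightarrow> 'g::group_add"
  shows
  "sig_act a (sig_act (a + 1) v) \<circ> thm_pl (a + 1) = sig_act a (v \<circ> thm_pl a)"
proof
  fix p
  \<comment> \<open>The half-integer break point is the preimage of \<open>a + 2\<close> under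
    \<open>thm_pl (a + 1)\<close>; in \<open>sig_act_cable_right\<close> it is that of
    \<open>a + 1\<close> under \<open>thm_pl a\<close>.\<close>
  consider "p \<le> a" | "a < p" "p \<le> a + 1" | "a + 1 < p" "p \<le> a + 3/2" | "a + 3/2 < p" "p \<le> a + 2"
    | "a + 2 < p" by linarith
  then show "(sig_act a (sig_act (a + 1) v) \<circ> thm_pl (a + 1)) p = sig_act a (v \<circ> thm_pl a) p"
    by (cases, auto simp: sig_act_def thm_pl_def group_normalize[where 'a='g] add.commute[of _ a] simp del: add_uminus_conv_diff) (rule arg_cong[where f = v], linarith)+
qed

lemma sig_act_cable_right:
  fixes v :: "real \<Rightarrow> 'g::group_add"
  shows
  "sig_act (a + 1) (sig_act a v) \<circ> thm_pl a = sig_act a (v \<circ> thm_pl (a + 1))"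
proof
  fix p
  consider "p \<le> a" | "a < p" "p \<le> a + 1/2" | "a + 1/2 < p" "p \<le> a + 1" | "a + 1 < p" "p \<le> a + 2"
    | "a + 2 < p" by linarith
  then show "(sig_act (a + 1) (sig_act a v) \<circ> thm_pl a) p = sig_act a (v \<circ> thm_pl (a + 1)) p"
    by (cases, auto simp: sig_act_def thm_pl_def group_normalize[where 'a='g] add.commute[of _ a] simp del: add_uminus_conv_diff) (rule arg_cong[where f = v], linarith)+
qed

section \<open>The right action of words and of group elements\<close>

fun letter_act :: "gen \<times> bool \<Rightarrow> (real \<Rightarrow> 'g::group_add) \<Rightarrow> real \<Rightarrow> 'g" where
  "letter_act (Sig i, b) v = (if b then sig_act i v else sig_act_inv i v)"
| "letter_act (Thm i, b) v = (if b then v \<circ> thm_pl i else v \<circ> thm_pl_inv i)"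

text \<open>With \<open>fold\<close> the leftmost letter acts first, which makes this a right
  action.\<close>

definition word_act :: "(real \<Rightarrow> 'g::group_add) \<Rightarrow> gen word \<Rightarrow> real \<Rightarrow> 'g" where
  "word_act v w = fold letter_act w v"

lemma word_act_simps [simp]:
  "word_act v [] = v" "word_act v (s # w) = word_act (letter_act s v) w"
  "word_act v (w @ w') = word_act (word_act v w) w'"
  by (simp_all add: word_act_def)

lemma letter_act_inverse: "letter_act (g, \<not> b) (letter_act (g, b) v) = v"
  by (cases g; cases b) (simp_all add: sig_act_inverse comp_def thm_pl_inverse)

lemma word_act_rels:
  assumes "(l, r) \<in> rels" shows "word_act v l = word_act v r"
  using assms
proof cases
  case (sig_sig i j)
  then have "real i + 2 \<le> real j" by linarith
  then show ?thesis using sig_act_sig_act[of i j v] by (simp add: sig_sig pos_word_def)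
next
  case (sig_thm i j)
  then have "real i + 2 \<le> real j" by linarith
  then show ?thesis by (simp add: sig_thm pos_word_def sig_act_thm_pl)
next
  case (thm_thm i j)
  then have "real i + 2 \<le> real j" "real (j - 1) = real j - 1" by linarith+
  then show ?thesis by (simp add: thm_thm pos_word_def thm_pl_thm_pl comp_assoc)
next
  case (thm_sig i j)
  then have "real i + 2 \<le> real j" "real (j - 1) = real j - 1" by linarith+
  then show ?thesis by (simp add: thm_sig pos_word_def thm_pl_sig_act)
next
  case (braid i)
  then show ?thesis using sig_act_braid[of i v] by (simp add: pos_word_def add.commute)
next
  case (sig_sig_thm i)
  then show ?thesis using sig_act_cable_left[of i v] by (simp add: pos_word_def add.commute)
next
  case (sig_sig_thm' i)
  then show ?thesis using sig_act_cable_right[of i v] by (simp add: pos_word_def add.commute)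
qed

lemma word_act_pres_eq: "pres_eq gens rels w w' \<Longrightarrow> word_act v w = word_act v w'"
proof (induction arbitrary: v rule: pres_eq.induct)
  case (cancel u u' g b)
  then show ?case by (simp add: letter_act_inverse)
next
  case (rel u u' l r)
  then show ?case using word_act_rels[of l r "word_act v u"] by simp
qed auto

definition class_act :: "(real \<Rightarrow> 'g::group_add) \<Rightarrow> gen word set \<Rightarrow> real \<Rightarrow> 'g" where
  "class_act v x = word_act v (SOME w. w \<in> x)"

lemma class_act_PB_class:
  assumes "w \<in> words gens" shows "class_act v (PB_class w) = word_act v w"
proof -
  have "w \<in> PB_class w" using assms by (simp add: PB_class_def pres_eq.refl)
  then have "(SOME w'. w' \<in> PB_class w) \<in> PB_class w" by (rule someI)
  then show ?thesis unfolding class_act_def PB_class_def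
    using word_act_pres_eq[of w _ v] by simp
qed

lemma class_act_one [simp]: "class_act v \<e> = v"
  using class_act_PB_class[of "[]" v] by (simp add: PB_class_Nil)

lemma class_act_mult [simp]:
  assumes "x \<in> carrier PB" "y \<in> carrier PB"
  shows "class_act v (x \<cdot> y) = class_act (class_act v x) y"
  using assms by (auto simp: carrier_PB PB_class_mult class_act_PB_class)

lemma class_act_thm_gen [simp]: "1 \<le> i \<Longrightarrow> class_act v (thm_gen i) = v \<circ> thm_pl i"
  by (simp add: thm_gen_def class_act_PB_class)

lemma letter_act_shift:
  "letter_act (shift_gen g, b) v p = letter_act (g, b) (\<lambda>q. v (q + 1)) (p - 1)"
  by (cases g; cases b, auto simp: sig_act_def sig_act_inv_def thm_pl_def thm_pl_inv_def
      add.commute[of _ 1] diff_add_eq add_divide_distrib diff_divide_distrib)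
    (rule arg_cong[where f = v], simp)+

text \<open>The shift becomes the translation of positions by 1. Since colourings live on all of the
  reals, the translated colouring needs no treatment of a boundary.\<close>

lemma word_act_shift: "word_act v (shift_word w) p = word_act (\<lambda>q. v (q + 1)) w (p - 1)"
proof (induction w arbitrary: v)
  case (Cons s w)
  obtain g b where s: "s = (g, b)" by fastforce
  have "(\<lambda>q. letter_act (shift_gen g, b) v (q + 1)) = letter_act (g, b) (\<lambda>q. v (q + 1))"
    by (simp add: letter_act_shift fun_eq_iff)
  then show ?case by (simp add: s Cons.IH)
qed simp

lemma class_act_shift:
  assumes "x \<in> carrier PB"
  shows "class_act v (shift x) p = class_act (\<lambda>q. v (q + 1)) x (p - 1)"
  using assms by (auto simp: carrier_PB shift_PB_class class_act_PB_class word_act_shift)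

section \<open>Thompson's group as piecewise linear maps\<close>

text \<open>The identity is a colouring by the additive group of reals in which each unit cell has
  colour 1; acting on it reads off the reparametrisation performed by an element of
  \<open>F\<close>.\<close>

definition pl :: "gen word set \<Rightarrow> real \<Rightarrow> real" where
  "pl x = class_act (\<lambda>p. p) x"

lemma thm_pl_strict_mono: "strict_mono (thm_pl a)"
  by (auto simp: strict_mono_def thm_pl_def)

lemma F_induct [consumes 1, case_names one thm_gen inv]:
  assumes "x \<in> F" "P \<e>"
    "\<And>x i. x \<in> F \<Longrightarrow> P x \<Longrightarrow> 1 \<le> i \<Longrightarrow> P (x \<cdot> thm_gen i)"
    "\<And>x i. x \<in> F \<Longrightarrow> P x \<Longrightarrow> 1 \<le> i \<Longrightarrow> P (x \<cdot> \<i> thm_gen i)"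
  shows "P x"
  using generate_induct_right[OF generators_carrier(2), of x P] assms unfolding F_def by auto

lemma class_act_thm_gen_inv [simp]:
  assumes "1 \<le> i" shows "class_act v (\<i> thm_gen i) = v \<circ> thm_pl_inv i"
  using assms by (simp add: thm_gen_def class_act_PB_class flip: PB_class_neg)

text \<open>Generators of \<open>F\<close> and their inverses act by precomposition only, so one map
  \<open>pl f\<close> describes the action on colourings in every group at once. This is what
  transfers information between different choices of colours.\<close>

lemma class_act_F: "f \<in> F \<Longrightarrow> class_act v f = v \<circ> pl f"
  by (induction arbitrary: v rule: F_induct) (auto simp: pl_def fun_eq_iff)

lemma pl_one [simp]: "pl \<e> = (\<lambda>p. p)"
  by (simp add: pl_def)

lemma pl_mult: "f \<in> F \<Longrightarrow> g \<in> F \<Longrightarrow> pl (f \<cdot> g) = pl f \<circ> pl g"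
  using class_act_F[of g "pl f"] by (simp add: pl_def)

lemma pl_thm_gen: "1 \<le> i \<Longrightarrow> pl (thm_gen i) = thm_pl i"
  by (simp add: pl_def comp_def)

lemma pl_strict_mono: "f \<in> F \<Longrightarrow> strict_mono (pl f)"
  by (induction rule: F_induct)
    (auto simp: pl_def strict_mono_def thm_pl_def thm_pl_inv_def)

lemma pl_fixes: "f \<in> F \<Longrightarrow> p \<le> 1 \<Longrightarrow> pl f p = p"
  by (induction rule: F_induct) (auto simp: pl_def thm_pl_def thm_pl_inv_def)

lemma shift_F: "f \<in> F \<Longrightarrow> shift f \<in> F"
  by (induction rule: F_induct) (auto simp: shift_thm_gen)

lemma pl_shift: "f \<in> F \<Longrightarrow> pl (shift f) p = pl f (p - 1) + 1"
  using class_act_F[of f "\<lambda>q. q + 1"] by (simp add: pl_def class_act_shift)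

lemma pl_F_pos_ge: "f \<in> F_pos \<Longrightarrow> p \<le> pl f p"
proof (induction arbitrary: p rule: F_pos_induct)
  case (mult f i)
  then have "pl (f \<cdot> thm_gen i) p = pl f (thm_pl i p)"
    using F_pos_F by (simp add: pl_mult pl_thm_gen subset_eq)
  also have "\<dots> \<ge> thm_pl i p" by fact
  finally show ?case by (smt (verit) thm_pl_def)
qed simp

section \<open>Comparison of increasing maps by their first difference\<close>

definition first_diff_at :: "real \<Rightarrow> (real \<Rightarrow> real) \<Rightarrow> (real \<Rightarrow> real) \<Rightarrow> bool" where
  "first_diff_at p u u' \<longleftrightarrow> (\<forall>q\<le>p. u q = u' q) \<and> (\<exists>r>p. \<forall>q. p < q \<longrightarrow> q < r \<longrightarrow> u q < u' q)"

lemma first_diff_irrefl: "\<not> first_diff_at p u u"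
  unfolding first_diff_at_def by (meson dense less_irrefl)

lemma first_diff_trans:
  assumes "first_diff_at p u v" "first_diff_at p' v w"
  shows "first_diff_at (min p p') u w"
proof -
  obtain r r' where "p < r" "\<forall>q. p < q \<longrightarrow> q < r \<longrightarrow> u q < v q"
    "p' < r'" "\<forall>q. p' < q \<longrightarrow> q < r' \<longrightarrow> v q < w q"
    using assms unfolding first_diff_at_def by auto
  moreover have "u q < w q" if "min p p' < q" "q < min (if p \<le> p' then r else p) (if p' \<le> p then r' else p')"
    for q
    using that assms calculation unfolding first_diff_at_def
    by (smt (verit))
  moreover have "\<forall>q\<le>min p p'. u q = w q" using assms unfolding first_diff_at_def by simp
  ultimately show ?thesis unfolding first_diff_at_def
    by (intro conjI exI[of _ "min (if p \<le> p' then r else p) (if p' \<le> p then r' else p')"]) auto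
qed

text \<open>Because \<open>pl (h \<cdot> f)\<close> is \<open>pl h \<circ> pl f\<close>, this is the
  left invariance of the order on \<open>F\<close>.\<close>

lemma first_diff_comp_left:
  "strict_mono h \<Longrightarrow> first_diff_at p u u' \<Longrightarrow> first_diff_at p (h \<circ> u) (h \<circ> u')"
  unfolding first_diff_at_def strict_mono_def by auto

text \<open>A common reparametrisation on the right only moves the point of first difference to its
  preimage \<open>k' p\<close>.\<close>

lemma first_diff_comp_right:
  assumes "strict_mono k" "\<And>q. k (k' q) = q" "first_diff_at p u u'"
  shows "first_diff_at (k' p) (u \<circ> k) (u' \<circ> k)"
proof -
  have *: "k' q < q' \<longleftrightarrow> q < k q'" for q q'
    using strict_mono_less[OF assms(1)] assms(2) by metis
  then have "q' < k' q \<longleftrightarrow> k q' < q" for q q'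
    using assms(1,2) by (metis strict_mono_less)
  moreover from * have "q' \<le> k' q \<longleftrightarrow> k q' \<le> q" for q q'
    by (meson linorder_not_less)
  moreover obtain r where "r > p" "\<forall>q. p < q \<longrightarrow> q < r \<longrightarrow> u q < u' q" "\<forall>q\<le>p. u q = u' q"
    using assms(3) unfolding first_diff_at_def by blast
  ultimately show ?thesis unfolding first_diff_at_def using * assms(2)
    by (intro conjI exI[of _ "k' r"]) auto
qed

text \<open>The right factors may differ from each other here. It is applied with
  \<open>m = 2\<close> to the later trees of two sequences: their maps are the identity up to 2 and
  cannot undo a difference located before 2.\<close>

lemma first_diff_comp_fix:
  assumes "first_diff_at p u u'" "p < m" "\<And>q. q \<le> m \<Longrightarrow> k q = q" "\<And>q. q \<le> m \<Longrightarrow> k' q = q"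
  shows "first_diff_at p (u \<circ> k) (u' \<circ> k')"
proof -
  obtain r where "r > p" "\<forall>q. p < q \<longrightarrow> q < r \<longrightarrow> u q < u' q"
    using assms unfolding first_diff_at_def by auto
  then show ?thesis
    using assms unfolding first_diff_at_def by (intro conjI exI[of _ "min r m"]) auto
qed

section \<open>Trees and tree sequences as increasing maps\<close>

lemma shift_F_pos: "f \<in> F_pos \<Longrightarrow> shift f \<in> F_pos"
  by (induction rule: F_pos_induct) (auto simp: shift_thm_gen)

lemma F_pos_F' [simp]: "f \<in> F_pos \<Longrightarrow> f \<in> F"
  using F_pos_F by auto

lemma ev_F_pos: "ev t \<in> F_pos"
  by (induction t) (auto simp: shift_F_pos)

lemma ev_carrier [simp]: "ev t \<in> carrier PB"
  using ev_F_pos by auto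

lemma ev_shift_first_diff:
  assumes "first_diff_at p (pl (ev t)) (pl (ev t'))" "p < 2" "x \<in> F" "x' \<in> F"
  shows "first_diff_at p (pl (ev t \<cdot> shift x)) (pl (ev t' \<cdot> shift x'))"
  using assms first_diff_comp_fix[of p _ _ 2 "pl (shift x)" "pl (shift x')"]
  by (simp add: pl_mult ev_F_pos shift_F pl_shift pl_fixes)

lemma first_diff_shift:
  assumes "first_diff_at p (pl x) (pl y)" "x \<in> F" "y \<in> F"
  shows "first_diff_at (p + 1) (pl (shift x)) (pl (shift y))"
proof -
  have "first_diff_at (p + 1) (pl x \<circ> (\<lambda>q. q - 1)) (pl y \<circ> (\<lambda>q. q - 1))"
    using assms first_diff_comp_right[of "\<lambda>q. q - 1" "\<lambda>q. q + 1"] by (simp add: strict_mono_def)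
  moreover have "strict_mono (\<lambda>q::real. q + 1)" by (simp add: strict_mono_def)
  moreover have "pl (shift z) = (\<lambda>q. q + 1) \<circ> (pl z \<circ> (\<lambda>q. q - 1))" if "z \<in> F" for z
    using that by (simp add: pl_shift fun_eq_iff)
  ultimately show ?thesis using first_diff_comp_left assms(2,3) by metis
qed

text \<open>The map \<open>pl (ev t)\<close> spreads the dyadic subdivision of \<open>[1, 2]\<close> described by \<open>t\<close> over unit
  intervals, so a tree that is \<open>tree_less\<close> has the smaller slope at the first difference.\<close>

lemma tree_less_first_diff:
  "tree_less t t' \<Longrightarrow> \<exists>p. 1 \<le> p \<and> p < 2 \<and> first_diff_at p (pl (ev t)) (pl (ev t'))"
proof (induction t t' rule: tree_less.induct)
  case (1 t1 t2)
  \<comment> \<open>Up to 3/2 the factor \<open>thm_gen 1\<close> has image below 2, where the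
    shifted right subtree still acts as the identity; the slope 2 then already produces the strict
    inequality.\<close>
  have "q < pl (ev (Node t1 t2)) q" if "1 < q" "q < 3/2" for q
  proof -
    have "pl (ev (Node t1 t2)) q = pl (ev t1) (2 * q - 1)"
      using that by (simp add: pl_mult ev_F_pos shift_F_pos pl_thm_gen pl_shift thm_pl_def pl_fixes)
    then show ?thesis using pl_F_pos_ge[OF ev_F_pos, of "2 * q - 1" t1] that by simp
  qed
  moreover have "ev (Node t1 t2) \<in> F" by (metis ev_F_pos F_pos_F')
  then have "\<forall>q\<le>1. pl (ev (Node t1 t2)) q = q" by (simp add: pl_fixes del: ev.simps)
  ultimately have "first_diff_at 1 (pl (ev Leaf)) (pl (ev (Node t1 t2)))"
    unfolding first_diff_at_def by (intro conjI exI[of _ "3/2"]) (auto simp del: ev.simps(2))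
  then show ?case by (intro exI[of _ 1]) simp
next
  case (2 t1 t2 t1' t2')
  \<comment> \<open>The left subtrees differ within \<open>[1, 2)\<close> and the shifted right
    subtrees within \<open>[2, 3)\<close>; the common last factor \<open>thm_gen 1\<close> pulls
    \<open>[1, 3)\<close> back to \<open>[1, 2)\<close>.\<close>
  have *: "\<exists>p. 1 \<le> p \<and> p < 2 \<and> first_diff_at p (pl (ev (Node t1 t2))) (pl (ev (Node t1' t2')))"
    if "first_diff_at p (pl (ev t1 \<cdot> shift (ev t2))) (pl (ev t1' \<cdot> shift (ev t2')))" "1 \<le> p" "p < 3" for p
  proof (intro exI[of _ "thm_pl_inv 1 p"] conjI)
    show "1 \<le> thm_pl_inv 1 p" "thm_pl_inv 1 p < 2" using that by (auto simp: thm_pl_inv_def)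
    show "first_diff_at (thm_pl_inv 1 p) (pl (ev (Node t1 t2))) (pl (ev (Node t1' t2')))"
      using first_diff_comp_right[OF thm_pl_strict_mono thm_pl_inverse(1) that(1)]
      by (simp add: pl_mult[of "_ \<cdot> _"] ev_F_pos shift_F pl_thm_gen)
  qed
  from "2.prems" consider "tree_less t1 t1'" | "t1 = t1'" "tree_less t2 t2'" by auto
  then show ?case
  proof cases
    case 1
    then show ?thesis using 2(1) *[OF ev_shift_first_diff] by (force simp: ev_F_pos)
  next
    case 2
    then obtain p where "1 \<le> p" "p < 2" "first_diff_at p (pl (ev t2)) (pl (ev t2'))"
      using "2.IH"(2) by blast
    then have "first_diff_at (p + 1) (pl (shift (ev t2))) (pl (shift (ev t2')))"
      by (intro first_diff_shift) (simp_all add: ev_F_pos)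
    then show ?thesis
      using *[of "p + 1"] first_diff_comp_left[OF pl_strict_mono[of "ev t1"]] 2 \<open>1 \<le> p\<close> \<open>p < 2\<close>
      by (simp add: pl_mult ev_F_pos shift_F del: o_apply)
  qed
qed simp

lemma shift_funpow_carrier [simp]: "x \<in> carrier PB \<Longrightarrow> (shift ^^ i) x \<in> carrier PB"
  by (induction i) auto

lemma ev_seq_Nil [simp]: "ev_seq [] = \<e>"
  by (simp add: ev_seq_def)

lemma ev_seq_Cons [simp]: "ev_seq (t # ts) = ev t \<cdot> shift (ev_seq ts)"
proof -
  have "foldr (\<lambda>i x. (shift ^^ Suc i) (ev (ts ! i)) \<cdot> x) is \<e>
      = shift (foldr (\<lambda>i x. (shift ^^ i) (ev (ts ! i)) \<cdot> x) is \<e>)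
    \<and> foldr (\<lambda>i x. (shift ^^ i) (ev (ts ! i)) \<cdot> x) is \<e> \<in> carrier PB" for "is"
    by (induction "is") auto
  then show ?thesis
    by (simp add: ev_seq_def upt_rec[of 0] map_Suc_upt[symmetric] foldr_map comp_def del: upt_Suc)
qed

lemma ev_seq_F_pos: "ev_seq ts \<in> F_pos"
  by (induction ts) (auto simp: ev_F_pos shift_F_pos)

lemma ev_seq_carrier [simp]: "ev_seq ts \<in> carrier PB"
  using ev_seq_F_pos by auto

lemma ev_seq_unfold: "ev_seq ts = ev (tree_at ts 0) \<cdot> shift (ev_seq (tl ts))"
  by (cases ts) (simp_all add: tree_at_def)

lemma tree_at_tl: "tree_at (tl ts) i = tree_at ts (Suc i)"
  by (cases ts) (simp_all add: tree_at_def)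

lemma tree_seq_less_first_diff:
  assumes "tree_seq_less ts ts'" shows "\<exists>p. first_diff_at p (pl (ev_seq ts)) (pl (ev_seq ts'))"
proof -
  have "\<exists>p. first_diff_at p (pl (ev_seq ts)) (pl (ev_seq ts'))"
    if "\<forall>i<k. tree_at ts i = tree_at ts' i" "tree_less (tree_at ts k) (tree_at ts' k)" for k
    using that
  proof (induction k arbitrary: ts ts')
    case 0
    then obtain p where "p < 2" "first_diff_at p (pl (ev (tree_at ts 0))) (pl (ev (tree_at ts' 0)))"
      using tree_less_first_diff by blast
    then show ?case
      using ev_shift_first_diff ev_seq_F_pos F_pos_F' ev_seq_unfold[of ts] ev_seq_unfold[of ts']
      by metis
  next
    case (Suc k)
    have "\<exists>p. first_diff_at p (pl (ev_seq (tl ts))) (pl (ev_seq (tl ts')))"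
      using Suc.prems by (intro Suc.IH) (auto simp: tree_at_tl)
    then obtain p where "first_diff_at (p + 1) (pl (shift (ev_seq (tl ts)))) (pl (shift (ev_seq (tl ts'))))"
      using first_diff_shift ev_seq_F_pos F_pos_F' by blast
    then have "first_diff_at (p + 1) (pl (ev (tree_at ts 0)) \<circ> pl (shift (ev_seq (tl ts))))
        (pl (ev (tree_at ts 0)) \<circ> pl (shift (ev_seq (tl ts'))))"
      by (intro first_diff_comp_left pl_strict_mono) (simp_all add: ev_F_pos)
    moreover have "tree_at ts 0 = tree_at ts' 0" using Suc.prems by simp
    ultimately show ?case
      unfolding ev_seq_unfold[of ts] ev_seq_unfold[of ts']
      by (auto simp: pl_mult ev_F_pos shift_F_pos ev_seq_F_pos simp del: o_apply)
  qed
  then show ?thesis using assms unfolding tree_seq_less_def by blast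
qed

lemma neq_Leaf: "t \<noteq> Leaf \<longleftrightarrow> (\<exists>t1 t2. t = Node t1 t2)"
  by (cases t) auto

lemma tree_less_total: "t \<noteq> t' \<Longrightarrow> tree_less t t' \<or> tree_less t' t"
  by (induction t t' rule: tree_less.induct) (auto simp: neq_Leaf)

lemma ev_seq_eqI: "(\<And>i. tree_at ts i = tree_at ts' i) \<Longrightarrow> ev_seq ts = ev_seq ts'"
proof (induction "length ts + length ts'" arbitrary: ts ts' rule: less_induct)
  case less
  show ?case
  proof (cases "ts = [] \<and> ts' = []")
    case False
    then have "ev_seq (tl ts) = ev_seq (tl ts')"
      by (intro less.hyps) (auto simp: tree_at_tl less.prems neq_Nil_conv)
    then show ?thesis using less.prems[of 0] ev_seq_unfold by metis
  qed simp
qed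

lemma tree_seq_less_total: "ev_seq ts = ev_seq ts' \<or> tree_seq_less ts ts' \<or> tree_seq_less ts' ts"
proof (cases "\<forall>i. tree_at ts i = tree_at ts' i")
  case False
  define k where "k = (LEAST i. tree_at ts i \<noteq> tree_at ts' i)"
  have "tree_at ts k \<noteq> tree_at ts' k" unfolding k_def using False by (metis (mono_tags) LeastI)
  moreover have "\<forall>i<k. tree_at ts i = tree_at ts' i" unfolding k_def using not_less_Least by blast
  ultimately show ?thesis unfolding tree_seq_less_def by (metis tree_less_total)
qed (use ev_seq_eqI in blast)

text \<open>This lets a final \<open>thm_gen 1\<close> pass the third and later trees of a sequence,
  so that it meets the first two.\<close>

lemma shift_shift_thm_gen: "f \<in> F_pos \<Longrightarrow> shift (shift f) \<cdot> thm_gen 1 = thm_gen 1 \<cdot> shift f"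
proof (induction rule: F_pos_induct)
  case (mult f i)
  have "shift (shift (f \<cdot> thm_gen i)) \<cdot> thm_gen 1
      = shift (shift f) \<cdot> (thm_gen (Suc (Suc i)) \<cdot> thm_gen 1)"
    using mult by (simp add: shift_thm_gen PB.m_assoc)
  also have "\<dots> = shift (shift f) \<cdot> (thm_gen 1 \<cdot> thm_gen (Suc i))"
    using mult.hyps thm_thm[of 1 "Suc i"] by simp
  also have "\<dots> = shift (shift f) \<cdot> thm_gen 1 \<cdot> thm_gen (Suc i)"
    using mult.hyps by (simp add: PB.m_assoc)
  also have "\<dots> = thm_gen 1 \<cdot> shift f \<cdot> thm_gen (Suc i)"
    using mult by simp
  also have "\<dots> = thm_gen 1 \<cdot> shift (f \<cdot> thm_gen i)"
    using mult by (simp add: PB.m_assoc shift_thm_gen)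
  finally show ?case .
qed simp

text \<open>Right multiplication by the letter of index \<open>i\<close> grafts the trees number
  \<open>i\<close> and \<open>i + 1\<close> (counted from 1) into one node and moves the later trees
  one place to the left.\<close>

lemma ev_seq_mult_thm_gen: "1 \<le> i \<Longrightarrow> \<exists>ts'. ev_seq ts \<cdot> thm_gen i = ev_seq ts'"
proof (induction i arbitrary: ts rule: nat_induct_at_least)
  case base
  define t u x where "t = tree_at ts 0" and "u = tree_at (tl ts) 0" and "x = tl (tl ts)"
  have "ev_seq ts \<cdot> thm_gen 1 = ev t \<cdot> shift (ev u) \<cdot> (shift (shift (ev_seq x)) \<cdot> thm_gen 1)"
    unfolding ev_seq_unfold[of ts] ev_seq_unfold[of "tl ts"] t_def u_def x_def
    by (simp add: PB.m_assoc)
  also have "\<dots> = ev_seq (Node t u # x)"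
    by (simp add: shift_shift_thm_gen[OF ev_seq_F_pos] PB.m_assoc del: One_nat_def)
  finally show ?case by blast
next
  case (Suc i)
  obtain us where "ev_seq (tl ts) \<cdot> thm_gen i = ev_seq us" using Suc.IH by blast
  then have "ev_seq ts \<cdot> thm_gen (Suc i) = ev_seq (tree_at ts 0 # us)"
    unfolding ev_seq_unfold[of ts] using Suc.hyps
    by (simp add: PB.m_assoc flip: shift_thm_gen[simplified] shift_mult)
  then show ?case by blast
qed

lemma F_pos_ev_seq: "f \<in> F_pos \<Longrightarrow> \<exists>ts. f = ev_seq ts"
proof (induction rule: F_pos_induct)
  case one
  show ?case by (rule exI[of _ "[]"]) simp
next
  case (mult x i)
  then show ?case using ev_seq_mult_thm_gen by metis
qed

definition pl_less :: "gen word set \<Rightarrow> gen word set \<Rightarrow> bool" where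
  "pl_less f g \<longleftrightarrow> (\<exists>p. first_diff_at p (pl f) (pl g))"

lemma pl_less_irrefl: "\<not> pl_less f f"
  by (simp add: pl_less_def first_diff_irrefl)

lemma pl_less_trans: "pl_less f g \<Longrightarrow> pl_less g h \<Longrightarrow> pl_less f h"
  using first_diff_trans unfolding pl_less_def by blast

lemma pl_less_mult:
  assumes "h \<in> F" "f \<in> F" "g \<in> F" "pl_less f g" shows "pl_less (h \<cdot> f) (h \<cdot> g)"
  using assms first_diff_comp_left[OF pl_strict_mono[OF assms(1)]]
  unfolding pl_less_def by (auto simp: pl_mult)

text \<open>Only the forward direction is computed with trees. The converse is formal: tree
  sequences are comparable, and the order by maps is irreflexive and transitive, so the opposite
  comparison is impossible.\<close>

lemma less_F_pos_iff:
  "(f, f') \<in> less_F_pos \<longleftrightarrow> f \<in> F_pos \<and> f' \<in> F_pos \<and> pl_less f f'"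
proof
  assume "(f, f') \<in> less_F_pos"
  then show "f \<in> F_pos \<and> f' \<in> F_pos \<and> pl_less f f'"
    unfolding less_F_pos_def pl_less_def using tree_seq_less_first_diff by auto
next
  assume *: "f \<in> F_pos \<and> f' \<in> F_pos \<and> pl_less f f'"
  then obtain ts ts' where ts: "f = ev_seq ts" "f' = ev_seq ts'" using F_pos_ev_seq by metis
  have "f \<noteq> f'" using * pl_less_irrefl by auto
  moreover have "\<not> tree_seq_less ts' ts"
    using * ts tree_seq_less_first_diff pl_less_trans pl_less_irrefl unfolding pl_less_def by metis
  ultimately have "tree_seq_less ts ts'" using ts tree_seq_less_total by metis
  then show "(f, f') \<in> less_F_pos" unfolding less_F_pos_def using * ts by auto
qed

lemma pl_less_total: "f \<in> F_pos \<Longrightarrow> f' \<in> F_pos \<Longrightarrow> f = f' \<or> pl_less f f' \<or> pl_less f' f"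
  using F_pos_ev_seq tree_seq_less_total tree_seq_less_first_diff unfolding pl_less_def by metis

section \<open>Positive braid words act non-trivially\<close>

typedef 'a bijection = "{f :: 'a \<Rightarrow> 'a. bij f}"
  by (rule exI[of _ id]) simp

setup_lifting type_definition_bijection

instantiation bijection :: (type) group_add
begin
lift_definition zero_bijection :: "'a bijection" is id by simp
lift_definition plus_bijection :: "'a bijection \<Rightarrow> 'a bijection \<Rightarrow> 'a bijection" is "(\<circ>)"
  by (rule bij_comp)
lift_definition uminus_bijection :: "'a bijection \<Rightarrow> 'a bijection" is "inv_into UNIV"
  by (rule bij_imp_bij_inv)
definition minus_bijection :: "'a bijection \<Rightarrow> 'a bijection \<Rightarrow> 'a bijection" where
  "minus_bijection f g = f + - g"
instance
proof
  fix f g h :: "'a bijection"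
  show "f + g + h = f + (g + h)" by transfer auto
  show "0 + f = f" "f + 0 = f" by (transfer, simp)+
  show "- f + f = 0" by transfer (simp add: bij_is_inj)
  show "f + - g = f - g" by (simp add: minus_bijection_def)
qed
end

type_synonym letters = "(nat \<times> bool) list"

fun cons_red :: "nat \<times> bool \<Rightarrow> letters \<Rightarrow> letters" where
  "cons_red x [] = [x]"
| "cons_red x (y # u) = (if y = (fst x, \<not> snd x) then u else x # y # u)"

definition red :: "letters \<Rightarrow> letters" where
  "red u = foldr cons_red u []"

fun reduced :: "letters \<Rightarrow> bool" where
  "reduced (x # y # u) \<longleftrightarrow> y \<noteq> (fst x, \<not> snd x) \<and> reduced (y # u)"
| "reduced _ \<longleftrightarrow> True"

definition weval :: "(nat \<Rightarrow> 'g::group_add) \<Rightarrow> letters \<Rightarrow> 'g" where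
  "weval g u = (\<Sum>(k, b)\<leftarrow>u. if b then g k else - g k)"

lemma weval_simps [simp]:
  "weval g [] = 0" "weval g ((k, b) # u) = (if b then g k else - g k) + weval g u"
  "weval g (u @ u') = weval g u + weval g u'"
  by (simp_all add: weval_def)

lemma reduced_ConsD: "reduced (x # u) \<Longrightarrow> reduced u"
  by (cases u) auto

lemma reduced_cons_red: "reduced u \<Longrightarrow> reduced (cons_red x u)"
  by (cases u) (auto dest: reduced_ConsD)

lemma reduced_red: "reduced (red u)"
  by (induction u) (auto simp: red_def reduced_cons_red)

lemma cons_red_inverse: "reduced u \<Longrightarrow> cons_red (k, b) (cons_red (k, \<not> b) u) = u"
proof (induction u)
  case (Cons y u)
  then show ?case by (cases u) auto
qed simp

lemma weval_cons_red: "weval g (cons_red x u) = weval g (x # u)"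
  by (cases x; cases u) (auto simp flip: add.assoc)

lemma weval_red: "weval g (red u) = weval g u"
proof (induction u)
  case (Cons x u)
  then show ?case by (cases x) (simp add: red_def weval_cons_red)
qed (simp add: red_def)

text \<open>Prepending with cancellation is invertible on reduced words only; acting as the identity
  elsewhere makes it a permutation of the whole type.\<close>

definition letter_bij :: "nat \<times> bool \<Rightarrow> letters \<Rightarrow> letters" where
  "letter_bij x u = (if reduced u then cons_red x u else u)"

lemma letter_bij_inverse: "letter_bij (k, b) (letter_bij (k, \<not> b) u) = u"
  by (simp add: letter_bij_def reduced_cons_red cons_red_inverse)

lemma bij_letter_bij: "bij (letter_bij (k, b))"
  using letter_bij_inverse[of k b] letter_bij_inverse[of k "\<not> b"]
  by (intro bij_betw_byWitness[of _ "letter_bij (k, \<not> b)"]) auto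

lift_definition free_gen :: "nat \<Rightarrow> letters bijection" is "\<lambda>k. letter_bij (k, True)"
  by (rule bij_letter_bij)

lemma Rep_free_gen: "Rep_bijection (if b then free_gen k else - free_gen k) = letter_bij (k, b)"
proof -
  have "inv_into UNIV (letter_bij (k, True)) = letter_bij (k, False)"
    using letter_bij_inverse[of k True] letter_bij_inverse[of k False]
    by (intro inv_unique_comp) auto
  then show ?thesis by (simp add: free_gen.rep_eq uminus_bijection.rep_eq)
qed

text \<open>Applying a permutation to the empty word recovers the reduced form. So
  \<open>red\<close> is a complete invariant of group elements, with no confluence argument about
  cancellation.\<close>

lemma weval_free_gen: "Rep_bijection (weval free_gen u) [] = red u"
proof (induction u)
  case Nil
  then show ?case by (simp add: red_def zero_bijection.rep_eq)
next
  case (Cons x u)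
  obtain k b where x: "x = (k, b)" by fastforce
  have "Rep_bijection (weval free_gen (x # u)) [] = letter_bij (k, b) (red u)"
    using Cons by (simp add: x plus_bijection.rep_eq Rep_free_gen del: if_split)
  then show ?case
    by (simp add: x letter_bij_def reduced_red) (simp add: red_def)
qed

lemma red_eq_iff: "red u = red u' \<longleftrightarrow> weval free_gen u = weval free_gen u'"
  by (metis weval_free_gen weval_red)

section \<open>The Artin action on the free group\<close>

definition gaps :: "(real \<Rightarrow> 'g::group_add) \<Rightarrow> nat \<Rightarrow> 'g" where
  "gaps v k = - v (real k) + v (real k + 1)"

definition free_colouring :: "real \<Rightarrow> letters bijection" where
  "free_colouring p = (\<Sum>k\<leftarrow>[0..<nat \<lfloor>p\<rfloor>]. free_gen k)"

lemma gaps_free_colouring: "gaps free_colouring = free_gen"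
  by (simp add: fun_eq_iff gaps_def free_colouring_def nat_add_distrib)

text \<open>The Artin automorphism \<open>x_i \<mapsto> x_i x_{i+1} x_i^{-1}\<close>,
  \<open>x_{i+1} \<mapsto> x_i\<close> for \<open>True\<close> and its inverse for
  \<open>False\<close>. The flag \<open>b\<close> distinguishes a letter from its inverse.\<close>

fun subst_letter :: "nat \<Rightarrow> bool \<Rightarrow> nat \<times> bool \<Rightarrow> letters" where
  "subst_letter i True (k, b) =
    (if k = i then [(i, True), (Suc i, b), (i, False)] else if k = Suc i then [(i, b)] else [(k, b)])"
| "subst_letter i False (k, b) =
    (if k = i then [(Suc i, b)] else if k = Suc i then [(Suc i, False), (i, b), (Suc i, True)]
     else [(k, b)])"

definition subst :: "nat \<Rightarrow> bool \<Rightarrow> letters \<Rightarrow> letters" where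
  "subst i s u = concat (map (subst_letter i s) u)"

lemma gaps_sig_act:
  "gaps (sig_act i v) k = (if k = i then gaps v i + (gaps v (Suc i) + - gaps v i)
     else if k = Suc i then gaps v i else gaps v k)" (is ?A)
  "gaps (sig_act_inv i v) k = (if k = i then gaps v (Suc i)
     else if k = Suc i then - gaps v (Suc i) + (gaps v i + gaps v (Suc i)) else gaps v k)" (is ?B)
proof -
  consider "k < i" | "k = i" | "k = Suc i" | "real k \<ge> real i + 2" by linarith
  then show ?A
    by cases (auto simp: gaps_def sig_act_def minus_add add.assoc
        add.commute[of _ "real i"] simp del: add_uminus_conv_diff)
  consider "k < i" | "k = i" | "k = Suc i" | "real k \<ge> real i + 2" by linarith
  then show ?B
    by cases (auto simp: gaps_def sig_act_inv_def minus_add add.assoc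
        add.commute[of _ "real i"] simp del: add_uminus_conv_diff)
qed

lemma weval_subst:
  "weval (gaps (letter_act (Sig i, s) v)) u = weval (gaps v) (subst i s u)"
proof (induction u)
  case (Cons x u)
  then show ?case
    by (cases x; cases s)
      (auto simp: subst_def gaps_sig_act minus_add add.assoc simp del: add_uminus_conv_diff)
qed (simp add: subst_def)

lemma red_subst_red: "red (subst i s (red u)) = red (subst i s u)"
  by (simp add: red_eq_iff weval_red flip: gaps_free_colouring weval_subst)

lemma red_subst_inverse: "red (subst i s (subst i (\<not> s) u)) = red u"
  using letter_act_inverse[of "Sig i" s free_colouring]
  by (simp add: red_eq_iff flip: gaps_free_colouring weval_subst)

text \<open>The possible beginnings of the image of a reduced word, by the first letter of the word.
  The table is closed under prepending a letter, which is what controls the cancellations.\<close>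

definition first_letters :: "nat \<Rightarrow> letters \<Rightarrow> letters \<Rightarrow> bool" where
  "first_letters i u r \<longleftrightarrow> (case u of [] \<Rightarrow> r = [] | (k, b) # _ \<Rightarrow>
    if k = i then \<exists>s. r = (i, True) # (Suc i, b) # s
    else if k = Suc i then
      if b then \<exists>s. r = (i, True) # s \<and> (\<forall>c t. s \<noteq> (Suc i, c) # t)
      else \<exists>c t. r = c # t \<and> c \<in> {(i, False), (Suc i, True), (Suc i, False)}
    else \<exists>t. r = (k, b) # t)"

lemma cons_red_irreducible: "\<forall>c t. s \<noteq> (l, c) # t \<Longrightarrow> cons_red (l, b) s = (l, b) # s"
  by (cases s) auto

lemma first_letters_subst: "reduced u \<Longrightarrow> first_letters i u (red (subst i True u))"
proof (induction u)
  case (Cons x u)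
  obtain k b where x: "x = (k, b)" by fastforce
  have *: "first_letters i u (red (subst i True u))"
    using Cons reduced_ConsD by blast
  have r: "red (subst i True (x # u))
      = foldr cons_red (subst_letter i True x) (red (subst i True u))"
    by (simp add: subst_def red_def)
  show ?case
  proof (cases u)
    case Nil
    then show ?thesis unfolding r using x by (auto simp: first_letters_def subst_def red_def)
  next
    case (Cons y u')
    obtain l c where y: "y = (l, c)" by fastforce
    show ?thesis unfolding r using x y Cons * Cons.prems
      by (auto simp: first_letters_def cons_red_irreducible split: if_splits)
  qed
qed (simp add: first_letters_def subst_def red_def)

definition starts :: "nat \<Rightarrow> letters \<Rightarrow> bool" where
  "starts i u \<longleftrightarrow> (\<exists>t. red u = (i, True) # t)"

lemma starts_subst_same: "starts i u \<Longrightarrow> starts i (subst i True u)"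
  using first_letters_subst[OF reduced_red, of i u]
  by (auto simp: starts_def first_letters_def red_subst_red)

text \<open>By the table, an image under the substitution of index \<open>j\<close> can begin with a
  letter of index \<open>i < j\<close> only if the word does. Being an equivalence, the claim for
  the inverse substitution follows by applying it to the substituted word.\<close>

lemma starts_subst_greater:
  assumes "i < j" shows "starts i (subst j s u) \<longleftrightarrow> starts i u"
proof -
  have *: "starts i (subst j True u) \<longleftrightarrow> starts i u" for u
    using first_letters_subst[OF reduced_red, of j u] assms
    by (auto simp: starts_def first_letters_def red_subst_red split: list.splits if_splits)
  have "starts i (subst j False u) \<longleftrightarrow> starts i u"
    using *[of "subst j False u"] red_subst_inverse[of j True u] by (simp add: starts_def)
  with * show ?thesis by (cases s) auto
qed

text \<open>The order is reversed: a right action on colourings corresponds to substitutions in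
  which the last letter of the braid word is applied first.\<close>

fun subst_word :: "gen word \<Rightarrow> letters \<Rightarrow> letters" where
  "subst_word [] u = u"
| "subst_word ((Sig i, s) # w) u = subst i s (subst_word w u)"
| "subst_word ((Thm i, s) # w) u = subst_word w u"

lemma weval_subst_word:
  "w \<in> words (Sig ` {1..}) \<Longrightarrow> weval (gaps (word_act v w)) u = weval (gaps v) (subst_word w u)"
  by (induction w u arbitrary: v rule: subst_word.induct) (auto simp: weval_subst simp del: letter_act.simps)

text \<open>The braid word is processed from its right end. Letters of index above \<open>i\<close>
  fix \<open>x_i^{-1}\<close>; the first \<open>\<sigma>_i\<close> turns it into
  \<open>x_i x_{i+1}^{-1} x_i^{-1}\<close>, which begins with the positive letter
  \<open>x_i\<close>; all further letters keep that beginning.\<close>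

lemma starts_subst_word:
  assumes "\<forall>(g, b)\<in>set w. \<exists>j\<ge>i. g = Sig j" "(Sig i, False) \<notin> set w"
  shows "if (Sig i, True) \<in> set w then starts i (subst_word w [(i, False)])
    else subst_word w [(i, False)] = [(i, False)]"
  using assms
proof (induction w)
  case (Cons x w)
  obtain j b where x: "x = (Sig j, b)" "i \<le> j" using Cons.prems(1) by auto
  have *: "if (Sig i, True) \<in> set w then starts i (subst_word w [(i, False)])
    else subst_word w [(i, False)] = [(i, False)]"
    using Cons by auto
  show ?case
  proof (cases "i = j")
    case True
    then have "b" using Cons.prems x by (cases b) auto
    have "starts i (subst i True [(i, False)])" by (simp add: starts_def subst_def red_def)
    then show ?thesis using * x True \<open>b\<close> starts_subst_same by (auto split: if_splits)
  next
    case False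
    then have "subst j b [(i, False)] = [(i, False)]" using x by (cases b) (auto simp: subst_def)
    then show ?thesis using * x False starts_subst_greater[of i j] by (auto split: if_splits)
  qed
qed simp

section \<open>Braids that act as reparametrisations\<close>

lemma word_act_integers:
  assumes "w \<in> words (Sig ` {1..})" "\<And>k::int. v (real_of_int k) = (0::'g::group_add)"
  shows "word_act v w (real_of_int k) = 0"
  using assms
proof (induction w arbitrary: v k)
  case (Cons x w)
  obtain i b where x: "x = (Sig i, b)" using Cons.prems(1) by (cases x) auto
  have "v (real i) = 0" "v (real i + 1) = 0" "v (real i + 2) = 0"
    "v (real_of_int k + 1) = 0" "v (real_of_int k - 1) = 0" for k
    using Cons.prems(2)[of "int i"] Cons.prems(2)[of "int i + 1"] Cons.prems(2)[of "int i + 2"]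
      Cons.prems(2)[of "k + 1"] Cons.prems(2)[of "k - 1"] by auto
  then have "letter_act x v (real_of_int k) = 0" for k
    using Cons.prems(2) by (simp add: x sig_act_def sig_act_inv_def)
  then show ?case using Cons.IH Cons.prems(1) x by auto
qed simp

lemma word_act_eventually:
  "w \<in> words (Sig ` {1..}) \<Longrightarrow> \<exists>N. \<forall>v::real \<Rightarrow> 'g::group_add. \<forall>p\<ge>N. word_act v w p = v p"
proof (induction w)
  case (Cons x w)
  obtain i b where x: "x = (Sig i, b)" using Cons.prems(1) by (cases x) auto
  obtain N where "\<forall>v::real \<Rightarrow> 'g::group_add. \<forall>p\<ge>N. word_act v w p = v p"
    using Cons x by auto
  then show ?case
    by (intro exI[of _ "max N (real i + 3)"]) (auto simp: x sig_act_def sig_act_inv_def)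
qed simp

lemma Ints_Suc_le:
  assumes "x \<in> \<int>" "real k < x" shows "real (Suc k) \<le> x"
proof -
  obtain z where x: "x = real_of_int z" using assms(1) by (elim Ints_cases)
  then have "int k < z" using assms(2) by linarith
  then show ?thesis using x by linarith
qed

text \<open>The increasing map \<open>?h\<close> fixes 0 and maps integers to integers, so it cannot
  fall below the identity at a natural number. If it exceeded the identity at one, it would do so at
  all later ones, against the finite support of the braid word.\<close>

lemma sigma_word_F_fixes_naturals:
  assumes w: "w \<in> words (Sig ` {1..})" and F: "PB_class w \<in> F"
  shows "word_act v w (real k) = v (real k)"
proof -
  let ?h = "pl (PB_class w)"
  have "words (Sig ` {1..}) \<subseteq> words gens" by (auto simp: words_def gens_def)
  then have wg: "w \<in> words gens" using w by auto
  have act: "word_act v w = v \<circ> ?h" for v :: "real \<Rightarrow> 'g::group_add"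
    using class_act_F[OF F, of v] class_act_PB_class[OF wg, of v] by simp
  have mono: "strict_mono ?h" using F by (rule pl_strict_mono)
  \<comment> \<open>The test colouring vanishes exactly at the integers. A braid word preserves its
    vanishing there, so \<open>?h\<close> can only send integers to integers.\<close>
  have int: "?h (real_of_int k) \<in> \<int>" for k
    using word_act_integers[OF w, of "\<lambda>p. if p \<in> \<int> then 0 else 1::int" k]
    unfolding act by (auto split: if_splits)
  have ge: "real k \<le> ?h (real k)" for k
  proof (induction k)
    case 0
    then show ?case using pl_fixes[OF F, of 0] by simp
  next
    case (Suc k)
    have "?h (real k) < ?h (real (Suc k))" using mono by (simp add: strict_mono_less)
    then show ?case using Suc int[of "int (Suc k)"] by (intro Ints_Suc_le) auto
  qed
  have "\<not> real k < ?h (real k)"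
  proof
    assume *: "real k < ?h (real k)"
    have "real (k + m) < ?h (real (k + m))" for m
    proof (induction m)
      case 0
      then show ?case using * by simp
    next
      case (Suc m)
      have "?h (real (k + m)) < ?h (real (k + Suc m))" using mono by (simp add: strict_mono_less)
      then show ?case
        using Ints_Suc_le[OF _ Suc] int[of "int (k + m)"] by fastforce
    qed
    moreover obtain N where "\<forall>p\<ge>N. word_act (\<lambda>p::real. p) w p = p"
      using word_act_eventually[OF w, where 'g = real] by auto
    then have "?h p = p" if "p \<ge> N" for p using act[of "\<lambda>p::real. p"] that by (simp add: fun_eq_iff)
    moreover obtain m where "real m \<ge> N" using real_arch_simple by blast
    then have "real (k + m) \<ge> N" by simp
    ultimately show False by (metis less_irrefl)
  qed
  then have "?h (real k) = real k" using ge[of k] by simp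
  then show ?thesis unfolding act by simp
qed

text \<open>Larue's argument: the substitution of a word that is positive in \<open>\<sigma>\<^sub>i\<close> maps the inverse of the
  \<open>i\<close>th generator of the free group to a word whose reduced form starts with that generator.\<close>

theorem sigma_positive_notin_F:
  assumes "sigma_positive w" shows "PB_class w \<notin> F"
proof
  assume F: "PB_class w \<in> F"
  obtain i where w: "w \<in> words (Sig ` {1..})"
    and i: "\<forall>(g, b)\<in>set w. \<exists>j\<ge>i. g = Sig j" "(Sig i, True) \<in> set w" "(Sig i, False) \<notin> set w"
    using assms unfolding sigma_positive_def by blast
  have "gaps (word_act free_colouring w) = gaps free_colouring"
    using sigma_word_F_fixes_naturals[OF w F, of free_colouring "Suc _"]
      sigma_word_F_fixes_naturals[OF w F, of free_colouring]
    by (simp add: gaps_def fun_eq_iff add.commute)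
  then have "red (subst_word w [(i, False)]) = red [(i, False)]"
    using weval_subst_word[OF w, of free_colouring]
    by (simp add: red_eq_iff gaps_free_colouring del: weval_simps)
  moreover have "starts i (subst_word w [(i, False)])"
    using starts_subst_word[OF i(1,3)] i(2) by simp
  ultimately show False by (simp add: starts_def red_def)
qed

section \<open>The order of braids\<close>

definition tail_braids :: "nat \<Rightarrow> gen word set set" where
  "tail_braids i = generate PB (sig ` {i..})"

text \<open>Group-level form of \<open>\<sigma>\<close>-positivity with least index
  \<open>i\<close>: at least one \<open>sig i\<close> occurs, and every other factor has larger
  index. Arguments about words thereby become rule inductions.\<close>

inductive_set sigma_pos :: "nat \<Rightarrow> gen word set set" for i where
  base: "h \<in> tail_braids (Suc i) \<Longrightarrow> h' \<in> tail_braids (Suc i) \<Longrightarrow> h \<cdot> sig i \<cdot> h' \<in> sigma_pos i"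
| mult: "x \<in> sigma_pos i \<Longrightarrow> y \<in> sigma_pos i \<Longrightarrow> x \<cdot> y \<in> sigma_pos i"

lemma sig_atLeast_carrier: "1 \<le> i \<Longrightarrow> sig ` {i..} \<subseteq> carrier PB"
  by auto

lemma subgroup_tail_braids: "1 \<le> i \<Longrightarrow> subgroup (tail_braids i) PB"
  unfolding tail_braids_def by (intro PB.generate_is_subgroup sig_atLeast_carrier)

lemma tail_braids_1: "tail_braids 1 = B_inf"
  by (simp add: tail_braids_def B_inf_def)

lemma tail_braids_antimono: "i \<le> j \<Longrightarrow> tail_braids j \<subseteq> tail_braids i"
  unfolding tail_braids_def by (intro PB.mono_generate image_mono) auto

lemma tail_braids_carrier: "1 \<le> i \<Longrightarrow> x \<in> tail_braids i \<Longrightarrow> x \<in> carrier PB"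
  by (rule subgroup.mem_carrier[OF subgroup_tail_braids])

lemma tail_braids_closed:
  assumes "1 \<le> i"
  shows "\<e> \<in> tail_braids i" "x \<in> tail_braids i \<Longrightarrow> y \<in> tail_braids i \<Longrightarrow> x \<cdot> y \<in> tail_braids i"
    "x \<in> tail_braids i \<Longrightarrow> \<i> x \<in> tail_braids i"
  using subgroup_tail_braids[OF assms]
  by (blast intro: subgroup.one_closed subgroup.m_closed subgroup.m_inv_closed)+

lemma sig_tail_braids: "i \<le> j \<Longrightarrow> sig j \<in> tail_braids i"
  unfolding tail_braids_def by (intro generate.incl) auto

lemma tail_braids_induct [consumes 2, case_names one mult inv]:
  assumes "1 \<le> i" "x \<in> tail_braids i" "P \<e>"
    "\<And>x j. x \<in> tail_braids i \<Longrightarrow> P x \<Longrightarrow> i \<le> j \<Longrightarrow> P (x \<cdot> sig j)"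
    "\<And>x j. x \<in> tail_braids i \<Longrightarrow> P x \<Longrightarrow> i \<le> j \<Longrightarrow> P (x \<cdot> \<i> sig j)"
  shows "P x"
  using generate_induct_right[OF sig_atLeast_carrier[OF assms(1)], of x P] assms(2-)
  unfolding tail_braids_def by auto

lemma shift_tail_braids:
  assumes "1 \<le> i" "x \<in> tail_braids i" shows "shift x \<in> tail_braids (Suc i)"
  using assms
proof (induction rule: tail_braids_induct)
  case (mult x j)
  then show ?case using assms(1) tail_braids_carrier[OF assms(1), of x]
    by (auto simp: shift_sig intro!: tail_braids_closed sig_tail_braids)
next
  case (inv x j)
  then show ?case using assms(1) tail_braids_carrier[OF assms(1), of x]
    by (auto simp: shift_sig intro!: tail_braids_closed sig_tail_braids)
qed (simp add: tail_braids_closed)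

lemma PB_commute_inv:
  assumes "x \<in> carrier PB" "y \<in> carrier PB" "x \<cdot> y = y \<cdot> x"
  shows "\<i> x \<cdot> y = y \<cdot> \<i> x"
proof -
  have "\<i> x \<cdot> y = \<i> x \<cdot> (y \<cdot> x \<cdot> \<i> x)" using assms(1,2) by (simp add: PB.m_assoc)
  also have "\<dots> = y \<cdot> \<i> x" using assms(1,2) by (simp add: PB.m_assoc flip: assms(3))
  finally show ?thesis .
qed

lemma PB_commute_mult:
  assumes "x \<in> carrier PB" "y \<in> carrier PB" "z \<in> carrier PB" "x \<cdot> z = z \<cdot> x" "y \<cdot> z = z \<cdot> y"
  shows "x \<cdot> y \<cdot> z = z \<cdot> (x \<cdot> y)"
proof -
  have "x \<cdot> y \<cdot> z = x \<cdot> z \<cdot> y" using assms(1,2,3,5) by (simp add: PB.m_assoc)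
  then show ?thesis using assms(1-4) by (simp add: PB.m_assoc)
qed

lemma tail_braids_commute:
  assumes "1 \<le> i" "x \<in> tail_braids (i + 2)" shows "x \<cdot> sig i = sig i \<cdot> x"
proof -
  have *: "\<i> sig j \<cdot> sig i = sig i \<cdot> \<i> sig j" if "i + 2 \<le> j" for j
    using sig_sig[OF assms(1) that] that assms(1) by (intro PB_commute_inv) auto
  have "1 \<le> i + 2" by simp
  from this assms(2) show ?thesis
  proof (induction rule: tail_braids_induct)
    case (mult x j)
    then show ?case
      using assms(1) sig_sig[OF assms(1), of j] tail_braids_carrier[of "i + 2" x]
      by (intro PB_commute_mult) auto
  next
    case (inv x j)
    then show ?case
      using assms(1) *[of j] tail_braids_carrier[of "i + 2" x]
      by (intro PB_commute_mult) auto
  qed (use assms(1) in simp)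
qed

lemma sigma_pos_tail_braids:
  assumes "1 \<le> i" "x \<in> sigma_pos i" shows "x \<in> tail_braids i"
  using assms(2)
proof induction
  case (base h h')
  then have "h \<in> tail_braids i" "h' \<in> tail_braids i" using tail_braids_antimono[of i "Suc i"] by auto
  then show ?case using assms(1) by (intro tail_braids_closed sig_tail_braids) auto
qed (use assms(1) tail_braids_closed in auto)

lemma sigma_pos_carrier: "1 \<le> i \<Longrightarrow> x \<in> sigma_pos i \<Longrightarrow> x \<in> carrier PB"
  using sigma_pos_tail_braids tail_braids_carrier by blast

lemma sigma_pos_mult_tail:
  assumes "1 \<le> i" "x \<in> sigma_pos i" "h \<in> tail_braids (Suc i)"
  shows "h \<cdot> x \<in> sigma_pos i" "x \<cdot> h \<in> sigma_pos i"
proof -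
  have h: "h \<in> carrier PB" using tail_braids_carrier[of "Suc i"] assms by simp
  have c: "k \<in> carrier PB" if "k \<in> tail_braids (Suc i)" for k
    using tail_braids_carrier[of "Suc i"] that by simp
  show "h \<cdot> x \<in> sigma_pos i" using assms(2)
  proof induction
    case (base k k')
    then have "h \<cdot> (k \<cdot> sig i \<cdot> k') = (h \<cdot> k) \<cdot> sig i \<cdot> k'"
      using assms(1) c h by (simp add: PB.m_assoc)
    then show ?case using base assms by (simp add: sigma_pos.base tail_braids_closed)
  next
    case (mult x y)
    then have "h \<cdot> (x \<cdot> y) = h \<cdot> x \<cdot> y"
      using sigma_pos_carrier assms(1) h by (simp add: PB.m_assoc)
    then show ?case using mult by (simp add: sigma_pos.mult)
  qed
  show "x \<cdot> h \<in> sigma_pos i" using assms(2)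
  proof induction
    case (base k k')
    then have "k \<cdot> sig i \<cdot> k' \<cdot> h = k \<cdot> sig i \<cdot> (k' \<cdot> h)"
      using assms(1) c h by (simp add: PB.m_assoc)
    then show ?case using base assms by (simp add: sigma_pos.base tail_braids_closed)
  next
    case (mult x y)
    then have "x \<cdot> y \<cdot> h = x \<cdot> (y \<cdot> h)"
      using sigma_pos_carrier assms(1) h by (simp add: PB.m_assoc)
    then show ?case using mult by (simp add: sigma_pos.mult)
  qed
qed

lemma sig_sigma_pos: "1 \<le> i \<Longrightarrow> sig i \<in> sigma_pos i"
  using sigma_pos.base[of \<e> i \<e>] tail_braids_closed(1)[of "Suc i"] by simp

text \<open>The smaller index governs the product, since the other factor then lies in the tail
  braids that positivity of that index ignores.\<close>

lemma sigma_pos_mult: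
  assumes "1 \<le> i" "1 \<le> j" "x \<in> sigma_pos i" "y \<in> sigma_pos j"
  shows "\<exists>k\<ge>1. x \<cdot> y \<in> sigma_pos k"
proof -
  consider "i = j" | "i < j" | "j < i" by linarith
  then show ?thesis
  proof cases
    case 2
    then have "y \<in> tail_braids (Suc i)"
      using assms sigma_pos_tail_braids tail_braids_antimono[of "Suc i" j] by auto
    then show ?thesis using assms sigma_pos_mult_tail(2) by blast
  next
    case 3
    then have "x \<in> tail_braids (Suc j)"
      using assms sigma_pos_tail_braids tail_braids_antimono[of "Suc j" i] by auto
    then show ?thesis using assms sigma_pos_mult_tail(1) by blast
  qed (use assms sigma_pos.mult in blast)
qed

lemma shift_sigma_pos:
  assumes "1 \<le> i" "x \<in> sigma_pos i" shows "shift x \<in> sigma_pos (Suc i)"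
  using assms(2)
proof induction
  case (base h h')
  then have "h \<in> carrier PB" "h' \<in> carrier PB" using tail_braids_carrier[of "Suc i"] by auto
  then show ?case
    using base assms(1) by (simp add: shift_sig sigma_pos.base shift_tail_braids)
next
  case (mult x y)
  then show ?case using sigma_pos_carrier assms(1) by (simp add: sigma_pos.mult)
qed

lemma words_Sig_gens: "1 \<le> i \<Longrightarrow> w \<in> words (Sig ` {i..}) \<Longrightarrow> w \<in> words gens"
  by (fastforce simp: words_def gens_def lists_eq_set)

lemma sigma_positive_sigma_pos:
  assumes "sigma_positive w" shows "\<exists>i\<ge>1. PB_class w \<in> sigma_pos i"
proof -
  obtain i where w: "w \<in> words (Sig ` {1..})"
    and i: "\<forall>(g, b)\<in>set w. \<exists>j\<ge>i. g = Sig j" "(Sig i, True) \<in> set w" "(Sig i, False) \<notin> set w"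
    using assms unfolding sigma_positive_def by blast
  have i1: "1 \<le> i" using w i(2) by (auto simp: words_def lists_eq_set)
  have "if (Sig i, True) \<in> set w then PB_class w \<in> sigma_pos i else PB_class w \<in> tail_braids (Suc i)"
    using w i(1,3)
  proof (induction w)
    case Nil
    then show ?case by (simp add: PB_class_Nil tail_braids_closed)
  next
    case (Cons x w)
    obtain j b where x: "x = (Sig j, b)" "i \<le> j" using Cons.prems(2) by auto
    have *: "if (Sig i, True) \<in> set w then PB_class w \<in> sigma_pos i
      else PB_class w \<in> tail_braids (Suc i)"
      using Cons by auto
    have c: "PB_class (x # w) = (if b then sig j else \<i> sig j) \<cdot> PB_class w"
      using Cons.prems(1) words_Sig_gens[of 1 w] x i1
      by (auto simp: PB_class_Cons[of _ w] PB_class_neg sig_def)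
    show ?case
    proof (cases "i = j")
      case True
      then have "b" using Cons.prems x by (cases b) auto
      then have "PB_class (x # w) \<in> sigma_pos i"
        using * c True sig_sigma_pos[OF i1] sigma_pos_mult_tail(2)[OF i1]
        by (auto split: if_splits intro: sigma_pos.mult)
      then show ?thesis using x True \<open>b\<close> by simp
    next
      case False
      then have "(if b then sig j else \<i> sig j) \<in> tail_braids (Suc i)"
        using x sig_tail_braids tail_braids_closed by auto
      then show ?thesis
        using * x False c sigma_pos_mult_tail(1)[OF i1] tail_braids_closed(2)[of "Suc i"]
        by (auto split: if_splits)
    qed
  qed
  then show ?thesis using i(2) i1 by auto
qed

lemma tail_braids_word:
  assumes "1 \<le> i" "x \<in> tail_braids i" shows "\<exists>w\<in>words (Sig ` {i..}). PB_class w = x"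
  using assms
proof (induction rule: tail_braids_induct)
  case one
  show ?case by (rule bexI[of _ "[]"]) (simp_all add: PB_class_Nil)
next
  case (mult x j)
  then obtain w where "w \<in> words (Sig ` {i..})" "PB_class w = x" by blast
  then show ?case
    using mult assms(1) words_Sig_gens[of i w]
    by (intro bexI[of _ "w @ [(Sig j, True)]"]) (auto simp: sig_def simp flip: PB_class_mult)
next
  case (inv x j)
  then obtain w where "w \<in> words (Sig ` {i..})" "PB_class w = x" by blast
  then show ?case
    using inv assms(1) words_Sig_gens[of i w]
    by (intro bexI[of _ "w @ [(Sig j, False)]"])
      (auto simp: sig_def PB_class_neg simp flip: PB_class_mult)
qed

lemma sigma_pos_sigma_positive:
  assumes "1 \<le> i" "x \<in> sigma_pos i" shows "\<exists>w. sigma_positive w \<and> PB_class w = x"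
proof -
  have "\<exists>w\<in>words (Sig ` {i..}). (Sig i, True) \<in> set w \<and> (Sig i, False) \<notin> set w \<and> PB_class w = x"
    using assms(2)
  proof induction
    case (base h h')
    then obtain w w' where w: "w \<in> words (Sig ` {Suc i..})" "PB_class w = h"
      "w' \<in> words (Sig ` {Suc i..})" "PB_class w' = h'"
      using tail_braids_word by (metis le_SucI assms(1))
    have "words (Sig ` {Suc i..}) \<subseteq> words (Sig ` {i..})"
      unfolding words_def by (intro lists_mono) auto
    moreover have "PB_class (w @ [(Sig i, True)] @ w') = h \<cdot> sig i \<cdot> h'"
      using w assms(1) words_Sig_gens[of "Suc i" w] words_Sig_gens[of "Suc i" w']
        PB_class_carrier[of w] PB_class_carrier[of w']
      by (simp add: sig_def PB.m_assoc PB_class_Cons[of _ w'] flip: PB_class_mult[of w])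
    ultimately show ?case
      using w assms(1)
      by (intro bexI[of _ "w @ [(Sig i, True)] @ w'"]) (auto simp: words_def lists_eq_set)
  next
    case (mult x y)
    then obtain w w' where "w \<in> words (Sig ` {i..})" "(Sig i, True) \<in> set w" "(Sig i, False) \<notin> set w"
      "PB_class w = x" "w' \<in> words (Sig ` {i..})" "(Sig i, False) \<notin> set w'" "PB_class w' = y"
      by blast
    then show ?case
      using assms(1) words_Sig_gens[of i w] words_Sig_gens[of i w']
      by (intro bexI[of _ "w @ w'"]) (auto simp flip: PB_class_mult)
  qed
  then obtain w where w: "w \<in> words (Sig ` {i..})" "(Sig i, True) \<in> set w" "(Sig i, False) \<notin> set w"
    "PB_class w = x" by blast
  then have "sigma_positive w"
    unfolding sigma_positive_def words_def lists_eq_set using assms(1)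
    by (intro conjI exI[of _ i]) fastforce+
  then show ?thesis using w by blast
qed

lemma less_B_iff:
  "(x, y) \<in> less_B \<longleftrightarrow> x \<in> B_inf \<and> y \<in> B_inf \<and> (\<exists>i\<ge>1. \<i> x \<cdot> y \<in> sigma_pos i)"
  unfolding less_B_def using sigma_positive_sigma_pos sigma_pos_sigma_positive by fastforce

lemma sigma_pos_notin_F: "1 \<le> i \<Longrightarrow> x \<in> sigma_pos i \<Longrightarrow> x \<notin> F"
  using sigma_pos_sigma_positive sigma_positive_notin_F by blast

section \<open>Special braids and left self-distributivity\<close>

text \<open>Trees are evaluated by Dehornoy's bracket on braids, with leaves sent to the unit. The
  bracket of \<open>x\<close> and \<open>y\<close> is
  \<open>x \<cdot> shift y \<cdot> sig 1 \<cdot> (shift x)^{-1}\<close>.\<close>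

fun special :: "tree \<Rightarrow> gen word set" where
  "special Leaf = \<e>"
| "special (Node a b) = special a \<cdot> shift (special b) \<cdot> sig 1 \<cdot> \<i> shift (special a)"

lemma shift_B_inf: "x \<in> B_inf \<Longrightarrow> shift x \<in> B_inf"
  using shift_tail_braids[of 1 x] tail_braids_antimono[of 1 2]
  by (auto simp: tail_braids_1[simplified] numeral_2_eq_2)

lemma special_B_inf: "special t \<in> B_inf"
  by (induction t) (auto simp: shift_B_inf)

lemma special_carrier [simp]: "special t \<in> carrier PB"
  using special_B_inf by auto

lemma shift_special_tail: "shift (special t) \<in> tail_braids 2"
  using shift_tail_braids[of 1 "special t"] special_B_inf[of t]
  by (simp add: tail_braids_1[simplified] numeral_2_eq_2)

lemma shift_shift_commute_sig_1:
  assumes "x \<in> B_inf" shows "shift (shift x) \<cdot> sig 1 = sig 1 \<cdot> shift (shift x)"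
proof -
  have "shift (shift x) \<in> tail_braids (1 + 2)"
    using shift_tail_braids[of 2 "shift x"] shift_tail_braids[of 1 x] assms
    by (simp add: tail_braids_1[simplified] numeral_2_eq_2)
  then show ?thesis by (intro tail_braids_commute) auto
qed

text \<open>Self-distributivity of the bracket comes down to the braid relation between
  \<open>sig 1\<close> and \<open>sig 2\<close> and to the commutation of \<open>sig 1\<close> with
  everything shifted twice.\<close>

lemma special_distrib:
  "special (Node a (Node b c)) = special (Node (Node a b) (Node a c))"
proof -
  define x y z s t where "x = special a" and "y = special b" and "z = special c"
    and "s = sig 1" and "t = sig 2"
  have [simp]: "x \<in> carrier PB" "y \<in> carrier PB" "z \<in> carrier PB" "s \<in> carrier PB" "t \<in> carrier PB"
    by (simp_all add: x_def y_def z_def s_def t_def)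
  have shs [simp]: "shift s = t" unfolding s_def t_def using shift_sig[of 1] by (simp add: numeral_2_eq_2)
  have comm: "shift (shift u) \<cdot> s = s \<cdot> shift (shift u)" if "u \<in> {x, y, z}" for u
    unfolding s_def using that special_B_inf
    by (intro shift_shift_commute_sig_1) (auto simp: x_def y_def z_def)
  have icomm: "\<i> shift (shift u) \<cdot> s = s \<cdot> \<i> shift (shift u)" if "u \<in> {x, y, z}" for u
    using that by (intro PB_commute_inv comm) auto
  have braid': "s \<cdot> t \<cdot> s = t \<cdot> s \<cdot> t"
    unfolding s_def t_def by (rule braid[of 1, unfolded Suc_1, OF order_refl])
  have inv_t: "s \<cdot> (t \<cdot> (s \<cdot> (\<i> t \<cdot> w))) = t \<cdot> (s \<cdot> w)" if "w \<in> carrier PB" for w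
  proof -
    have "s \<cdot> (t \<cdot> (s \<cdot> (\<i> t \<cdot> w))) = (s \<cdot> t \<cdot> s) \<cdot> (\<i> t \<cdot> w)"
      using that by (simp add: PB.m_assoc)
    also have "\<dots> = t \<cdot> (s \<cdot> w)" unfolding braid' using that by (simp add: PB.m_assoc)
    finally show ?thesis .
  qed
  have push: "s \<cdot> (shift (shift u) \<cdot> w) = shift (shift u) \<cdot> (s \<cdot> w)"
    "s \<cdot> (\<i> shift (shift u) \<cdot> w) = \<i> shift (shift u) \<cdot> (s \<cdot> w)"
    if "u \<in> {x, y, z}" "w \<in> carrier PB" for u w
  proof -
    have "u \<in> carrier PB" using that(1) by auto
    then show "s \<cdot> (shift (shift u) \<cdot> w) = shift (shift u) \<cdot> (s \<cdot> w)"
      using that(2) comm[OF that(1)] by (simp flip: PB.m_assoc)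
    show "s \<cdot> (\<i> shift (shift u) \<cdot> w) = \<i> shift (shift u) \<cdot> (s \<cdot> w)"
      using that(2) icomm[OF that(1)] \<open>u \<in> carrier PB\<close> by (simp flip: PB.m_assoc)
  qed
  have "special (Node a (Node b c))
      = x \<cdot> shift (y \<cdot> shift z \<cdot> s \<cdot> \<i> shift y) \<cdot> s \<cdot> \<i> shift x"
    by (simp add: x_def y_def z_def s_def)
  also have "\<dots> = (x \<cdot> shift y \<cdot> s \<cdot> \<i> shift x) \<cdot> shift (x \<cdot> shift z \<cdot> s \<cdot> \<i> shift x) \<cdot> s
      \<cdot> \<i> shift (x \<cdot> shift y \<cdot> s \<cdot> \<i> shift x)"
    by (simp add: PB.m_assoc PB.inv_mult_group push inv_t)
  also have "\<dots> = special (Node (Node a b) (Node a c))"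
    by (simp add: x_def y_def z_def s_def)
  finally show ?thesis .
qed

section \<open>Self-distributive expansion of trees and its confluence\<close>

inductive expand1 :: "tree \<Rightarrow> tree \<Rightarrow> bool" where
  top: "expand1 (Node a (Node b c)) (Node (Node a b) (Node a c))"
| left: "expand1 a a' \<Longrightarrow> expand1 (Node a b) (Node a' b)"
| right: "expand1 b b' \<Longrightarrow> expand1 (Node a b) (Node a b')"

abbreviation expand :: "tree \<Rightarrow> tree \<Rightarrow> bool" (infix "\<leadsto>" 50) where
  "expand \<equiv> expand1\<^sup>*\<^sup>*"

lemma special_expand1: "expand1 s t \<Longrightarrow> special s = special t"
proof (induction rule: expand1.induct)
  case (top a b c)
  show ?case by (rule special_distrib)
qed simp_all

lemma special_expand: "s \<leadsto> t \<Longrightarrow> special s = special t"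
  by (induction rule: rtranclp_induct) (simp_all add: special_expand1)

lemma expand_Node:
  assumes "a \<leadsto> a'" "b \<leadsto> b'" shows "Node a b \<leadsto> Node a' b'"
proof -
  have "Node a b \<leadsto> Node a' b"
    using assms(1) by induction (auto intro: expand1.left rtranclp.rtrancl_into_rtrancl)
  also have "Node a' b \<leadsto> Node a' b'"
    using assms(2) by induction (auto intro: expand1.right rtranclp.rtrancl_into_rtrancl)
  finally show ?thesis .
qed

lemma expand_top: "Node a (Node b c) \<leadsto> Node (Node a b) (Node a c)"
  by (intro r_into_rtranclp expand1.top)

fun distribute :: "tree \<Rightarrow> tree \<Rightarrow> tree" where
  "distribute a Leaf = Node a Leaf"
| "distribute a (Node b c) = Node (distribute a b) (distribute a c)"

text \<open>\<open>full t\<close> is a common expansion of all trees obtained from \<open>t\<close> by one expansion step.\<close>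

fun full :: "tree \<Rightarrow> tree" where
  "full Leaf = Leaf"
| "full (Node a b) = distribute (full a) (full b)"

lemma expand_distribute: "Node a b \<leadsto> distribute a b"
proof (induction b)
  case (Node b c)
  then show ?case using expand_top[of a b c] expand_Node by (metis distribute.simps(2) rtranclp_trans)
qed simp

lemma distribute_mono_left: "a \<leadsto> a' \<Longrightarrow> distribute a b \<leadsto> distribute a' b"
  by (induction b) (simp_all add: expand_Node)

lemma distribute_expand1: "expand1 b b' \<Longrightarrow> distribute a b \<leadsto> distribute a b'"
  by (induction rule: expand1.induct) (simp_all add: expand_Node expand_top)

lemma distribute_mono:
  assumes "a \<leadsto> a'" "b \<leadsto> b'" shows "distribute a b \<leadsto> distribute a' b'"
proof -
  have "distribute a b \<leadsto> distribute a b'"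
    using assms(2) by induction (auto dest: distribute_expand1[of _ _ a])
  also have "\<dots> \<leadsto> distribute a' b'" using assms(1) by (rule distribute_mono_left)
  finally show ?thesis .
qed

text \<open>Needed for an expansion at the root in \<open>full_expand1\<close>;
  \<open>Node_distribute\<close> does the same for \<open>expand1_full\<close>.\<close>

lemma distribute_distribute:
  "distribute a (distribute b c) \<leadsto> distribute (distribute a b) (distribute a c)"
proof (induction c)
  case Leaf
  have "Node (distribute a b) (Node a Leaf) \<leadsto> Node (Node (distribute a b) a) (Node (distribute a b) Leaf)"
    by (rule expand_top)
  also have "\<dots> \<leadsto> Node (distribute (distribute a b) a) (Node (distribute a b) Leaf)"
    by (simp add: expand_Node expand_distribute)
  finally show ?case by simp
qed (simp add: expand_Node)

lemma Node_distribute: "Node (Node a b) (Node a c) \<leadsto> distribute a (distribute b c)"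
proof (induction c)
  case Leaf
  show ?case by (simp add: expand_Node expand_distribute)
next
  case (Node c d)
  have "Node (Node a b) (Node a (Node c d)) \<leadsto> Node (Node a b) (Node (Node a c) (Node a d))"
    by (simp add: expand_Node expand_top)
  also have "\<dots> \<leadsto> Node (Node (Node a b) (Node a c)) (Node (Node a b) (Node a d))"
    by (rule expand_top)
  also have "\<dots> \<leadsto> distribute a (distribute b (Node c d))"
    using Node by (simp add: expand_Node)
  finally show ?case .
qed

lemma expand_full: "t \<leadsto> full t"
proof (induction t)
  case (Node a b)
  then show ?case using expand_Node expand_distribute by (metis full.simps(2) rtranclp_trans)
qed simp

lemma expand1_full: "expand1 t u \<Longrightarrow> u \<leadsto> full t"
proof (induction rule: expand1.induct)
  case (top a b c)
  have "Node (Node a b) (Node a c) \<leadsto> Node (Node (full a) (full b)) (Node (full a) (full c))"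
    by (intro expand_Node expand_full)
  also have "\<dots> \<leadsto> full (Node a (Node b c))" by (simp add: Node_distribute)
  finally show ?case .
next
  case (left a a' b)
  then show ?case
    using expand_Node[of a' "full a" b "full b"] expand_full expand_distribute
    by (metis full.simps(2) rtranclp_trans)
next
  case (right b b' a)
  then show ?case
    using expand_Node[of a "full a" b' "full b"] expand_full expand_distribute
    by (metis full.simps(2) rtranclp_trans)
qed

lemma full_expand1: "expand1 t u \<Longrightarrow> full t \<leadsto> full u"
  by (induction rule: expand1.induct) (auto intro: distribute_distribute distribute_mono)

lemma full_mono: "t \<leadsto> u \<Longrightarrow> full t \<leadsto> full u"
  by (induction rule: rtranclp_induct) (auto dest: full_expand1)

lemma expand_iterate: "m \<le> n \<Longrightarrow> (full ^^ m) t \<leadsto> (full ^^ n) t"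
  by (induction n rule: dec_induct) (auto intro: rtranclp_trans expand_full)

text \<open>Expansion does not terminate, so local confluence would not suffice. Instead the
  iterates of \<open>full\<close> form a chain that is cofinal among the expansions of
  \<open>t\<close>, and two expansions meet at the larger of two iterates.\<close>

lemma expand_full_iterate: "t \<leadsto> u \<Longrightarrow> \<exists>n. u \<leadsto> (full ^^ n) t"
proof (induction rule: rtranclp_induct)
  case base
  show ?case by (rule exI[of _ 0]) simp
next
  case (step u v)
  then obtain n where "u \<leadsto> (full ^^ n) t" by blast
  then have "v \<leadsto> (full ^^ Suc n) t"
    using expand1_full[OF step.hyps(2)] full_mono by (fastforce intro: rtranclp_trans)
  then show ?case by blast
qed

definition joinable :: "tree \<Rightarrow> tree \<Rightarrow> bool" (infix "\<approx>" 50) where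
  "s \<approx> t \<longleftrightarrow> (\<exists>u. s \<leadsto> u \<and> t \<leadsto> u)"

lemma expand_confluent: "t \<leadsto> u \<Longrightarrow> t \<leadsto> v \<Longrightarrow> u \<approx> v"
  unfolding joinable_def
  by (meson expand_full_iterate expand_iterate max.cobounded1 max.cobounded2 rtranclp_trans)

lemma joinable_sym: "s \<approx> t \<Longrightarrow> t \<approx> s"
  by (auto simp: joinable_def)

lemma expand_joinable: "s \<leadsto> t \<Longrightarrow> s \<approx> t"
  by (auto simp: joinable_def)

lemma joinable_trans [trans]: "s \<approx> t \<Longrightarrow> t \<approx> u \<Longrightarrow> s \<approx> u"
  unfolding joinable_def using expand_confluent[unfolded joinable_def] by (meson rtranclp_trans)

lemma joinable_Node: "a \<approx> a' \<Longrightarrow> b \<approx> b' \<Longrightarrow> Node a b \<approx> Node a' b'"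
  unfolding joinable_def using expand_Node by blast

fun right_power :: "nat \<Rightarrow> tree" where
  "right_power 0 = Leaf"
| "right_power (Suc n) = Node Leaf (right_power n)"

text \<open>As \<open>right_power\<close> counts from 0, \<open>right_power n\<close> is the right
  power with \<open>n + 1\<close> leaves. Large right powers absorb any tree put on their left; thus
  two arbitrary trees acquire equivalent products with one and the same right factor.\<close>

lemma absorption: "\<exists>m. \<forall>n\<ge>m. right_power (Suc n) \<approx> Node t (right_power n)"
proof (induction t)
  case Leaf
  show ?case by (simp add: expand_joinable)
next
  case (Node a b)
  then obtain k l where a: "\<And>n. n \<ge> k \<Longrightarrow> right_power (Suc n) \<approx> Node a (right_power n)"
    and b: "\<And>n. n \<ge> l \<Longrightarrow> right_power (Suc n) \<approx> Node b (right_power n)" by blast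
  \<comment> \<open>One more than the two thresholds is required, because both hypotheses are also
    used for the predecessor \<open>p\<close> of \<open>n\<close>.\<close>
  have "right_power (Suc n) \<approx> Node (Node a b) (right_power n)" if n: "n \<ge> Suc (max k l)" for n
  proof -
    obtain p where p: "n = Suc p" "p \<ge> k" "p \<ge> l" using n by (cases n) auto
    have refl: "t \<approx> t" for t by (simp add: expand_joinable)
    have "right_power (Suc n) \<approx> Node a (right_power n)" by (rule a) (use p in simp)
    also have "\<dots> \<approx> Node a (Node b (right_power p))"
      using joinable_Node[OF refl b[OF p(3)]] p by simp
    also have "\<dots> \<approx> Node (Node a b) (Node a (right_power p))"
      by (intro expand_joinable expand_top)
    also have "\<dots> \<approx> Node (Node a b) (right_power n)"
      using joinable_Node[OF refl joinable_sym[OF a[OF p(2)]]] p by simp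
    finally show ?thesis .
  qed
  then show ?case by blast
qed

inductive left_sub :: "tree \<Rightarrow> tree \<Rightarrow> bool" where
  "left_sub a (Node a b)"
| "left_sub s a \<Longrightarrow> left_sub s (Node a b)"

lemma left_sub_Node: "left_sub s (Node a b) \<longleftrightarrow> s = a \<or> left_sub s a"
  by (auto intro: left_sub.intros elim: left_sub.cases)

text \<open>Going from \<open>a\<close> to \<open>Node a b\<close> multiplies the special braid on
  the right by a braid with a single \<open>sig 1\<close> between elements of
  \<open>tail_braids 2\<close>.\<close>

lemma left_sub_sigma_pos: "left_sub s t \<Longrightarrow> \<i> special s \<cdot> special t \<in> sigma_pos 1"
proof (induction rule: left_sub.induct)
  case (1 a b)
  have "shift (special b) \<cdot> sig 1 \<cdot> \<i> shift (special a) \<in> sigma_pos 1"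
    using shift_special_tail tail_braids_closed(3)[of 2]
    by (intro sigma_pos.base) (simp_all add: numeral_2_eq_2)
  then show ?case by (simp add: PB.m_assoc)
next
  case (2 s a b)
  have "shift (special b) \<cdot> sig 1 \<cdot> \<i> shift (special a) \<in> sigma_pos 1"
    using shift_special_tail tail_braids_closed(3)[of 2]
    by (intro sigma_pos.base) (simp_all add: numeral_2_eq_2)
  with 2 have "\<i> special s \<cdot> special a \<cdot> (shift (special b) \<cdot> sig 1 \<cdot> \<i> shift (special a)) \<in> sigma_pos 1"
    by (metis sigma_pos.mult)
  then show ?case by (simp add: PB.m_assoc)
qed

text \<open>Expansion at the root only adds new left subtrees, and expansion inside a left subtree
  is matched by expanding \<open>s\<close> itself. Allowing \<open>s = t\<close> covers a step
  taking place within \<open>s\<close>.\<close>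

lemma expand1_left_sub:
  "expand1 t t' \<Longrightarrow> s = t \<or> left_sub s t \<Longrightarrow> \<exists>s'. s \<leadsto> s' \<and> (s' = t' \<or> left_sub s' t')"
proof (induction rule: expand1.induct)
  case (top a b c)
  then show ?case using expand_top[of a b c] by (auto simp: left_sub_Node)
next
  case (left a a' b)
  then show ?case by (metis expand1.left left_sub_Node r_into_rtranclp)
next
  case (right b b' a)
  then show ?case by (metis expand1.right left_sub_Node r_into_rtranclp rtranclp.rtrancl_refl)
qed

lemma expand_left_sub:
  "t \<leadsto> t' \<Longrightarrow> s = t \<or> left_sub s t \<Longrightarrow> \<exists>s'. s \<leadsto> s' \<and> (s' = t' \<or> left_sub s' t')"
proof (induction rule: rtranclp_induct)
  case (step u v)
  then obtain s' where "s \<leadsto> s'" "s' = u \<or> left_sub s' u" by blast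
  moreover obtain s'' where "s' \<leadsto> s''" "s'' = v \<or> left_sub s'' v"
    using expand1_left_sub[OF step.hyps(2)] calculation(2) by blast
  ultimately show ?case using rtranclp_trans by metis
qed blast

lemma left_sub_linear:
  "s = u \<or> left_sub s u \<Longrightarrow> t = u \<or> left_sub t u \<Longrightarrow> s = t \<or> left_sub s t \<or> left_sub t s"
  by (induction u) (auto simp: left_sub_Node elim: left_sub.cases)

text \<open>After multiplication by a large right power, \<open>s\<close> and \<open>t\<close> have
  a common expansion \<open>u\<close>. Both survive, up to expansion, on the leftmost branch of
  \<open>u\<close>, where iterated left subtrees are linearly ordered; expansion does not change the
  special braid.\<close>

lemma special_comparable:
  "special s = special t \<or> \<i> special s \<cdot> special t \<in> sigma_pos 1
    \<or> \<i> special t \<cdot> special s \<in> sigma_pos 1"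
proof -
  obtain k l where "\<forall>n\<ge>k. right_power (Suc n) \<approx> Node s (right_power n)"
    "\<forall>n\<ge>l. right_power (Suc n) \<approx> Node t (right_power n)"
    using absorption by meson
  then have "Node s (right_power (max k l)) \<approx> Node t (right_power (max k l))"
    using joinable_trans joinable_sym by (meson max.cobounded1 max.cobounded2)
  then obtain u where u: "Node s (right_power (max k l)) \<leadsto> u" "Node t (right_power (max k l)) \<leadsto> u"
    by (auto simp: joinable_def)
  obtain s' t' where "s \<leadsto> s'" "s' = u \<or> left_sub s' u" "t \<leadsto> t'" "t' = u \<or> left_sub t' u"
    using expand_left_sub[OF u(1), of s] expand_left_sub[OF u(2), of t] by (auto simp: left_sub_Node)
  then show ?thesis
    using left_sub_linear left_sub_sigma_pos special_expand by metis
qed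

section \<open>Positive braids as sequences of special braids\<close>

fun special_seq :: "tree list \<Rightarrow> gen word set" where
  "special_seq [] = \<e>"
| "special_seq (t # ts) = special t \<cdot> shift (special_seq ts)"

lemma special_seq_B_inf: "special_seq ts \<in> B_inf"
  by (induction ts) (auto simp: special_B_inf shift_B_inf)

lemma special_seq_carrier [simp]: "special_seq ts \<in> carrier PB"
  using special_seq_B_inf by auto

lemma special_seq_unfold: "special_seq ts = special (tree_at ts 0) \<cdot> shift (special_seq (tl ts))"
  by (cases ts) (simp_all add: tree_at_def)

text \<open>A crossing replaces the neighbours \<open>t\<close>, \<open>u\<close> by
  \<open>Node t u\<close>, \<open>t\<close>: the inverse at the end of the bracket is cancelled by
  the shifted copy of \<open>t\<close> that follows.\<close>

lemma special_seq_mult_sig: "1 \<le> i \<Longrightarrow> \<exists>ts'. special_seq ts \<cdot> sig i = special_seq ts'"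
proof (induction i arbitrary: ts rule: nat_induct_at_least)
  case base
  define t u x where "t = tree_at ts 0" and "u = tree_at (tl ts) 0" and "x = tl (tl ts)"
  have "special_seq ts \<cdot> sig 1
      = special t \<cdot> shift (special u) \<cdot> (shift (shift (special_seq x)) \<cdot> sig 1)"
    unfolding special_seq_unfold[of ts] special_seq_unfold[of "tl ts"] t_def u_def x_def
    by (simp add: PB.m_assoc)
  also have "\<dots> = special_seq (Node t u # t # x)"
    by (simp add: shift_shift_commute_sig_1[OF special_seq_B_inf] PB.m_assoc del: One_nat_def)
  finally show ?case by blast
next
  case (Suc i)
  obtain us where "special_seq (tl ts) \<cdot> sig i = special_seq us" using Suc.IH by blast
  then have "special_seq ts \<cdot> sig (Suc i) = special_seq (tree_at ts 0 # us)"
    unfolding special_seq_unfold[of ts] using Suc.hyps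
    by (simp add: PB.m_assoc flip: shift_sig[simplified] shift_mult)
  then show ?case by blast
qed

lemma B_inf_pos_special_seq: "x \<in> B_inf_pos \<Longrightarrow> \<exists>ts. x = special_seq ts"
proof (induction rule: B_inf_pos_induct)
  case one
  show ?case by (rule exI[of _ "[]"]) simp
next
  case (mult x i)
  then show ?case using special_seq_mult_sig by metis
qed

text \<open>A lexicographic comparison: inequality of the first entries is decided by
  \<open>sig 1\<close>, and the shifted remainders are tail braids, which cannot disturb it. Equal
  first entries cancel and leave a shifted quotient.\<close>

lemma special_seq_comparable:
  "special_seq ts = special_seq ts' \<or> (\<exists>i\<ge>1. \<i> special_seq ts \<cdot> special_seq ts' \<in> sigma_pos i)
    \<or> (\<exists>i\<ge>1. \<i> special_seq ts' \<cdot> special_seq ts \<in> sigma_pos i)"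
proof (induction "length ts + length ts'" arbitrary: ts ts' rule: less_induct)
  case less
  show ?case
  proof (cases "ts = [] \<and> ts' = []")
    case False
    define t u x y where "t = special (tree_at ts 0)" and "u = special (tree_at ts' 0)"
      and "x = special_seq (tl ts)" and "y = special_seq (tl ts')"
    have [simp]: "t \<in> carrier PB" "u \<in> carrier PB" "x \<in> carrier PB" "y \<in> carrier PB"
      by (simp_all add: t_def u_def x_def y_def)
    have eq: "special_seq ts = t \<cdot> shift x" "special_seq ts' = u \<cdot> shift y"
      unfolding t_def u_def x_def y_def by (rule special_seq_unfold)+
    have tail: "shift x \<in> tail_braids (Suc 1)" "shift y \<in> tail_braids (Suc 1)"
      using special_seq_B_inf unfolding x_def y_def
      by (intro shift_tail_braids; simp only: tail_braids_1 order_refl)+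
    have quot: "\<i> (t \<cdot> shift x) \<cdot> (u \<cdot> shift y) = \<i> shift x \<cdot> (\<i> t \<cdot> u) \<cdot> shift y"
      "\<i> (u \<cdot> shift y) \<cdot> (t \<cdot> shift x) = \<i> shift y \<cdot> (\<i> u \<cdot> t) \<cdot> shift x"
      by (simp_all add: PB.inv_mult_group PB.m_assoc)
    consider "t = u" | "\<i> t \<cdot> u \<in> sigma_pos 1" | "\<i> u \<cdot> t \<in> sigma_pos 1"
      using special_comparable unfolding t_def u_def by blast
    then show ?thesis
    proof cases
      case 1
      have "x = y \<or> (\<exists>i\<ge>1. \<i> x \<cdot> y \<in> sigma_pos i) \<or> (\<exists>i\<ge>1. \<i> y \<cdot> x \<in> sigma_pos i)"
        unfolding x_def y_def using False by (intro less.hyps) (auto simp: neq_Nil_conv)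
      moreover have "\<i> (t \<cdot> shift x) \<cdot> (u \<cdot> shift y) = shift (\<i> x \<cdot> y)"
        "\<i> (u \<cdot> shift y) \<cdot> (t \<cdot> shift x) = shift (\<i> y \<cdot> x)"
        unfolding quot using 1 by (simp_all add: PB.m_assoc)
      ultimately show ?thesis
        unfolding eq using 1 shift_sigma_pos by (metis le_SucI)
    next
      case 2
      then have "\<i> (t \<cdot> shift x) \<cdot> (u \<cdot> shift y) \<in> sigma_pos 1"
        unfolding quot using tail by (simp add: sigma_pos_mult_tail tail_braids_closed)
      then show ?thesis unfolding eq by blast
    next
      case 3
      then have "\<i> (u \<cdot> shift y) \<cdot> (t \<cdot> shift x) \<in> sigma_pos 1"
        unfolding quot using tail by (simp add: sigma_pos_mult_tail tail_braids_closed)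
      then show ?thesis unfolding eq by blast
    qed
  qed simp
qed

lemma B_inf_pos_comparable:
  assumes "x \<in> B_inf_pos" "y \<in> B_inf_pos" shows "x = y \<or> (x, y) \<in> less_B \<or> (y, x) \<in> less_B"
proof -
  obtain ts ts' where "x = special_seq ts" "y = special_seq ts'"
    using assms B_inf_pos_special_seq by metis
  then show ?thesis
    using special_seq_comparable[of ts ts'] by (auto simp: less_B_iff special_seq_B_inf)
qed

section \<open>Common left multiples\<close>

definition left_ore :: "gen word set set \<Rightarrow> bool" where
  "left_ore M \<longleftrightarrow> (\<forall>p\<in>M. \<forall>q\<in>M. \<exists>u\<in>M. \<exists>v\<in>M. u \<cdot> p = v \<cdot> q)"

lemma left_oreE:
  assumes "left_ore M" "p \<in> M" "q \<in> M"
  obtains u v where "u \<in> M" "v \<in> M" "u \<cdot> p = v \<cdot> q"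
  using assms unfolding left_ore_def by blast

lemma generate_fraction:
  assumes X: "X \<subseteq> carrier PB" "X \<subseteq> M" and M: "submonoid M PB" and ore: "left_ore M"
    and x: "x \<in> generate PB X"
  shows "\<exists>p\<in>M. \<exists>q\<in>M. x = \<i> p \<cdot> q"
proof -
  interpret M: submonoid M PB by fact
  show ?thesis using X(1) x
  proof (induction rule: generate_induct_right)
    case one
    show ?case by (intro bexI[of _ \<e>]) auto
  next
    case (mult x s)
    then obtain p q where pq: "p \<in> M" "q \<in> M" "x = \<i> p \<cdot> q" by blast
    have s: "s \<in> M" using mult X by auto
    then have "x \<cdot> s = \<i> p \<cdot> (q \<cdot> s)" using pq by (simp add: PB.m_assoc)
    then show ?case using pq s by blast
  next
    case (inv x s)
    then obtain p q where pq: "p \<in> M" "q \<in> M" "x = \<i> p \<cdot> q" by blast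
    have s: "s \<in> M" using inv X by auto
    obtain u v where uv: "u \<in> M" "v \<in> M" "u \<cdot> q = v \<cdot> s" using left_oreE[OF ore pq(2) s] .
    \<comment> \<open>The common multiple \<open>u \<cdot> q = v \<cdot> s\<close> makes the
      numerator divisible by \<open>s\<close>, so that the inverse letter is absorbed.\<close>
    have "x \<cdot> \<i> s = \<i> (u \<cdot> p) \<cdot> (u \<cdot> q) \<cdot> \<i> s"
      using pq uv(1) s by (simp add: PB.inv_mult_group PB.m_assoc)
    also have "\<dots> = \<i> (u \<cdot> p) \<cdot> v"
      unfolding uv(3) using pq uv(1,2) s by (simp add: PB.m_assoc)
    finally show ?case using pq uv by blast
  qed
qed

section \<open>Garside theory of finitely many strands\<close>

definition finite_braids :: "nat \<Rightarrow> gen word set set" where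
  "finite_braids n = submonoid_generated PB (sig ` {1..n})"

lemma sig_atLeastAtMost_carrier: "sig ` {1..n} \<subseteq> carrier PB"
  by auto

lemma submonoid_finite_braids: "submonoid (finite_braids n) PB"
  unfolding finite_braids_def
  by (rule submonoid_generated_submonoid[OF PB.monoid_axioms sig_atLeastAtMost_carrier])

lemma finite_braids_closed:
  "\<e> \<in> finite_braids n" "x \<in> finite_braids n \<Longrightarrow> y \<in> finite_braids n \<Longrightarrow> x \<cdot> y \<in> finite_braids n"
  "1 \<le> i \<Longrightarrow> i \<le> n \<Longrightarrow> sig i \<in> finite_braids n"
proof -
  interpret submonoid "finite_braids n" PB by (rule submonoid_finite_braids)
  show "\<e> \<in> finite_braids n" "x \<in> finite_braids n \<Longrightarrow> y \<in> finite_braids n \<Longrightarrow> x \<cdot> y \<in> finite_braids n"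
    by auto
  show "1 \<le> i \<Longrightarrow> i \<le> n \<Longrightarrow> sig i \<in> finite_braids n"
    by (auto simp: finite_braids_def intro!: submonoid_generated_incl)
qed

lemma finite_braids_carrier: "x \<in> finite_braids n \<Longrightarrow> x \<in> carrier PB"
  using submonoid.subset[OF submonoid_finite_braids, of n] by auto

lemma finite_braids_induct [consumes 1, case_names one mult]:
  assumes "x \<in> finite_braids n" "P \<e>"
    "\<And>x i. x \<in> finite_braids n \<Longrightarrow> P x \<Longrightarrow> 1 \<le> i \<Longrightarrow> i \<le> n \<Longrightarrow> P (x \<cdot> sig i)"
  shows "P x"
  using PB.monoid_axioms sig_atLeastAtMost_carrier assms(1)[unfolded finite_braids_def]
proof (induction rule: submonoid_generated_induct)
  case (mult x s)
  then show ?case using assms(3)[of x] unfolding finite_braids_def by auto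
qed (rule assms(2))

lemma finite_braids_mono: "m \<le> n \<Longrightarrow> finite_braids m \<subseteq> finite_braids n"
  unfolding finite_braids_def[of m]
  by (rule submonoid_generated_minimal[OF submonoid_finite_braids])
    (auto intro: finite_braids_closed(3))

lemma finite_braids_pos: "finite_braids n \<subseteq> B_inf_pos"
  unfolding finite_braids_def
  by (rule submonoid_generated_minimal[OF Bp.submonoid_axioms]) auto

lemma B_inf_pos_finite_braids: "x \<in> B_inf_pos \<Longrightarrow> \<exists>n. x \<in> finite_braids n"
proof (induction rule: B_inf_pos_induct)
  case one
  show ?case using finite_braids_closed(1) by blast
next
  case (mult x i)
  then obtain n where "x \<in> finite_braids n" by blast
  then have "x \<in> finite_braids (max n i)" using finite_braids_mono[of n "max n i"] by auto
  then have "x \<cdot> sig i \<in> finite_braids (max n i)"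
    using mult.hyps by (intro finite_braids_closed) auto
  then show ?case by blast
qed

fun cycle_braid :: "nat \<Rightarrow> gen word set" where
  "cycle_braid 0 = \<e>"
| "cycle_braid (Suc n) = cycle_braid n \<cdot> sig (Suc n)"

text \<open>The half twist on \<open>n + 1\<close> strands, as \<open>n\<close> counts generators
  and not strands.\<close>

fun garside :: "nat \<Rightarrow> gen word set" where
  "garside 0 = \<e>"
| "garside (Suc n) = cycle_braid (Suc n) \<cdot> garside n"

lemma cycle_braid_finite: "cycle_braid n \<in> finite_braids n"
proof (induction n)
  case (Suc n)
  then have "cycle_braid n \<in> finite_braids (Suc n)" using finite_braids_mono[of n "Suc n"] by auto
  then show ?case by (simp add: finite_braids_closed)
qed (simp add: finite_braids_closed)

lemma garside_finite: "garside n \<in> finite_braids n"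
proof (induction n)
  case (Suc n)
  then have "garside n \<in> finite_braids (Suc n)" using finite_braids_mono[of n "Suc n"] by auto
  then show ?case using cycle_braid_finite[of "Suc n"] by (auto intro: finite_braids_closed)
qed (simp add: finite_braids_closed)

lemma braid_carriers [simp]: "cycle_braid n \<in> carrier PB" "garside n \<in> carrier PB"
  using cycle_braid_finite garside_finite finite_braids_carrier by blast+

lemma finite_braids_commute:
  assumes "x \<in> finite_braids n" "n + 2 \<le> j" shows "x \<cdot> sig j = sig j \<cdot> x"
  using assms(1)
proof (induction rule: finite_braids_induct)
  case (mult x i)
  then show ?case using assms(2) sig_sig[of i j] finite_braids_carrier
    by (intro PB_commute_mult) auto
qed (use assms in simp)

lemma cycle_braid_sig:
  "1 \<le> i \<Longrightarrow> i < n \<Longrightarrow> cycle_braid n \<cdot> sig i = sig (Suc i) \<cdot> cycle_braid n"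
proof (induction n)
  case (Suc n)
  show ?case
  proof (cases "i = n")
    case True
    then obtain m where m: "n = Suc m" using Suc.prems by (cases n) auto
    have "cycle_braid (Suc n) \<cdot> sig i = cycle_braid m \<cdot> (sig n \<cdot> sig (Suc n) \<cdot> sig n)"
      using True m by (simp add: PB.m_assoc)
    also have "\<dots> = cycle_braid m \<cdot> sig (Suc n) \<cdot> (sig n \<cdot> sig (Suc n))"
      using m by (subst braid) (simp_all add: PB.m_assoc)
    also have "cycle_braid m \<cdot> sig (Suc n) = sig (Suc n) \<cdot> cycle_braid m"
      using m by (intro finite_braids_commute[OF cycle_braid_finite]) simp
    finally show ?thesis using True m by (simp add: PB.m_assoc)
  next
    case False
    then have i: "1 \<le> i" "i < n" using Suc.prems by auto
    have "cycle_braid (Suc n) \<cdot> sig i = cycle_braid n \<cdot> (sig (Suc n) \<cdot> sig i)"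
      using i by (simp add: PB.m_assoc)
    also have "\<dots> = cycle_braid n \<cdot> sig i \<cdot> sig (Suc n)"
      using i sig_sig[of i "Suc n"] by (simp add: PB.m_assoc)
    also have "\<dots> = sig (Suc i) \<cdot> cycle_braid (Suc n)"
      using i Suc.IH by (simp add: PB.m_assoc)
    finally show ?thesis .
  qed
qed simp

lemma shift_cycle_braid: "cycle_braid (Suc n) = sig 1 \<cdot> shift (cycle_braid n)"
proof (induction n)
  case (Suc n)
  have "cycle_braid (Suc (Suc n)) = cycle_braid (Suc n) \<cdot> sig (Suc (Suc n))" by simp
  also have "\<dots> = sig 1 \<cdot> shift (cycle_braid n) \<cdot> sig (Suc (Suc n))" by (simp only: Suc)
  also have "\<dots> = sig 1 \<cdot> shift (cycle_braid (Suc n))" by (simp add: PB.m_assoc shift_sig)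
  finally show ?case .
qed simp

lemma cycle_braid_shift:
  assumes "x \<in> finite_braids n"
  shows "cycle_braid (Suc n) \<cdot> x = shift x \<cdot> cycle_braid (Suc n)"
  using assms
proof (induction rule: finite_braids_induct)
  case (mult x i)
  have x: "x \<in> carrier PB" using mult finite_braids_carrier by blast
  have "cycle_braid (Suc n) \<cdot> (x \<cdot> sig i) = shift x \<cdot> (cycle_braid (Suc n) \<cdot> sig i)"
    using mult x by (simp add: PB.m_assoc del: cycle_braid.simps flip: PB.m_assoc[of _ x])
  also have "\<dots> = shift (x \<cdot> sig i) \<cdot> cycle_braid (Suc n)"
    using mult x cycle_braid_sig[of i "Suc n"]
    by (simp add: PB.m_assoc shift_sig del: cycle_braid.simps)
  finally show ?case .
qed simp

text \<open>Moving a generator across the half twist reverses its index. For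
  \<open>i \<le> n\<close> the inductive flip is followed by the shift through
  \<open>cycle_braid (Suc n)\<close>; the top generator is beyond the induction hypothesis and is
  treated separately.\<close>

lemma garside_sig:
  "1 \<le> i \<Longrightarrow> i \<le> n \<Longrightarrow> garside n \<cdot> sig i = sig (Suc n - i) \<cdot> garside n"
proof (induction n)
  case (Suc n)
  show ?case
  proof (cases "i = Suc n")
    case False
    then have i: "1 \<le> i" "i \<le> n" using Suc.prems by auto
    have "garside (Suc n) \<cdot> sig i = cycle_braid (Suc n) \<cdot> (garside n \<cdot> sig i)"
      using i by (simp add: PB.m_assoc del: cycle_braid.simps)
    also have "\<dots> = cycle_braid (Suc n) \<cdot> sig (Suc n - i) \<cdot> garside n"
      using Suc.IH i by (simp add: PB.m_assoc del: cycle_braid.simps)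
    also have "cycle_braid (Suc n) \<cdot> sig (Suc n - i) = sig (Suc (Suc n - i)) \<cdot> cycle_braid (Suc n)"
      using i by (intro cycle_braid_sig) auto
    finally show ?thesis using i by (simp add: PB.m_assoc Suc_diff_le del: cycle_braid.simps)
  next
    case True
    show ?thesis
    proof (cases n)
      case 0
      then show ?thesis using True by simp
    next
      case (Suc m)
      \<comment> \<open>The top letter commutes with \<open>garside m\<close> and completes
        \<open>cycle_braid n\<close> to a second copy of \<open>?c\<close>. The identity of
        \<open>?c \<cdot> ?c\<close> with \<open>sig 1 \<cdot> (?c \<cdot> cycle_braid n)\<close>
        then releases \<open>sig 1\<close> on the left.\<close>
      let ?c = "cycle_braid (Suc n)"
      have "garside (Suc n) \<cdot> sig i = ?c \<cdot> cycle_braid n \<cdot> (garside m \<cdot> sig (Suc n))"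
        using True Suc by (simp add: PB.m_assoc del: cycle_braid.simps)
      also have "garside m \<cdot> sig (Suc n) = sig (Suc n) \<cdot> garside m"
        using Suc by (intro finite_braids_commute[OF garside_finite]) simp
      also have "?c \<cdot> cycle_braid n \<cdot> (sig (Suc n) \<cdot> garside m) = ?c \<cdot> ?c \<cdot> garside m"
        by (simp add: PB.m_assoc)
      also have "?c \<cdot> ?c = sig 1 \<cdot> (shift (cycle_braid n) \<cdot> ?c)"
        by (subst (1) shift_cycle_braid) (simp add: PB.m_assoc del: cycle_braid.simps)
      also have "shift (cycle_braid n) \<cdot> ?c = ?c \<cdot> cycle_braid n"
        by (rule cycle_braid_shift[OF cycle_braid_finite, symmetric])
      finally show ?thesis using True Suc by (simp add: PB.m_assoc del: cycle_braid.simps)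
    qed
  qed
qed simp

lemma shift_finite_braids: "x \<in> finite_braids n \<Longrightarrow> shift x \<in> finite_braids (Suc n)"
proof (induction rule: finite_braids_induct)
  case (mult x i)
  then show ?case using finite_braids_carrier[of x n]
    by (simp add: shift_sig finite_braids_closed)
qed (simp add: finite_braids_closed)

lemma garside_divisible: "1 \<le> i \<Longrightarrow> i \<le> n \<Longrightarrow> \<exists>y\<in>finite_braids n. garside n = y \<cdot> sig i"
proof (induction n)
  case (Suc n)
  show ?case
  proof (cases "i = Suc n")
    case True
    \<comment> \<open>This is the half twist without its leading \<open>sig 1\<close>. Cancelling
      \<open>sig 1\<close> in the flip of the top generator shows that
      \<open>?z \<cdot> sig (Suc n)\<close> is the half twist again.\<close>
    let ?z = "shift (cycle_braid n) \<cdot> garside n"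
    have z: "?z \<in> finite_braids (Suc n)"
      using shift_finite_braids[OF cycle_braid_finite] garside_finite[of n]
        finite_braids_mono[of n "Suc n"] by (intro finite_braids_closed) auto
    have g: "garside (Suc n) = sig 1 \<cdot> ?z"
      by (simp add: shift_cycle_braid PB.m_assoc del: cycle_braid.simps)
    have "sig 1 \<cdot> (?z \<cdot> sig (Suc n)) = sig 1 \<cdot> (sig 1 \<cdot> ?z)"
      using garside_sig[of "Suc n" "Suc n"] unfolding g by (simp add: PB.m_assoc)
    then have "?z \<cdot> sig (Suc n) = sig 1 \<cdot> ?z" by simp
    then show ?thesis using z g True by auto
  next
    case False
    then obtain y where y: "y \<in> finite_braids n" "garside n = y \<cdot> sig i" using Suc by auto
    then have "garside (Suc n) = cycle_braid (Suc n) \<cdot> y \<cdot> sig i"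
      using Suc.prems finite_braids_carrier[of y n] by (simp add: PB.m_assoc del: cycle_braid.simps)
    moreover have "cycle_braid (Suc n) \<cdot> y \<in> finite_braids (Suc n)"
      using cycle_braid_finite y finite_braids_mono[of n "Suc n"]
      by (intro finite_braids_closed) (auto simp del: cycle_braid.simps)
    ultimately show ?thesis by blast
  qed
qed simp

lemma garside_conjugate:
  assumes "y \<in> finite_braids n" shows "\<exists>y'\<in>finite_braids n. garside n \<cdot> y = y' \<cdot> garside n"
  using assms
proof (induction rule: finite_braids_induct)
  case one
  show ?case by (intro bexI[of _ \<e>]) (simp_all add: finite_braids_closed)
next
  case (mult y i)
  then obtain y' where y': "y' \<in> finite_braids n" "garside n \<cdot> y = y' \<cdot> garside n" by blast
  have c: "y \<in> carrier PB" "y' \<in> carrier PB" using mult y' finite_braids_carrier by auto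
  have "garside n \<cdot> (y \<cdot> sig i) = y' \<cdot> (garside n \<cdot> sig i)"
    using y' c mult.hyps by (simp flip: PB.m_assoc)
  also have "\<dots> = y' \<cdot> sig (Suc n - i) \<cdot> garside n"
    using garside_sig[of i n] mult.hyps c by (simp add: PB.m_assoc)
  finally show ?case
    using y' mult.hyps by (intro bexI[of _ "y' \<cdot> sig (Suc n - i)"]) (simp_all add: finite_braids_closed)
qed

fun garside_power :: "nat \<Rightarrow> nat \<Rightarrow> gen word set" where
  "garside_power n 0 = \<e>"
| "garside_power n (Suc l) = garside n \<cdot> garside_power n l"

lemma garside_power_finite: "garside_power n l \<in> finite_braids n"
  by (induction l) (auto simp: garside_finite finite_braids_closed)

lemma garside_power_carrier [simp]: "garside_power n l \<in> carrier PB"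
  using garside_power_finite finite_braids_carrier by blast

lemma garside_power_add: "garside_power n (l + m) = garside_power n l \<cdot> garside_power n m"
  by (induction l) (simp_all add: PB.m_assoc)

lemma garside_power_conjugate:
  assumes "y \<in> finite_braids n"
  shows "\<exists>y'\<in>finite_braids n. garside_power n l \<cdot> y = y' \<cdot> garside_power n l"
proof (induction l)
  case 0
  show ?case using assms by (intro bexI[of _ y]) (auto dest: finite_braids_carrier)
next
  case (Suc l)
  then obtain y' where y': "y' \<in> finite_braids n" "garside_power n l \<cdot> y = y' \<cdot> garside_power n l"
    by blast
  obtain z where z: "z \<in> finite_braids n" "garside n \<cdot> y' = z \<cdot> garside n"
    using garside_conjugate[OF y'(1)] by blast
  have c: "y \<in> carrier PB" "y' \<in> carrier PB" "z \<in> carrier PB"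
    using assms y' z finite_braids_carrier by auto
  have "garside_power n (Suc l) \<cdot> y = garside n \<cdot> y' \<cdot> garside_power n l"
    using y' c by (simp add: PB.m_assoc)
  also have "\<dots> = z \<cdot> garside_power n (Suc l)" unfolding z(2) using c by (simp add: PB.m_assoc)
  finally show ?case using z by blast
qed

text \<open>Each further letter costs one more half twist: its complement \<open>y\<close> in the
  half twist is moved to the left through the power already obtained. Any two braids then meet in a
  power of the half twist.\<close>

lemma finite_braids_divide_garside_power:
  "p \<in> finite_braids n \<Longrightarrow> \<exists>l. \<exists>u\<in>finite_braids n. u \<cdot> p = garside_power n l"
proof (induction rule: finite_braids_induct)
  case one
  show ?case by (intro exI[of _ 0] bexI[of _ \<e>]) (simp_all add: finite_braids_closed)
next
  case (mult p i)
  then obtain l u where u: "u \<in> finite_braids n" "u \<cdot> p = garside_power n l" by blast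
  obtain y where y: "y \<in> finite_braids n" "garside n = y \<cdot> sig i"
    using garside_divisible mult.hyps by blast
  obtain z where z: "z \<in> finite_braids n" "garside_power n l \<cdot> y = z \<cdot> garside_power n l"
    using garside_power_conjugate[OF y(1)] by blast
  have c: "p \<in> carrier PB" "u \<in> carrier PB" "y \<in> carrier PB" "z \<in> carrier PB"
    using mult.hyps u y z finite_braids_carrier by auto
  have "garside_power n (l + 1) = garside_power n l \<cdot> y \<cdot> sig i"
    unfolding garside_power_add using y c mult.hyps by (simp add: PB.m_assoc)
  also have "\<dots> = z \<cdot> u \<cdot> (p \<cdot> sig i)"
    unfolding z(2) unfolding u(2)[symmetric] using c mult.hyps by (simp add: PB.m_assoc)
  finally show ?case using u z finite_braids_closed by metis
qed

lemma left_ore_B_inf_pos: "left_ore B_inf_pos"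
  unfolding left_ore_def
proof (intro ballI)
  fix p q assume pq: "p \<in> B_inf_pos" "q \<in> B_inf_pos"
  obtain m m' where "p \<in> finite_braids m" "q \<in> finite_braids m'"
    using B_inf_pos_finite_braids[OF pq(1)] B_inf_pos_finite_braids[OF pq(2)] by auto
  then obtain n where n: "p \<in> finite_braids n" "q \<in> finite_braids n"
    using finite_braids_mono[of m "max m m'"] finite_braids_mono[of m' "max m m'"] by auto
  obtain l u where u: "u \<in> finite_braids n" "u \<cdot> p = garside_power n l"
    using finite_braids_divide_garside_power[OF n(1)] by blast
  obtain k v where v: "v \<in> finite_braids n" "v \<cdot> q = garside_power n k"
    using finite_braids_divide_garside_power[OF n(2)] by blast
  have "garside_power n k \<cdot> u \<cdot> p = garside_power n (k + l)"
    using u n finite_braids_carrier garside_power_add by (simp add: PB.m_assoc)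
  also have "\<dots> = garside_power n l \<cdot> v \<cdot> q"
    using v n finite_braids_carrier garside_power_add[of n l k] by (simp add: PB.m_assoc add.commute)
  finally show "\<exists>u\<in>B_inf_pos. \<exists>v\<in>B_inf_pos. u \<cdot> p = v \<cdot> q"
    using u v garside_power_finite finite_braids_closed(2) finite_braids_pos by blast
qed

section \<open>Common left multiples in Thompson's monoid\<close>

lemma thm_gen_left_multiple:
  assumes "1 \<le> i" "1 \<le> j"
  shows "\<exists>p\<in>insert \<e> (thm_gen ` {1..}). \<exists>q\<in>F_pos. p \<cdot> thm_gen i = q \<cdot> thm_gen j"
proof -
  consider "i = j" | "i < j" | "j < i" by linarith
  then show ?thesis
  proof cases
    case 1
    then show ?thesis using assms by (intro bexI[of _ \<e>]) auto
  next
    case 2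
    then show ?thesis using thm_thm[OF assms(1) 2] assms
      by (intro bexI[of _ "thm_gen (Suc j)"] bexI[of _ "thm_gen i"]) auto
  next
    case 3
    then show ?thesis using thm_thm[OF assms(2) 3] assms
      by (intro bexI[of _ "thm_gen j"] bexI[of _ "thm_gen (Suc i)"]) auto
  qed
qed

lemma F_pos_thm_gen_left_multiple:
  "f \<in> F_pos \<Longrightarrow> 1 \<le> j \<Longrightarrow> \<exists>s\<in>F_pos. \<exists>u\<in>F_pos. s \<cdot> f = u \<cdot> thm_gen j"
proof -
  assume f: "f \<in> F_pos" and j: "1 \<le> j"
  \<comment> \<open>A single letter has a common left multiple with another one in which its
    multiplier is the unit or again a single letter. The residue \<open>p\<close> therefore never
    grows into a longer word, and the induction on \<open>f\<close> closes.\<close>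
  have *: "\<exists>s\<in>insert \<e> (thm_gen ` {1..}). \<exists>u\<in>F_pos. s \<cdot> f = u \<cdot> p"
    if "f \<in> F_pos" "p \<in> insert \<e> (thm_gen ` {1..})" for p
    using that
  proof (induction arbitrary: p rule: F_pos_induct)
    case one
    then show ?case by (intro bexI[of _ p] bexI[of _ \<e>]) auto
  next
    case (mult f i)
    show ?case
    proof (cases "p = \<e>")
      case True
      then show ?thesis using mult.hyps by (intro bexI[of _ \<e>] bexI[of _ "f \<cdot> thm_gen i"]) auto
    next
      case False
      then obtain j where j: "1 \<le> j" "p = thm_gen j" using mult.prems by auto
      obtain a b where ab: "a \<in> insert \<e> (thm_gen ` {1..})" "b \<in> F_pos"
        "a \<cdot> thm_gen i = b \<cdot> thm_gen j"
        using thm_gen_left_multiple[OF mult.hyps(2) j(1)] by blast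
      obtain s u where su: "s \<in> insert \<e> (thm_gen ` {1..})" "u \<in> F_pos" "s \<cdot> f = u \<cdot> a"
        using mult.IH[OF ab(1)] by blast
      have c: "s \<in> carrier PB" "a \<in> carrier PB" using su(1) ab(1) by auto
      have "s \<cdot> (f \<cdot> thm_gen i) = s \<cdot> f \<cdot> thm_gen i" using c mult.hyps by (simp add: PB.m_assoc)
      also have "\<dots> = u \<cdot> (a \<cdot> thm_gen i)"
        unfolding su(3) using c su(2) mult.hyps by (simp add: PB.m_assoc)
      also have "\<dots> = u \<cdot> b \<cdot> p" unfolding ab(3) j(2) using su(2) ab(2) j(1) by (simp add: PB.m_assoc)
      finally show ?thesis using su ab by blast
    qed
  qed
  obtain s u where "s \<in> insert \<e> (thm_gen ` {1..})" "u \<in> F_pos" "s \<cdot> f = u \<cdot> thm_gen j"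
    using *[OF f, of "thm_gen j"] j by auto
  moreover from this(1) have "s \<in> F_pos" by auto
  ultimately show ?thesis by blast
qed

lemma left_ore_F_pos: "left_ore F_pos"
proof -
  have "\<exists>u\<in>F_pos. \<exists>v\<in>F_pos. u \<cdot> p = v \<cdot> q" if "q \<in> F_pos" "p \<in> F_pos" for p q
    using that
  proof (induction arbitrary: p rule: F_pos_induct)
    case one
    then show ?case by (intro bexI[of _ \<e>] bexI[of _ p]) auto
  next
    case (mult q j)
    obtain s r where sr: "s \<in> F_pos" "r \<in> F_pos" "s \<cdot> p = r \<cdot> thm_gen j"
      using F_pos_thm_gen_left_multiple[OF mult.prems mult.hyps(2)] by blast
    obtain u v where uv: "u \<in> F_pos" "v \<in> F_pos" "u \<cdot> r = v \<cdot> q" using mult.IH[OF sr(2)] by blast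
    have "u \<cdot> s \<cdot> p = u \<cdot> r \<cdot> thm_gen j"
      using sr uv(1) mult.hyps mult.prems by (simp add: PB.m_assoc)
    also have "\<dots> = v \<cdot> (q \<cdot> thm_gen j)" unfolding uv(3) using uv mult.hyps by (simp add: PB.m_assoc)
    finally show ?case using sr uv by blast
  qed
  then show ?thesis unfolding left_ore_def by blast
qed

section \<open>Exchange of braids and Thompson elements\<close>

lemma sig_thm_gen_right:
  assumes "1 \<le> k" "1 \<le> i" shows "\<exists>b\<in>B_inf_pos. \<exists>j\<ge>1. thm_gen k \<cdot> sig i = b \<cdot> thm_gen j"
proof -
  consider "k < i" | "k = i" | "k = Suc i" | "i + 2 \<le> k" by linarith
  then show ?thesis
  proof cases
    case 1
    then show ?thesis using thm_sig[OF assms(1) 1] assms sig_pos(1)[of "Suc i"] by auto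
  next
    case 2
    then show ?thesis using thm_sig_same[OF assms(2)] assms
      by (intro bexI[of _ "sig (Suc i) \<cdot> sig i"] exI[of _ "Suc i"]) auto
  next
    case 3
    then show ?thesis using thm_sig_Suc[OF assms(2)] assms
      by (intro bexI[of _ "sig i \<cdot> sig (Suc i)"] exI[of _ i]) auto
  next
    case 4
    then show ?thesis using sig_thm[OF assms(2) 4] assms
      by (intro bexI[of _ "sig i"] exI[of _ k]) auto
  qed
qed

text \<open>Opposite to \<open>sig_thm_gen_right\<close>: the outgoing position \<open>j\<close> is
  prescribed and the incoming one is found, which is possible because a crossing permutes
  positions.\<close>

lemma sig_thm_gen_left:
  assumes "1 \<le> j" "1 \<le> i" shows "\<exists>k\<ge>1. \<exists>b\<in>B_inf_pos. thm_gen k \<cdot> sig i = b \<cdot> thm_gen j"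
proof -
  consider "j < i" | "j = i" | "j = Suc i" | "i + 2 \<le> j" by linarith
  then show ?thesis
  proof cases
    case 1
    then show ?thesis using thm_sig[OF assms(1) 1] assms
      by (intro exI[of _ j] conjI bexI[of _ "sig (Suc i)"]) auto
  next
    case 2
    then show ?thesis using thm_sig_Suc[OF assms(2)] assms
      by (intro exI[of _ "Suc i"] conjI bexI[of _ "sig i \<cdot> sig (Suc i)"]) auto
  next
    case 3
    then show ?thesis using thm_sig_same[OF assms(2)] assms
      by (intro exI[of _ i] conjI bexI[of _ "sig (Suc i) \<cdot> sig i"]) auto
  next
    case 4
    then show ?thesis using sig_thm[OF assms(2) 4] assms
      by (intro exI[of _ j] conjI bexI[of _ "sig i"]) auto
  qed
qed

lemma braid_thm_gen_right:
  "\<beta> \<in> B_inf_pos \<Longrightarrow> 1 \<le> k \<Longrightarrow> \<exists>b\<in>B_inf_pos. \<exists>j\<ge>1. thm_gen k \<cdot> \<beta> = b \<cdot> thm_gen j"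
proof (induction rule: B_inf_pos_induct)
  case one
  then show ?case by (intro bexI[of _ \<e>] exI[of _ k]) auto
next
  case (mult \<beta> i)
  then obtain b j where b: "b \<in> B_inf_pos" "1 \<le> j" "thm_gen k \<cdot> \<beta> = b \<cdot> thm_gen j" by blast
  obtain c l where c: "c \<in> B_inf_pos" "1 \<le> l" "thm_gen j \<cdot> sig i = c \<cdot> thm_gen l"
    using sig_thm_gen_right[OF b(2) mult.hyps(2)] by blast
  have "thm_gen k \<cdot> (\<beta> \<cdot> sig i) = b \<cdot> thm_gen j \<cdot> sig i"
    unfolding b(3)[symmetric] using mult.hyps mult.prems by (simp add: PB.m_assoc)
  also have "\<dots> = b \<cdot> c \<cdot> thm_gen l"
    using b c mult.hyps by (simp add: PB.m_assoc)
  finally show ?case using b c by blast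
qed

lemma braid_thm_gen_left:
  "\<beta> \<in> B_inf_pos \<Longrightarrow> 1 \<le> j \<Longrightarrow> \<exists>k\<ge>1. \<exists>b\<in>B_inf_pos. thm_gen k \<cdot> \<beta> = b \<cdot> thm_gen j"
proof (induction arbitrary: j rule: B_inf_pos_induct)
  case one
  then show ?case by (intro exI[of _ j] conjI bexI[of _ \<e>]) auto
next
  case (mult \<beta> i)
  obtain l c where c: "c \<in> B_inf_pos" "1 \<le> l" "thm_gen l \<cdot> sig i = c \<cdot> thm_gen j"
    using sig_thm_gen_left[OF mult.prems mult.hyps(2)] by blast
  obtain k b where b: "b \<in> B_inf_pos" "1 \<le> k" "thm_gen k \<cdot> \<beta> = b \<cdot> thm_gen l"
    using mult.IH[OF c(2)] by blast
  have "thm_gen k \<cdot> (\<beta> \<cdot> sig i) = b \<cdot> thm_gen l \<cdot> sig i"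
    unfolding b(3)[symmetric] using mult.hyps b(1,2) c(2) by (simp add: PB.m_assoc)
  also have "\<dots> = b \<cdot> c \<cdot> thm_gen j"
    using b c mult.hyps mult.prems by (simp add: PB.m_assoc)
  finally show ?case using b c by blast
qed

lemma F_pos_braid_right:
  "f \<in> F_pos \<Longrightarrow> \<beta> \<in> B_inf_pos \<Longrightarrow> \<exists>b\<in>B_inf_pos. \<exists>g\<in>F_pos. f \<cdot> \<beta> = b \<cdot> g"
proof (induction arbitrary: \<beta> rule: F_pos_induct)
  case one
  then show ?case by (intro bexI[of _ \<beta>] bexI[of _ \<e>]) auto
next
  case (mult f i)
  obtain b j where b: "b \<in> B_inf_pos" "1 \<le> j" "thm_gen i \<cdot> \<beta> = b \<cdot> thm_gen j"
    using braid_thm_gen_right[OF mult.prems mult.hyps(2)] by blast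
  obtain c g where c: "c \<in> B_inf_pos" "g \<in> F_pos" "f \<cdot> b = c \<cdot> g" using mult.IH[OF b(1)] by blast
  have "f \<cdot> thm_gen i \<cdot> \<beta> = f \<cdot> b \<cdot> thm_gen j"
    using mult.hyps mult.prems b by (simp add: PB.m_assoc)
  also have "\<dots> = c \<cdot> (g \<cdot> thm_gen j)"
    unfolding c(3) using b(2) c(1,2) by (simp add: PB.m_assoc)
  finally show ?case using c(1,2) b(2) Fp.m_closed thm_gen_pos(1) by blast
qed

lemma F_pos_braid_left:
  "f \<in> F_pos \<Longrightarrow> \<beta> \<in> B_inf_pos \<Longrightarrow> \<exists>g\<in>F_pos. \<exists>b\<in>B_inf_pos. g \<cdot> \<beta> = b \<cdot> f"
proof (induction arbitrary: \<beta> rule: F_pos_induct)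
  case one
  then show ?case by (intro bexI[of _ \<beta>] bexI[of _ \<e>]) auto
next
  case (mult f j)
  obtain k b where b: "b \<in> B_inf_pos" "1 \<le> k" "thm_gen k \<cdot> \<beta> = b \<cdot> thm_gen j"
    using braid_thm_gen_left[OF mult.prems mult.hyps(2)] by blast
  obtain g c where c: "g \<in> F_pos" "c \<in> B_inf_pos" "g \<cdot> b = c \<cdot> f" using mult.IH[OF b(1)] by blast
  have "g \<cdot> thm_gen k \<cdot> \<beta> = g \<cdot> b \<cdot> thm_gen j"
    using mult.prems mult.hyps b c(1) by (simp add: PB.m_assoc)
  also have "\<dots> = c \<cdot> (f \<cdot> thm_gen j)"
    unfolding c(3) using c mult.hyps by (simp add: PB.m_assoc)
  finally show ?case using b c thm_gen_pos(1) Fp.m_closed by blast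
qed

lemma PB_pos_decompose: "x \<in> PB_pos \<Longrightarrow> \<exists>\<beta>\<in>B_inf_pos. \<exists>f\<in>F_pos. x = \<beta> \<cdot> f"
proof (induction rule: PB_pos_induct)
  case one
  show ?case by (intro bexI[of _ \<e>]) auto
next
  case (sig x i)
  then obtain \<beta> f where x: "\<beta> \<in> B_inf_pos" "f \<in> F_pos" "x = \<beta> \<cdot> f" by blast
  obtain b g where b: "b \<in> B_inf_pos" "g \<in> F_pos" "f \<cdot> sig i = b \<cdot> g"
    using F_pos_braid_right[OF x(2), of "sig i"] sig.hyps by auto
  have "x \<cdot> sig i = \<beta> \<cdot> b \<cdot> g" using x b sig.hyps by (simp add: PB.m_assoc)
  then show ?case using x b by blast
next
  case (thm_gen x i)
  then obtain \<beta> f where x: "\<beta> \<in> B_inf_pos" "f \<in> F_pos" "x = \<beta> \<cdot> f" by blast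
  then have "x \<cdot> thm_gen i = \<beta> \<cdot> (f \<cdot> thm_gen i)" using thm_gen.hyps by (simp add: PB.m_assoc)
  then show ?case using x thm_gen.hyps thm_gen_pos(1) Fp.m_closed by blast
qed

text \<open>The parts in \<open>F_pos\<close> are equalised first, by \<open>f'\<close> and
  \<open>g'\<close>; these multipliers are pulled to the left through the two braids, and a common
  left multiple of the resulting braids \<open>b\<close> and \<open>c\<close> completes the
  construction.\<close>

lemma left_ore_PB_pos: "left_ore PB_pos"
  unfolding left_ore_def
proof (intro ballI)
  fix p q assume pq: "p \<in> PB_pos" "q \<in> PB_pos"
  obtain \<beta> f where p: "\<beta> \<in> B_inf_pos" "f \<in> F_pos" "p = \<beta> \<cdot> f"
    using PB_pos_decompose[OF pq(1)] by blast
  obtain \<gamma> g where q: "\<gamma> \<in> B_inf_pos" "g \<in> F_pos" "q = \<gamma> \<cdot> g"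
    using PB_pos_decompose[OF pq(2)] by blast
  obtain f' g' where f': "f' \<in> F_pos" "g' \<in> F_pos" "f' \<cdot> f = g' \<cdot> g"
    using left_oreE[OF left_ore_F_pos p(2) q(2)] .
  obtain r b where b: "r \<in> F_pos" "b \<in> B_inf_pos" "r \<cdot> \<beta> = b \<cdot> f'"
    using F_pos_braid_left[OF f'(1) p(1)] by blast
  obtain s c where c: "s \<in> F_pos" "c \<in> B_inf_pos" "s \<cdot> \<gamma> = c \<cdot> g'"
    using F_pos_braid_left[OF f'(2) q(1)] by blast
  obtain u v where uv: "u \<in> B_inf_pos" "v \<in> B_inf_pos" "u \<cdot> b = v \<cdot> c"
    using left_oreE[OF left_ore_B_inf_pos b(2) c(2)] .
  have "u \<cdot> r \<cdot> p = u \<cdot> (r \<cdot> \<beta>) \<cdot> f" unfolding p(3) using p(1,2) b(1) uv(1) by (simp add: PB.m_assoc)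
  also have "\<dots> = u \<cdot> b \<cdot> (f' \<cdot> f)" unfolding b(3) using p(1,2) b(1,2) uv(1) f'(1,2) by (simp add: PB.m_assoc)
  also have "\<dots> = v \<cdot> (c \<cdot> g') \<cdot> g" unfolding uv(3) f'(3) using q(1,2) c(1,2) uv(1,2) f'(1,2) by (simp add: PB.m_assoc)
  also have "\<dots> = v \<cdot> s \<cdot> q" unfolding c(3)[symmetric] q(3) using q(1,2) c(1) uv(2) by (simp add: PB.m_assoc)
  finally have "u \<cdot> r \<cdot> p = v \<cdot> s \<cdot> q" .
  moreover have "u \<cdot> r \<in> PB_pos" "v \<cdot> s \<in> PB_pos"
    using uv b c B_inf_pos_PB_pos F_pos_PB_pos by auto
  ultimately show "\<exists>u\<in>PB_pos. \<exists>v\<in>PB_pos. u \<cdot> p = v \<cdot> q" by blast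
qed

lemma B_inf_fraction: "x \<in> B_inf \<Longrightarrow> \<exists>p\<in>B_inf_pos. \<exists>q\<in>B_inf_pos. x = \<i> p \<cdot> q"
  unfolding B_inf_def
  by (rule generate_fraction[OF generators_carrier(1) _ Bp.submonoid_axioms left_ore_B_inf_pos]) auto

lemma F_fraction: "x \<in> F \<Longrightarrow> \<exists>p\<in>F_pos. \<exists>q\<in>F_pos. x = \<i> p \<cdot> q"
  unfolding F_def
  by (rule generate_fraction[OF generators_carrier(2) _ Fp.submonoid_axioms left_ore_F_pos]) auto

lemma PB_generated: "carrier PB \<subseteq> generate PB (sig ` {1..} \<union> thm_gen ` {1..})"
proof -
  let ?S = "sig ` {1..} \<union> thm_gen ` {1..}"
  have "PB_class w \<in> generate PB ?S" if "w \<in> words gens" for w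
    using that
  proof (induction w)
    case Nil
    show ?case by (simp add: PB_class_Nil generate.one)
  next
    case (Cons x w)
    obtain g b where x: "x = (g, b)" by fastforce
    have g: "g \<in> gens" "w \<in> words gens" using Cons.prems x by auto
    have "PB_class [(g, True)] \<in> ?S" using g by (cases g) (auto simp: sig_def thm_gen_def)
    then have "PB_class [(g, b)] \<in> generate PB ?S"
      using g(1) by (cases b) (auto simp: PB_class_neg intro: generate.incl generate.inv)
    then show ?case unfolding x PB_class_Cons[OF g] using Cons.IH[OF g(2)] by (rule generate.eng)
  qed
  then show ?thesis by (auto simp: carrier_PB)
qed

lemma PB_fraction: "x \<in> carrier PB \<Longrightarrow> \<exists>p\<in>PB_pos. \<exists>q\<in>PB_pos. x = \<i> p \<cdot> q"
  using PB_generated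
  by (intro generate_fraction[OF generators_carrier(3) _ PBp.submonoid_axioms left_ore_PB_pos]) auto

section \<open>Cabling\<close>

lemma thm_gen_sig_inv:
  assumes "1 \<le> k" "1 \<le> l" "s \<in> carrier PB" "h \<in> carrier PB" "thm_gen l \<cdot> s = h \<cdot> thm_gen k"
  shows "thm_gen k \<cdot> \<i> s = \<i> h \<cdot> thm_gen l"
proof -
  have "thm_gen k \<cdot> \<i> s = \<i> h \<cdot> (h \<cdot> thm_gen k) \<cdot> \<i> s"
    using assms(1-4) by (simp add: PB.m_assoc)
  also have "\<dots> = \<i> h \<cdot> thm_gen l"
    unfolding assms(5)[symmetric] using assms(1-4) by (simp add: PB.m_assoc)
  finally show ?thesis .
qed

text \<open>The doubled strand lies to the left of all crossings, so the additional strand merely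
  raises their indices by one.\<close>

lemma thm_gen_tail_braid_less:
  assumes "1 \<le> m" "m < i" "h \<in> tail_braids i"
  shows "\<exists>h'\<in>tail_braids (Suc i). thm_gen m \<cdot> h = h' \<cdot> thm_gen m"
proof -
  have i: "1 \<le> i" using assms by simp
  from i assms(3) show ?thesis
  proof (induction rule: tail_braids_induct)
    case one
    show ?case using assms by (intro bexI[of _ \<e>]) (auto simp: tail_braids_closed)
  next
    case (mult x j)
    then obtain h' where h': "h' \<in> tail_braids (Suc i)" "thm_gen m \<cdot> x = h' \<cdot> thm_gen m" by blast
    have c: "x \<in> carrier PB" "h' \<in> carrier PB" "1 \<le> j"
      using mult.hyps i h' tail_braids_carrier[of i] tail_braids_carrier[of "Suc i"] by auto
    have "thm_gen m \<cdot> (x \<cdot> sig j) = h' \<cdot> (thm_gen m \<cdot> sig j)"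
      using c assms(1) h'(2) by (simp flip: PB.m_assoc)
    also have "\<dots> = h' \<cdot> sig (Suc j) \<cdot> thm_gen m"
      using c assms mult.hyps(2) thm_sig[of m j] by (simp add: PB.m_assoc)
    finally have "thm_gen m \<cdot> (x \<cdot> sig j) = h' \<cdot> sig (Suc j) \<cdot> thm_gen m" .
    moreover have "h' \<cdot> sig (Suc j) \<in> tail_braids (Suc i)"
      using h'(1) mult.hyps(2) by (simp add: tail_braids_closed sig_tail_braids)
    ultimately show ?case by blast
  next
    case (inv x j)
    then obtain h' where h': "h' \<in> tail_braids (Suc i)" "thm_gen m \<cdot> x = h' \<cdot> thm_gen m" by blast
    have c: "x \<in> carrier PB" "h' \<in> carrier PB" "1 \<le> j"
      using inv.hyps i h' tail_braids_carrier[of i] tail_braids_carrier[of "Suc i"] by auto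
    have "thm_gen m \<cdot> (x \<cdot> \<i> sig j) = h' \<cdot> (thm_gen m \<cdot> \<i> sig j)"
      using c assms(1) h'(2) by (simp flip: PB.m_assoc)
    also have "thm_gen m \<cdot> \<i> sig j = \<i> sig (Suc j) \<cdot> thm_gen m"
      using c assms inv.hyps(2) thm_sig[of m j] by (intro thm_gen_sig_inv) auto
    also have "h' \<cdot> (\<i> sig (Suc j) \<cdot> thm_gen m) = h' \<cdot> \<i> sig (Suc j) \<cdot> thm_gen m"
      using c assms by (simp add: PB.m_assoc)
    finally have "thm_gen m \<cdot> (x \<cdot> \<i> sig j) = h' \<cdot> \<i> sig (Suc j) \<cdot> thm_gen m" .
    moreover have "h' \<cdot> \<i> sig (Suc j) \<in> tail_braids (Suc i)"
      using h'(1) inv.hyps(2) by (simp add: tail_braids_closed sig_tail_braids)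
    ultimately show ?case by blast
  qed
qed

lemma thm_gen_sig_tail:
  assumes "1 \<le> i" "i \<le> m" "i \<le> j"
  shows "\<exists>h\<in>tail_braids i. \<exists>l\<ge>i. thm_gen m \<cdot> sig j = h \<cdot> thm_gen l"
    "\<exists>h\<in>tail_braids i. \<exists>l\<ge>i. thm_gen m \<cdot> \<i> sig j = h \<cdot> thm_gen l"
proof -
  have j: "1 \<le> j" "1 \<le> m" using assms by auto
  have c: "sig j \<in> tail_braids i" "sig (Suc j) \<in> tail_braids i" "sig j \<cdot> sig (Suc j) \<in> tail_braids i"
    "sig (Suc j) \<cdot> sig j \<in> tail_braids i"
    using assms by (simp_all add: tail_braids_closed sig_tail_braids)
  consider "m < j" | "m = j" | "m = Suc j" | "j + 2 \<le> m" by linarith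
  then have "(\<exists>h\<in>tail_braids i. \<exists>l\<ge>i. thm_gen m \<cdot> sig j = h \<cdot> thm_gen l)
    \<and> (\<exists>h\<in>tail_braids i. \<exists>l\<ge>i. thm_gen m \<cdot> \<i> sig j = h \<cdot> thm_gen l)"
  proof cases
    case 1
    have *: "thm_gen m \<cdot> sig j = sig (Suc j) \<cdot> thm_gen m" using thm_sig[OF j(2) 1] .
    then have "thm_gen m \<cdot> \<i> sig j = \<i> sig (Suc j) \<cdot> thm_gen m"
      using j by (intro thm_gen_sig_inv) auto
    then show ?thesis using * c tail_braids_closed(3)[OF assms(1)] assms(2) by blast
  next
    case 2
    have "thm_gen m \<cdot> \<i> sig j = \<i> (sig j \<cdot> sig (Suc j)) \<cdot> thm_gen (Suc j)"
      unfolding 2 using j thm_sig_Suc[OF j(1)] by (intro thm_gen_sig_inv) auto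
    then show ?thesis
      using thm_sig_same[OF j(1)] 2 c tail_braids_closed(3)[OF assms(1)] assms by (metis le_SucI)
  next
    case 3
    have "thm_gen m \<cdot> \<i> sig j = \<i> (sig (Suc j) \<cdot> sig j) \<cdot> thm_gen j"
      unfolding 3 using j thm_sig_same[OF j(1)] by (intro thm_gen_sig_inv) auto
    then show ?thesis
      using thm_sig_Suc[OF j(1)] 3 c tail_braids_closed(3)[OF assms(1)] assms by metis
  next
    case 4
    have *: "thm_gen m \<cdot> sig j = sig j \<cdot> thm_gen m" using sig_thm[OF j(1) 4] by simp
    then have "thm_gen m \<cdot> \<i> sig j = \<i> sig j \<cdot> thm_gen m"
      using j by (intro thm_gen_sig_inv) auto
    then show ?thesis using * c tail_braids_closed(3)[OF assms(1)] assms(2) by blast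
  qed
  then show "\<exists>h\<in>tail_braids i. \<exists>l\<ge>i. thm_gen m \<cdot> sig j = h \<cdot> thm_gen l"
    "\<exists>h\<in>tail_braids i. \<exists>l\<ge>i. thm_gen m \<cdot> \<i> sig j = h \<cdot> thm_gen l" by auto
qed

lemma thm_gen_tail_braid_ge:
  assumes "1 \<le> i" "i \<le> m" "h \<in> tail_braids i"
  shows "\<exists>h'\<in>tail_braids i. \<exists>l\<ge>i. thm_gen m \<cdot> h = h' \<cdot> thm_gen l"
proof -
  have step: "\<exists>h'\<in>tail_braids i. \<exists>l\<ge>i. thm_gen m \<cdot> (x \<cdot> s) = h' \<cdot> thm_gen l"
    if x: "x \<in> tail_braids i" "h' \<in> tail_braids i" "i \<le> l" "thm_gen m \<cdot> x = h' \<cdot> thm_gen l"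
      and s: "s \<in> carrier PB" "\<exists>k\<in>tail_braids i. \<exists>l'\<ge>i. thm_gen l \<cdot> s = k \<cdot> thm_gen l'" for x h' l s
  proof -
    obtain k l' where k: "k \<in> tail_braids i" "i \<le> l'" "thm_gen l \<cdot> s = k \<cdot> thm_gen l'"
      using s(2) by blast
    have c: "x \<in> carrier PB" "h' \<in> carrier PB" "k \<in> carrier PB"
      using x k assms(1) tail_braids_carrier by auto
    have "thm_gen m \<cdot> (x \<cdot> s) = thm_gen m \<cdot> x \<cdot> s"
      using c s(1) assms(1,2) by (simp add: PB.m_assoc)
    also have "\<dots> = h' \<cdot> (thm_gen l \<cdot> s)"
      unfolding x(4) using c s(1) assms(1) x(3) by (simp add: PB.m_assoc)
    also have "\<dots> = h' \<cdot> k \<cdot> thm_gen l'"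
      unfolding k(3) using c assms(1) k(2) by (simp add: PB.m_assoc)
    finally show ?thesis using x(2) k(1,2) tail_braids_closed(2)[OF assms(1)] by blast
  qed
  from assms(1,3) show ?thesis
  proof (induction rule: tail_braids_induct)
    case one
    show ?case using assms(1,2)
      by (intro bexI[of _ \<e>] exI[of _ m]) (auto simp: tail_braids_closed)
  next
    case (mult x j)
    then obtain h' l where h: "h' \<in> tail_braids i" "i \<le> l" "thm_gen m \<cdot> x = h' \<cdot> thm_gen l"
      by blast
    show ?case
      using step[OF mult.hyps(1) h _ thm_gen_sig_tail(1)[OF assms(1) h(2) mult.hyps(2)]]
        mult.hyps(2) assms(1) by simp
  next
    case (inv x j)
    then obtain h' l where h: "h' \<in> tail_braids i" "i \<le> l" "thm_gen m \<cdot> x = h' \<cdot> thm_gen l"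
      by blast
    show ?case
      using step[OF inv.hyps(1) h _ thm_gen_sig_tail(2)[OF assms(1) h(2) inv.hyps(2)]]
        inv.hyps(2) assms(1) by simp
  qed
qed

text \<open>Cabling a strand at position \<open>i\<close> or beyond creates no \<open>sig i\<close>
  in a braid free of it, even though the position \<open>i\<close> itself is allowed: at
  \<open>m = i\<close> the crossings are just shifted.\<close>

lemma thm_gen_tail_braid_Suc:
  assumes "1 \<le> i" "i \<le> m" "h \<in> tail_braids (Suc i)"
  shows "\<exists>h'\<in>tail_braids (Suc i). \<exists>l\<ge>i. thm_gen m \<cdot> h = h' \<cdot> thm_gen l"
proof (cases "m = i")
  case True
  then obtain h' where "h' \<in> tail_braids (Suc (Suc i))" "thm_gen m \<cdot> h = h' \<cdot> thm_gen m"
    using thm_gen_tail_braid_less[of m "Suc i" h] assms by auto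
  then show ?thesis using tail_braids_antimono[of "Suc i" "Suc (Suc i)"] assms(2) by auto
next
  case False
  then obtain h' l where "h' \<in> tail_braids (Suc i)" "l \<ge> Suc i" "thm_gen m \<cdot> h = h' \<cdot> thm_gen l"
    using thm_gen_tail_braid_ge[of "Suc i" m h] assms by auto
  then show ?thesis by (meson Suc_leD)
qed

lemma thm_gen_sig_same_tail:
  assumes "1 \<le> i" "i \<le> m"
  shows "\<exists>y\<in>sigma_pos i. \<exists>l\<ge>i. thm_gen m \<cdot> sig i = y \<cdot> thm_gen l"
proof -
  have t: "sig (Suc i) \<in> tail_braids (Suc i)" by (simp add: sig_tail_braids)
  note s = sig_sigma_pos[OF assms(1)]
  consider "m = i" | "m = Suc i" | "i + 2 \<le> m" using assms(2) by linarith
  then show ?thesis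
  proof cases
    case 1
    have "sig (Suc i) \<cdot> sig i \<in> sigma_pos i" by (rule sigma_pos_mult_tail(1)[OF assms(1) s t])
    then show ?thesis
      by (intro bexI[of _ "sig (Suc i) \<cdot> sig i"] exI[of _ "Suc i"])
        (simp_all add: thm_sig_same[OF assms(1)] 1)
  next
    case 2
    have "sig i \<cdot> sig (Suc i) \<in> sigma_pos i" by (rule sigma_pos_mult_tail(2)[OF assms(1) s t])
    then show ?thesis using thm_sig_Suc[OF assms(1)] 2 by blast
  next
    case 3
    then show ?thesis using sig_thm[OF assms(1) 3] s assms by metis
  qed
qed

lemma thm_gen_sigma_pos_less:
  assumes "1 \<le> m" "m < i" "x \<in> sigma_pos i"
  shows "\<exists>y\<in>sigma_pos (Suc i). thm_gen m \<cdot> x = y \<cdot> thm_gen m"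
  using assms(3)
proof induction
  case (base h h')
  obtain k where k: "k \<in> tail_braids (Suc (Suc i))" "thm_gen m \<cdot> h = k \<cdot> thm_gen m"
    using thm_gen_tail_braid_less[of m "Suc i" h] assms base by auto
  obtain k' where k': "k' \<in> tail_braids (Suc (Suc i))" "thm_gen m \<cdot> h' = k' \<cdot> thm_gen m"
    using thm_gen_tail_braid_less[of m "Suc i" h'] assms base by auto
  have c: "h \<in> carrier PB" "h' \<in> carrier PB" "k \<in> carrier PB" "k' \<in> carrier PB" "1 \<le> i"
    using base k(1) k'(1) assms(1,2) tail_braids_carrier[of "Suc i"] tail_braids_carrier[of "Suc (Suc i)"]
    by auto
  have "thm_gen m \<cdot> (h \<cdot> sig i \<cdot> h') = thm_gen m \<cdot> h \<cdot> sig i \<cdot> h'"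
    using c assms(1) by (simp add: PB.m_assoc)
  also have "\<dots> = k \<cdot> (thm_gen m \<cdot> sig i) \<cdot> h'"
    unfolding k(2) using c assms(1) by (simp add: PB.m_assoc)
  also have "\<dots> = k \<cdot> sig (Suc i) \<cdot> (thm_gen m \<cdot> h')"
    unfolding thm_sig[OF assms(1,2)] using c assms(1) by (simp add: PB.m_assoc)
  also have "\<dots> = k \<cdot> sig (Suc i) \<cdot> k' \<cdot> thm_gen m"
    unfolding k'(2) using c assms(1) by (simp add: PB.m_assoc)
  finally show ?case using sigma_pos.base[OF k(1) k'(1)] by blast
next
  case (mult x x')
  then obtain y y' where y: "y \<in> sigma_pos (Suc i)" "thm_gen m \<cdot> x = y \<cdot> thm_gen m"
    "y' \<in> sigma_pos (Suc i)" "thm_gen m \<cdot> x' = y' \<cdot> thm_gen m" by blast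
  have c: "x \<in> carrier PB" "x' \<in> carrier PB" "y \<in> carrier PB" "y' \<in> carrier PB"
    using mult.hyps y(1,3) assms(1,2) sigma_pos_carrier[of i] sigma_pos_carrier[of "Suc i"] by auto
  have "thm_gen m \<cdot> (x \<cdot> x') = thm_gen m \<cdot> x \<cdot> x'"
    using c assms(1) by (simp add: PB.m_assoc)
  also have "\<dots> = y \<cdot> (thm_gen m \<cdot> x')" unfolding y(2) using c assms(1) by (simp add: PB.m_assoc)
  also have "\<dots> = y \<cdot> y' \<cdot> thm_gen m" unfolding y(4) using c assms(1) by (simp add: PB.m_assoc)
  finally show ?case using sigma_pos.mult[OF y(1,3)] by blast
qed

lemma thm_gen_sigma_pos_ge:
  assumes "1 \<le> i" "i \<le> m" "x \<in> sigma_pos i"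
  shows "\<exists>y\<in>sigma_pos i. \<exists>l\<ge>i. thm_gen m \<cdot> x = y \<cdot> thm_gen l"
  using assms(3,2)
proof (induction arbitrary: m)
  case (base h h')
  obtain k l where k: "k \<in> tail_braids (Suc i)" "i \<le> l" "thm_gen m \<cdot> h = k \<cdot> thm_gen l"
    using thm_gen_tail_braid_Suc[OF assms(1) base.prems base.hyps(1)] by blast
  obtain y n where y: "y \<in> sigma_pos i" "i \<le> n" "thm_gen l \<cdot> sig i = y \<cdot> thm_gen n"
    using thm_gen_sig_same_tail[OF assms(1) k(2)] by blast
  obtain k' r where k': "k' \<in> tail_braids (Suc i)" "i \<le> r" "thm_gen n \<cdot> h' = k' \<cdot> thm_gen r"
    using thm_gen_tail_braid_Suc[OF assms(1) y(2) base.hyps(2)] by blast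
  have c: "h \<in> carrier PB" "h' \<in> carrier PB" "k \<in> carrier PB" "k' \<in> carrier PB" "y \<in> carrier PB"
    "1 \<le> m" "1 \<le> l" "1 \<le> n" "1 \<le> r"
    using base k(1,2) k'(1,2) y(1,2) assms(1) tail_braids_carrier[of "Suc i"] sigma_pos_carrier[of i]
    by auto
  have "thm_gen m \<cdot> (h \<cdot> sig i \<cdot> h') = thm_gen m \<cdot> h \<cdot> sig i \<cdot> h'"
    using c assms(1) by (simp add: PB.m_assoc)
  also have "\<dots> = k \<cdot> (thm_gen l \<cdot> sig i) \<cdot> h'"
    unfolding k(3) using c assms(1) by (simp add: PB.m_assoc)
  also have "\<dots> = k \<cdot> y \<cdot> (thm_gen n \<cdot> h')"
    unfolding y(3) using c assms(1) by (simp add: PB.m_assoc)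
  also have "\<dots> = k \<cdot> y \<cdot> k' \<cdot> thm_gen r"
    unfolding k'(3) using c assms(1) by (simp add: PB.m_assoc)
  finally show ?case
    using sigma_pos_mult_tail[OF assms(1)] y(1) k(1) k'(1,2) by blast
next
  case (mult x x')
  obtain y l where y: "y \<in> sigma_pos i" "i \<le> l" "thm_gen m \<cdot> x = y \<cdot> thm_gen l"
    using mult.IH(1)[OF mult.prems] by blast
  obtain y' n where y': "y' \<in> sigma_pos i" "i \<le> n" "thm_gen l \<cdot> x' = y' \<cdot> thm_gen n"
    using mult.IH(2)[OF y(2)] by blast
  have c: "x \<in> carrier PB" "x' \<in> carrier PB" "y \<in> carrier PB" "y' \<in> carrier PB"
    "1 \<le> m" "1 \<le> l" "1 \<le> n"
    using mult.hyps mult.prems y(1,2) y'(1,2) assms(1) sigma_pos_carrier[of i] by auto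
  have "thm_gen m \<cdot> (x \<cdot> x') = thm_gen m \<cdot> x \<cdot> x'" using c by (simp add: PB.m_assoc)
  also have "\<dots> = y \<cdot> (thm_gen l \<cdot> x')" unfolding y(3) using c by (simp add: PB.m_assoc)
  also have "\<dots> = y \<cdot> y' \<cdot> thm_gen n" unfolding y'(3) using c by (simp add: PB.m_assoc)
  finally show ?case using sigma_pos.mult[OF y(1) y'(1)] y'(2) by blast
qed

text \<open>If the doubled strand is left of the main generator, the main index rises to
  \<open>i + 1\<close>. Otherwise it stays \<open>i\<close>: a crossing \<open>sig i\<close> becomes
  a positive braid that still contains \<open>sig i\<close>, and the factors around it gain
  none.\<close>

lemma thm_gen_sigma_pos:
  assumes "1 \<le> m" "1 \<le> i" "x \<in> sigma_pos i"
  shows "\<exists>j\<ge>1. \<exists>y\<in>sigma_pos j. \<exists>l\<ge>1. thm_gen m \<cdot> x = y \<cdot> thm_gen l"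
proof (cases "m < i")
  case True
  then show ?thesis using thm_gen_sigma_pos_less[OF assms(1) True assms(3)] assms(1)
    by (metis One_nat_def Suc_le_mono le0)
next
  case False
  then show ?thesis using thm_gen_sigma_pos_ge[OF assms(2) _ assms(3), of m] assms(2)
    by (meson leI le_trans)
qed

section \<open>The order on the group\<close>

text \<open>Writing \<open>x\<close> as a fraction of positive braids and comparing numerator with
  denominator shows that a non-trivial \<open>x\<close>, or its inverse, is
  \<open>\<sigma>\<close>-positive and hence outside \<open>F\<close>.\<close>

lemma B_inf_F_trivial:
  assumes "x \<in> B_inf" "x \<in> F" shows "x = \<e>"
proof -
  obtain p q where pq: "p \<in> B_inf_pos" "q \<in> B_inf_pos" "x = \<i> p \<cdot> q"
    using B_inf_fraction[OF assms(1)] by blast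
  have x': "\<i> x = \<i> q \<cdot> p" using pq by (simp add: PB.inv_mult_group)
  consider "p = q" | "(p, q) \<in> less_B" | "(q, p) \<in> less_B"
    using B_inf_pos_comparable[OF pq(1,2)] by blast
  then show ?thesis
  proof cases
    case 2
    then have "x \<notin> F" using pq(3) sigma_pos_notin_F unfolding less_B_iff by blast
    then show ?thesis using assms(2) by contradiction
  next
    case 3
    then have "\<i> x \<notin> F" unfolding x' using sigma_pos_notin_F unfolding less_B_iff by blast
    then show ?thesis using assms(2) by auto
  qed (use pq in simp)
qed

lemma decompose_unique:
  assumes "\<beta> \<in> B_inf" "\<beta>' \<in> B_inf" "f \<in> F" "f' \<in> F" "\<beta> \<cdot> f = \<beta>' \<cdot> f'"
  shows "\<beta> = \<beta>'" "f = f'"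
proof -
  have "\<i> \<beta>' \<cdot> \<beta> = \<i> \<beta>' \<cdot> (\<beta> \<cdot> f) \<cdot> \<i> f" using assms(1-4) by (simp add: PB.m_assoc)
  also have "\<dots> = f' \<cdot> \<i> f" unfolding assms(5) using assms(1-4) by (simp add: PB.m_assoc)
  finally have eq: "\<i> \<beta>' \<cdot> \<beta> = f' \<cdot> \<i> f" .
  have "\<i> \<beta>' \<cdot> \<beta> \<in> F" unfolding eq using assms(3,4) by simp
  then have "\<i> \<beta>' \<cdot> \<beta> = \<e>" using assms(1,2) by (intro B_inf_F_trivial) simp_all
  moreover note eq
  ultimately have "\<i> \<beta>' \<cdot> \<beta> = \<e>" "f' \<cdot> \<i> f = \<e>" by auto
  then show "\<beta> = \<beta>'" "f = f'"
    using assms(1-4) by (metis PB.inv_equality PB.inv_inv PB.inv_closed B.mem_carrier F.mem_carrier)+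
qed

section \<open>The orders on braids and on the positive monoid\<close>

lemma less_B_irrefl: "(x, x) \<notin> less_B"
  using sigma_pos_notin_F[of _ \<e>] by (auto simp: less_B_iff)

lemma less_B_trans: "(x, y) \<in> less_B \<Longrightarrow> (y, z) \<in> less_B \<Longrightarrow> (x, z) \<in> less_B"
proof -
  assume "(x, y) \<in> less_B" "(y, z) \<in> less_B"
  then obtain i j where *: "x \<in> B_inf" "y \<in> B_inf" "z \<in> B_inf" "i \<ge> 1" "\<i> x \<cdot> y \<in> sigma_pos i"
    "j \<ge> 1" "\<i> y \<cdot> z \<in> sigma_pos j" unfolding less_B_iff by blast
  then have "\<i> x \<cdot> z = (\<i> x \<cdot> y) \<cdot> (\<i> y \<cdot> z)" by (simp add: PB.m_assoc)
  then show ?thesis unfolding less_B_iff using sigma_pos_mult[OF *(4,6,5,7)] * by simp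
qed

lemma less_B_mult:
  assumes "b \<in> B_inf" "(x, y) \<in> less_B" shows "(b \<cdot> x, b \<cdot> y) \<in> less_B"
proof -
  have "x \<in> B_inf" "y \<in> B_inf" using assms(2) by (auto simp: less_B_iff)
  then have "\<i> (b \<cdot> x) \<cdot> (b \<cdot> y) = \<i> x \<cdot> y"
    using assms(1) by (simp add: PB.inv_mult_group PB.m_assoc)
  then show ?thesis using assms by (simp add: less_B_iff)
qed

lemma B_inf_pos_B_inf' [simp]: "\<beta> \<in> B_inf_pos \<Longrightarrow> \<beta> \<in> B_inf"
  using B_inf_pos_B_inf by auto

text \<open>Uniqueness of the decomposition removes the existential quantifiers, and the order on
  \<open>PB_pos\<close> becomes a genuine lexicographic one.\<close>

lemma less_PB_pos_iff:
  assumes "\<beta> \<in> B_inf_pos" "\<beta>' \<in> B_inf_pos" "f \<in> F_pos" "f' \<in> F_pos"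
  shows "(\<beta> \<cdot> f, \<beta>' \<cdot> f') \<in> less_PB_pos
    \<longleftrightarrow> (\<beta>, \<beta>') \<in> less_B \<or> \<beta> = \<beta>' \<and> pl_less f f'"
proof
  assume "(\<beta> \<cdot> f, \<beta>' \<cdot> f') \<in> less_PB_pos"
  then obtain b g b' g' where *: "b \<in> B_inf_pos" "g \<in> F_pos" "b' \<in> B_inf_pos" "g' \<in> F_pos"
    "\<beta> \<cdot> f = b \<cdot> g" "\<beta>' \<cdot> f' = b' \<cdot> g'" "(b, b') \<in> less_B \<or> b = b' \<and> (g, g') \<in> less_F_pos"
    unfolding less_PB_pos_def by auto
  then have "\<beta> = b" "f = g" "\<beta>' = b'" "f' = g'"
    using decompose_unique[of \<beta> b f g] decompose_unique[of \<beta>' b' f' g'] assms by auto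
  then show "(\<beta>, \<beta>') \<in> less_B \<or> \<beta> = \<beta>' \<and> pl_less f f'" using * by (simp add: less_F_pos_iff)
next
  assume "(\<beta>, \<beta>') \<in> less_B \<or> \<beta> = \<beta>' \<and> pl_less f f'"
  then show "(\<beta> \<cdot> f, \<beta>' \<cdot> f') \<in> less_PB_pos"
    unfolding less_PB_pos_def using assms by (auto simp: less_F_pos_iff)
qed

lemma less_PB_posE:
  assumes "(x, x') \<in> less_PB_pos"
  obtains \<beta> f \<beta>' f' where "\<beta> \<in> B_inf_pos" "f \<in> F_pos" "\<beta>' \<in> B_inf_pos" "f' \<in> F_pos"
    "x = \<beta> \<cdot> f" "x' = \<beta>' \<cdot> f'" "(\<beta>, \<beta>') \<in> less_B \<or> \<beta> = \<beta>' \<and> pl_less f f'"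
  using assms unfolding less_PB_pos_def less_F_pos_iff by blast

lemma less_PB_pos_PB_pos: "(x, x') \<in> less_PB_pos \<Longrightarrow> x \<in> PB_pos \<and> x' \<in> PB_pos"
  using B_inf_pos_PB_pos F_pos_PB_pos by (elim less_PB_posE) auto

lemma less_PB_pos_irrefl: "(x, x) \<notin> less_PB_pos"
proof
  assume "(x, x) \<in> less_PB_pos"
  then obtain \<beta> f \<beta>' f' where *: "\<beta> \<in> B_inf_pos" "f \<in> F_pos" "\<beta>' \<in> B_inf_pos" "f' \<in> F_pos"
    "x = \<beta> \<cdot> f" "x = \<beta>' \<cdot> f'" "(\<beta>, \<beta>') \<in> less_B \<or> \<beta> = \<beta>' \<and> pl_less f f'"
    by (elim less_PB_posE)
  then have "\<beta> = \<beta>'" "f = f'" using decompose_unique[of \<beta> \<beta>' f f'] by auto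
  then show False using *(7) less_B_irrefl pl_less_irrefl by auto
qed

lemma less_PB_pos_trans:
  assumes "(x, y) \<in> less_PB_pos" "(y, z) \<in> less_PB_pos" shows "(x, z) \<in> less_PB_pos"
proof -
  obtain \<beta> f \<beta>' f' where 1: "\<beta> \<in> B_inf_pos" "f \<in> F_pos" "\<beta>' \<in> B_inf_pos" "f' \<in> F_pos"
    "x = \<beta> \<cdot> f" "y = \<beta>' \<cdot> f'" "(\<beta>, \<beta>') \<in> less_B \<or> \<beta> = \<beta>' \<and> pl_less f f'"
    using assms(1) by (elim less_PB_posE)
  obtain b b' g g' where 2: "b \<in> B_inf_pos" "g \<in> F_pos" "b' \<in> B_inf_pos" "g' \<in> F_pos"
    "y = b \<cdot> g" "z = b' \<cdot> g'" "(b, b') \<in> less_B \<or> b = b' \<and> pl_less g g'"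
    using assms(2) by (elim less_PB_posE)
  have "\<beta>' = b" "f' = g" using decompose_unique[of \<beta>' b f' g] 1 2 by auto
  then have "(\<beta>, b') \<in> less_B \<or> \<beta> = b' \<and> pl_less f g'"
    using 1(7) 2(7) less_B_trans pl_less_trans by blast
  then show ?thesis using less_PB_pos_iff[of \<beta> b' f g'] 1 2 by simp
qed

lemma less_PB_pos_total:
  assumes "x \<in> PB_pos" "y \<in> PB_pos"
  shows "x = y \<or> (x, y) \<in> less_PB_pos \<or> (y, x) \<in> less_PB_pos"
proof -
  obtain \<beta> f where x: "\<beta> \<in> B_inf_pos" "f \<in> F_pos" "x = \<beta> \<cdot> f"
    using PB_pos_decompose[OF assms(1)] by blast
  obtain \<gamma> g where y: "\<gamma> \<in> B_inf_pos" "g \<in> F_pos" "y = \<gamma> \<cdot> g"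
    using PB_pos_decompose[OF assms(2)] by blast
  show ?thesis
    unfolding x(3) y(3) less_PB_pos_iff[OF x(1) y(1) x(2) y(2)] less_PB_pos_iff[OF y(1) x(1) y(2) x(2)]
    using B_inf_pos_comparable[OF x(1) y(1)] pl_less_total[OF x(2) y(2)] by blast
qed

lemma less_PB_pos_thm_gen:
  assumes "1 \<le> k" "(x, x') \<in> less_PB_pos" shows "(thm_gen k \<cdot> x, thm_gen k \<cdot> x') \<in> less_PB_pos"
proof -
  obtain \<beta> f \<beta>' f' where x: "\<beta> \<in> B_inf_pos" "f \<in> F_pos" "\<beta>' \<in> B_inf_pos" "f' \<in> F_pos"
    "x = \<beta> \<cdot> f" "x' = \<beta>' \<cdot> f'" "(\<beta>, \<beta>') \<in> less_B \<or> \<beta> = \<beta>' \<and> pl_less f f'"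
    using assms(2) by (elim less_PB_posE)
  obtain c m where c: "c \<in> B_inf_pos" "1 \<le> m" "thm_gen k \<cdot> \<beta> = c \<cdot> thm_gen m"
    using braid_thm_gen_right[OF x(1) assms(1)] by blast
  have kx: "thm_gen k \<cdot> x = c \<cdot> (thm_gen m \<cdot> f)"
  proof -
    have "thm_gen k \<cdot> x = thm_gen k \<cdot> \<beta> \<cdot> f"
      unfolding x(5) using x(1,2) assms(1) by (simp add: PB.m_assoc)
    then show ?thesis unfolding c(3) using x(2) c(1,2) by (simp add: PB.m_assoc)
  qed
  have mf: "thm_gen m \<cdot> f \<in> F_pos" using c(2) x(2) by simp
  from x(7) show ?thesis
  proof
    assume *: "\<beta> = \<beta>' \<and> pl_less f f'"
    have "thm_gen k \<cdot> x' = thm_gen k \<cdot> \<beta> \<cdot> f'"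
      unfolding x(6) using x(1,4) assms(1) * by (simp add: PB.m_assoc)
    then have "thm_gen k \<cdot> x' = c \<cdot> (thm_gen m \<cdot> f')"
      unfolding c(3) using x(4) c(1,2) by (simp add: PB.m_assoc)
    then show ?thesis
      unfolding kx using less_PB_pos_iff[OF c(1) c(1) mf, of "thm_gen m \<cdot> f'"] x(2,4) c(2) *
      by (simp add: pl_less_mult)
  next
    assume lt: "(\<beta>, \<beta>') \<in> less_B"
    obtain c' m' where c': "c' \<in> B_inf_pos" "1 \<le> m'" "thm_gen k \<cdot> \<beta>' = c' \<cdot> thm_gen m'"
      using braid_thm_gen_right[OF x(3) assms(1)] by blast
    obtain i where i: "1 \<le> i" "\<i> \<beta> \<cdot> \<beta>' \<in> sigma_pos i" using lt by (auto simp: less_B_iff)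
    obtain j y l where y: "1 \<le> j" "y \<in> sigma_pos j" "1 \<le> l" "thm_gen m \<cdot> (\<i> \<beta> \<cdot> \<beta>') = y \<cdot> thm_gen l"
      using thm_gen_sigma_pos[OF c(2) i] by blast
    have yB: "y \<in> B_inf" using sigma_pos_tail_braids[OF y(1,2)] tail_braids_antimono[OF y(1)]
      by (auto simp: tail_braids_1[simplified])
    \<comment> \<open>The cabled quotient and \<open>c^{-1} c'\<close> are two braid parts of one
      element, so uniqueness identifies them even though the positions \<open>m\<close> and
      \<open>m'\<close> come from different braids. Positivity of \<open>y\<close> thus orders
      \<open>c\<close> and \<open>c'\<close>.\<close>
    have "y \<cdot> thm_gen l = \<i> c \<cdot> (c \<cdot> thm_gen m) \<cdot> (\<i> \<beta> \<cdot> \<beta>')"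
      unfolding y(4)[symmetric] using c(1,2) x(1,3) by (simp add: PB.m_assoc)
    also have "\<dots> = \<i> c \<cdot> (thm_gen k \<cdot> \<beta>')"
      unfolding c(3)[symmetric] using c(1) x(1,3) assms(1) by (simp add: PB.m_assoc)
    also have "\<dots> = (\<i> c \<cdot> c') \<cdot> thm_gen m'"
      unfolding c'(3) using c(1) c'(1,2) by (simp add: PB.m_assoc)
    finally have "y = \<i> c \<cdot> c'"
      using decompose_unique(1)[of y "\<i> c \<cdot> c'" "thm_gen l" "thm_gen m'"] yB c(1) c'(1,2) y(3) by simp
    then have "(c, c') \<in> less_B" unfolding less_B_iff using c(1) c'(1) y(1,2) by auto
    moreover have "thm_gen k \<cdot> x' = thm_gen k \<cdot> \<beta>' \<cdot> f'"
      unfolding x(6) using x(3,4) assms(1) by (simp add: PB.m_assoc)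
    then have "thm_gen k \<cdot> x' = c' \<cdot> (thm_gen m' \<cdot> f')"
      unfolding c'(3) using x(4) c'(1,2) by (simp add: PB.m_assoc)
    ultimately show ?thesis
      unfolding kx using less_PB_pos_iff[OF c(1) c'(1) mf, of "thm_gen m' \<cdot> f'"] x(4) c'(2) by simp
  qed
qed

lemma less_PB_pos_sig:
  assumes "1 \<le> i" "(x, x') \<in> less_PB_pos" shows "(sig i \<cdot> x, sig i \<cdot> x') \<in> less_PB_pos"
proof -
  obtain \<beta> f \<beta>' f' where x: "\<beta> \<in> B_inf_pos" "f \<in> F_pos" "\<beta>' \<in> B_inf_pos" "f' \<in> F_pos"
    "x = \<beta> \<cdot> f" "x' = \<beta>' \<cdot> f'" "(\<beta>, \<beta>') \<in> less_B \<or> \<beta> = \<beta>' \<and> pl_less f f'"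
    using assms(2) by (elim less_PB_posE)
  have "sig i \<cdot> x = sig i \<cdot> \<beta> \<cdot> f" "sig i \<cdot> x' = sig i \<cdot> \<beta>' \<cdot> f'"
    unfolding x(5,6) using x(1-4) assms(1) by (simp_all add: PB.m_assoc)
  then show ?thesis
    using less_PB_pos_iff[of "sig i \<cdot> \<beta>" "sig i \<cdot> \<beta>'" f f'] x assms(1) less_B_mult[of "sig i"] by auto
qed

lemma less_PB_pos_mult:
  "u \<in> PB_pos \<Longrightarrow> (x, x') \<in> less_PB_pos \<Longrightarrow> (u \<cdot> x, u \<cdot> x') \<in> less_PB_pos"
proof (induction arbitrary: x x' rule: PB_pos_induct)
  case one
  then show ?case using less_PB_pos_PB_pos[of x x'] by auto
next
  case (sig u i)
  have "x \<in> carrier PB" "x' \<in> carrier PB" using less_PB_pos_PB_pos[OF sig.prems] by auto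
  then show ?case
    using sig.IH[OF less_PB_pos_sig[OF sig.hyps(2) sig.prems]] sig.hyps by (simp add: PB.m_assoc)
next
  case (thm_gen u i)
  have "x \<in> carrier PB" "x' \<in> carrier PB" using less_PB_pos_PB_pos[OF thm_gen.prems] by auto
  then show ?case
    using thm_gen.IH[OF less_PB_pos_thm_gen[OF thm_gen.hyps(2) thm_gen.prems]] thm_gen.hyps
    by (simp add: PB.m_assoc)
qed

section \<open>The positive cone and the order on the group\<close>

lemma PB_cone_iff: "g \<in> PB_cone \<longleftrightarrow> (\<exists>x x'. g = \<i> x \<cdot> x' \<and> (x, x') \<in> less_PB_pos)"
  unfolding PB_cone_def mem_Collect_eq using less_PB_pos_PB_pos by metis

text \<open>A common left multiple \<open>u \<cdot> x' = v \<cdot> y\<close> of the inner terms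
  joins two comparisons into the chain \<open>u x < u x' = v y < v y'\<close>, where left invariance
  on the monoid gives each inequality.\<close>

lemma PB_cone_mult:
  assumes "g \<in> PB_cone" "h \<in> PB_cone" shows "g \<cdot> h \<in> PB_cone"
proof -
  obtain x x' where g: "g = \<i> x \<cdot> x'" "(x, x') \<in> less_PB_pos"
    using assms(1) unfolding PB_cone_iff by blast
  obtain y y' where h: "h = \<i> y \<cdot> y'" "(y, y') \<in> less_PB_pos"
    using assms(2) unfolding PB_cone_iff by blast
  have c: "x \<in> PB_pos" "x' \<in> PB_pos" "y \<in> PB_pos" "y' \<in> PB_pos"
    using less_PB_pos_PB_pos[OF g(2)] less_PB_pos_PB_pos[OF h(2)] by auto
  obtain u v where uv: "u \<in> PB_pos" "v \<in> PB_pos" "u \<cdot> x' = v \<cdot> y"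
    using left_oreE[OF left_ore_PB_pos c(2,3)] .
  have "g \<cdot> h = \<i> (u \<cdot> x) \<cdot> (u \<cdot> x') \<cdot> (\<i> y \<cdot> y')"
    unfolding g(1) h(1) using c uv(1) by (simp add: PB.inv_mult_group PB.m_assoc)
  also have "\<dots> = \<i> (u \<cdot> x) \<cdot> (v \<cdot> y')" unfolding uv(3) using c uv(1,2) by (simp add: PB.m_assoc)
  finally show ?thesis
    using less_PB_pos_trans[OF less_PB_pos_mult[OF uv(1) g(2)]] less_PB_pos_mult[OF uv(2) h(2)] uv(3)
    unfolding PB_cone_iff by auto
qed

lemma one_notin_PB_cone: "\<e> \<notin> PB_cone"
proof
  assume "\<e> \<in> PB_cone"
  then obtain x x' where x: "\<e> = \<i> x \<cdot> x'" "(x, x') \<in> less_PB_pos"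
    unfolding PB_cone_iff by blast
  have c: "x \<in> carrier PB" "x' \<in> carrier PB" using less_PB_pos_PB_pos[OF x(2)] by auto
  have "x \<cdot> (\<i> x \<cdot> x') = x" unfolding x(1)[symmetric] using c by simp
  then have "x = x'" using c by simp
  then show False using x(2) less_PB_pos_irrefl by simp
qed

text \<open>Passing to fractions adds no comparisons on \<open>PB_pos\<close>: a fraction may be in
  the cone through another representation, but by totality the alternative would be the reverse
  comparison, which puts the unit into the cone.\<close>

lemma less_PB_pos_iff_PB_cone:
  assumes "x \<in> PB_pos" "x' \<in> PB_pos" shows "\<i> x \<cdot> x' \<in> PB_cone \<longleftrightarrow> (x, x') \<in> less_PB_pos"
proof
  assume *: "\<i> x \<cdot> x' \<in> PB_cone"
  have c: "x \<in> carrier PB" "x' \<in> carrier PB" using assms by auto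
  have "x \<noteq> x'" using * one_notin_PB_cone c by auto
  moreover have "(x', x) \<notin> less_PB_pos"
  proof
    assume "(x', x) \<in> less_PB_pos"
    then have "\<i> x' \<cdot> x \<in> PB_cone" unfolding PB_cone_iff by blast
    with * have "\<i> x \<cdot> x' \<cdot> (\<i> x' \<cdot> x) \<in> PB_cone" by (rule PB_cone_mult)
    then show False using one_notin_PB_cone c by (simp add: PB.m_assoc)
  qed
  ultimately show "(x, x') \<in> less_PB_pos" using less_PB_pos_total[OF assms] by blast
next
  assume "(x, x') \<in> less_PB_pos"
  then show "\<i> x \<cdot> x' \<in> PB_cone" unfolding PB_cone_iff by blast
qed

lemma PB_cone_total:
  assumes "g \<in> carrier PB" shows "g = \<e> \<or> g \<in> PB_cone \<or> \<i> g \<in> PB_cone"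
proof -
  obtain p q where pq: "p \<in> PB_pos" "q \<in> PB_pos" "g = \<i> p \<cdot> q" using PB_fraction[OF assms] by blast
  have g': "\<i> g = \<i> q \<cdot> p" unfolding pq(3) using pq(1,2) by (simp add: PB.inv_mult_group)
  consider "p = q" | "(p, q) \<in> less_PB_pos" | "(q, p) \<in> less_PB_pos"
    using less_PB_pos_total[OF pq(1,2)] by blast
  then show ?thesis
  proof cases
    case 1
    then show ?thesis using pq by simp
  next
    case 2
    then have "g \<in> PB_cone" unfolding pq(3) less_PB_pos_iff_PB_cone[OF pq(1,2)] .
    then show ?thesis by blast
  next
    case 3
    then have "\<i> g \<in> PB_cone" unfolding g' less_PB_pos_iff_PB_cone[OF pq(2,1)] .
    then show ?thesis by blast
  qed
qed

lemma less_PB_pos_shift: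
  assumes "(x, x') \<in> less_PB_pos" shows "(shift x, shift x') \<in> less_PB_pos"
proof -
  obtain \<beta> f \<beta>' f' where x: "\<beta> \<in> B_inf_pos" "f \<in> F_pos" "\<beta>' \<in> B_inf_pos" "f' \<in> F_pos"
    "x = \<beta> \<cdot> f" "x' = \<beta>' \<cdot> f'" "(\<beta>, \<beta>') \<in> less_B \<or> \<beta> = \<beta>' \<and> pl_less f f'"
    using assms by (elim less_PB_posE)
  have B: "shift b \<in> B_inf_pos" if "b \<in> B_inf_pos" for b
    using that by (induction rule: B_inf_pos_induct) (auto simp: shift_sig)
  have "(shift \<beta>, shift \<beta>') \<in> less_B" if *: "(\<beta>, \<beta>') \<in> less_B"
  proof -
    obtain i where "1 \<le> i" "\<i> \<beta> \<cdot> \<beta>' \<in> sigma_pos i" using * by (auto simp: less_B_iff)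
    then have "shift (\<i> \<beta> \<cdot> \<beta>') \<in> sigma_pos (Suc i)" by (intro shift_sigma_pos)
    then show ?thesis using x(1,3) B unfolding less_B_iff by auto
  qed
  moreover have "pl_less (shift f) (shift f')" if "pl_less f f'"
    using that first_diff_shift[of _ f f'] x(2,4) unfolding pl_less_def by auto
  ultimately have "(shift \<beta>, shift \<beta>') \<in> less_B \<or> shift \<beta> = shift \<beta>' \<and> pl_less (shift f) (shift f')"
    using x(7) by blast
  then show ?thesis
    unfolding x(5,6) using less_PB_pos_iff[of "shift \<beta>" "shift \<beta>'" "shift f" "shift f'"] B x(1-4)
    by (simp add: shift_F_pos)
qed

lemma PB_cone_shift:
  assumes "g \<in> PB_cone" shows "shift g \<in> PB_cone"
proof -
  obtain x x' where g: "g = \<i> x \<cdot> x'" "(x, x') \<in> less_PB_pos"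
    using assms unfolding PB_cone_iff by blast
  then have "shift g = \<i> shift x \<cdot> shift x'" using less_PB_pos_PB_pos[OF g(2)] by simp
  then show ?thesis using less_PB_pos_shift[OF g(2)] unfolding PB_cone_iff by blast
qed

text \<open>Both relations depend only on the quotient of the two braids, which can be rewritten as
  a fraction of positive braids.\<close>

lemma less_PB_B_inf_iff:
  assumes "\<beta> \<in> B_inf" "\<beta>' \<in> B_inf" shows "(\<beta>, \<beta>') \<in> less_PB \<longleftrightarrow> (\<beta>, \<beta>') \<in> less_B"
proof -
  have "\<i> \<beta> \<cdot> \<beta>' \<in> B_inf" using assms by simp
  then obtain p q where pq: "p \<in> B_inf_pos" "q \<in> B_inf_pos" "\<i> \<beta> \<cdot> \<beta>' = \<i> p \<cdot> q"
    using B_inf_fraction by blast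
  have "(\<beta>, \<beta>') \<in> less_PB \<longleftrightarrow> (p, q) \<in> less_PB_pos"
    unfolding less_PB_def using less_PB_pos_iff_PB_cone[of p q] pq assms B_inf_pos_PB_pos by auto
  also have "\<dots> \<longleftrightarrow> (p, q) \<in> less_B"
    using less_PB_pos_iff[OF pq(1,2), of \<e> \<e>] pq(1,2) pl_less_irrefl by simp
  also have "\<dots> \<longleftrightarrow> (\<beta>, \<beta>') \<in> less_B"
    unfolding less_B_iff using pq assms by simp
  finally show ?thesis .
qed

lemma less_PB_F_iff:
  assumes "f \<in> F" "f' \<in> F" shows "(f, f') \<in> less_PB \<longleftrightarrow> (f, f') \<in> less_F"
proof -
  \<comment> \<open>The equivalence is shown for every admissible multiplier \<open>h\<close>, so
    the existential one in \<open>less_F\<close> serves both directions; a common left multiple of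
    the two denominators shows that an admissible \<open>h\<close> exists.\<close>
  have *: "(f, f') \<in> less_PB \<longleftrightarrow> (h \<cdot> f, h \<cdot> f') \<in> less_F_pos"
    if h: "h \<in> F_pos" "h \<cdot> f \<in> F_pos" "h \<cdot> f' \<in> F_pos" for h
  proof -
    have "\<i> (h \<cdot> f) \<cdot> (h \<cdot> f') = \<i> f \<cdot> f'"
      using h(1) assms by (simp add: PB.inv_mult_group PB.m_assoc)
    then have "(f, f') \<in> less_PB \<longleftrightarrow> (h \<cdot> f, h \<cdot> f') \<in> less_PB_pos"
      unfolding less_PB_def
      using less_PB_pos_iff_PB_cone[of "h \<cdot> f" "h \<cdot> f'"] h assms F_pos_PB_pos by auto
    then show ?thesis
      using less_PB_pos_iff[of \<e> \<e> "h \<cdot> f" "h \<cdot> f'"] h less_B_irrefl assms by (simp add: less_F_pos_iff)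
  qed
  obtain p q where pq: "p \<in> F_pos" "q \<in> F_pos" "f = \<i> p \<cdot> q" using F_fraction[OF assms(1)] by blast
  obtain r s where rs: "r \<in> F_pos" "s \<in> F_pos" "f' = \<i> r \<cdot> s" using F_fraction[OF assms(2)] by blast
  obtain u v where uv: "u \<in> F_pos" "v \<in> F_pos" "u \<cdot> p = v \<cdot> r"
    using left_oreE[OF left_ore_F_pos pq(1) rs(1)] .
  have "u \<cdot> p \<cdot> f = u \<cdot> q" unfolding pq(3) using pq(1,2) uv(1) by (simp add: PB.m_assoc)
  moreover have "u \<cdot> p \<cdot> f' = v \<cdot> s"
    unfolding uv(3) rs(3) using rs(1,2) uv(2) by (simp add: PB.m_assoc)
  ultimately have "u \<cdot> p \<in> F_pos \<and> u \<cdot> p \<cdot> f \<in> F_pos \<and> u \<cdot> p \<cdot> f' \<in> F_pos" using pq uv rs by simp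
  then show ?thesis using * assms unfolding less_F_def by blast
qed

theorem proposition4p11:
  shows "strict_linear_order_on (carrier PB) less_PB
    \<and> (\<forall>x x' y. (x, x') \<in> less_PB \<longrightarrow> y \<in> carrier PB \<longrightarrow> (y \<otimes>\<^bsub>PB\<^esub> x, y \<otimes>\<^bsub>PB\<^esub> x') \<in> less_PB)
    \<and> (\<forall>x x'. (x, x') \<in> less_PB \<longrightarrow> (shift x, shift x') \<in> less_PB)
    \<and> (\<forall>x\<in>PB_pos. \<forall>x'\<in>PB_pos. (x, x') \<in> less_PB \<longleftrightarrow> (x, x') \<in> less_PB_pos)
    \<and> (\<forall>\<beta>\<in>B_inf. \<forall>\<beta>'\<in>B_inf. (\<beta>, \<beta>') \<in> less_PB \<longleftrightarrow> (\<beta>, \<beta>') \<in> less_B)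
    \<and> (\<forall>f\<in>F. \<forall>f'\<in>F. (f, f') \<in> less_PB \<longleftrightarrow> (f, f') \<in> less_F)"
proof (intro conjI ballI allI impI)
  show "strict_linear_order_on (carrier PB) less_PB"
    unfolding strict_linear_order_on_def
  proof (intro conjI)
    show "trans less_PB"
    proof (rule transI)
      fix x y z assume *: "(x, y) \<in> less_PB" "(y, z) \<in> less_PB"
      then have c: "x \<in> carrier PB" "y \<in> carrier PB" "z \<in> carrier PB" by (auto simp: less_PB_def)
      have "(\<i> x \<cdot> y) \<cdot> (\<i> y \<cdot> z) \<in> PB_cone"
        using * PB_cone_mult[of "\<i> x \<cdot> y" "\<i> y \<cdot> z"] by (simp add: less_PB_def)
      then show "(x, z) \<in> less_PB" using c by (simp add: less_PB_def PB.m_assoc)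
    qed
    show "irrefl less_PB"
      using one_notin_PB_cone by (auto simp: irrefl_def less_PB_def)
    show "total_on (carrier PB) less_PB"
    proof (rule total_onI)
      fix x y assume c: "x \<in> carrier PB" "y \<in> carrier PB" "x \<noteq> y"
      have "\<i> x \<cdot> y \<noteq> \<e>"
      proof
        assume "\<i> x \<cdot> y = \<e>"
        then have "x \<cdot> (\<i> x \<cdot> y) = x" using c by simp
        then show False using c by simp
      qed
      then show "(x, y) \<in> less_PB \<or> (y, x) \<in> less_PB"
        using PB_cone_total[of "\<i> x \<cdot> y"] c by (auto simp: less_PB_def PB.inv_mult_group)
    qed
  qed
next
  fix x x' y assume *: "(x, x') \<in> less_PB" "y \<in> carrier PB"
  then have "\<i> (y \<cdot> x) \<cdot> (y \<cdot> x') = \<i> x \<cdot> x'"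
    by (simp add: less_PB_def PB.inv_mult_group PB.m_assoc)
  then show "(y \<cdot> x, y \<cdot> x') \<in> less_PB" using * by (simp add: less_PB_def)
next
  fix x x' assume "(x, x') \<in> less_PB"
  then show "(shift x, shift x') \<in> less_PB"
    using PB_cone_shift[of "\<i> x \<cdot> x'"] by (simp add: less_PB_def)
next
  fix x x' assume "x \<in> PB_pos" "x' \<in> PB_pos"
  then show "(x, x') \<in> less_PB \<longleftrightarrow> (x, x') \<in> less_PB_pos"
    by (simp add: less_PB_def less_PB_pos_iff_PB_cone)
qed (simp_all add: less_PB_B_inf_iff less_PB_F_iff)

end
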